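(* Let $\mathcal{M}$ be a complete Riemannian manifold and let $f\colon\mathcal{M}\to\mathbb{R}$ be twice continuously differentiable. Assume (a) there is a finite $f_{\mathrm{low}}$ with $f(x)\ge f_{\mathrm{low}}$ for all $x\in\mathcal{M}$, and (b) $f$ has an $L$-Lipschitz continuous Riemannian Hessian for some constant $L$. Let $x_0\in\mathcal{M}$ and consider any run of the ARC algorithm (described in the context) started at $x_0$ with the exponential retraction $\mathrm{R}=\mathrm{Exp}$. Then for any $\varepsilon>0$ the algorithm produces an iterate $x_k\in\mathcal{M}$ such that $f(x_k)\le f(x_0)$, $\|\mathrm{grad} f(x_k)\|_{x_k}\le\varepsilon$ and, if the second-order progress condition is enforced at each iteration, also $\lambda_{\min}(\mathrm{Hess} f(x_k))\ge-\sqrt{\varepsilon}$, with $k=\tilde O(1/\varepsilon^{1.5})$. The bound on $k$ is dimension- and curvature-free: that is, $k\le C\,(1+\varepsilon^{-1.5})(1+|\log\varepsilon|)^p$ with constants $C,p\geq 0$ that depend only on $f(x_0)-f_{\mathrm{low}}$, $L$ and the algorithm parameters $\theta,\varsigma_{\min},\varsigma_0,\eta_1,\eta_2,\gamma_1,\gamma_2,\gamma_3$.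
   Context: Notation. $\mathrm{T}_x\mathcal{M}$ is the tangent space at $x$ with Riemannian inner product $\langle\cdot,\cdot\rangle$ and norm $\|\cdot\|$ (or $\|\cdot\|_x$); $\mathrm{grad} f$ and $\mathrm{Hess} f$ are the Riemannian gradient and Hessian; $\lambda_{\min}$ is the smallest eigenvalue of a self-adjoint operator; $\nabla,\nabla^2$ are the usual gradient and Hessian of functions on the Euclidean space $\mathrm{T}_x\mathcal{M}$. $\mathrm{Exp}$ is the Riemannian exponential map. Lipschitz Hessian. For $s\in \mathrm{T}_x\mathcal{M}$, $P_s\colon\mathrm{T}_x\mathcal{M}\to\mathrm{T}_{\mathrm{Exp}_x(s)}\mathcal{M}$ is parallel transport along $t\mapsto\mathrm{Exp}_x(ts)$ from $t=0$ to $t=1$. $f$ has an $L$-Lipschitz continuous Hessian if it is twice differentiable and for all $(x,s)$ in the domain of $\mathrm{Exp}$, $\|P_s^{-1}\circ\mathrm{Hess} f(\mathrm{Exp}_x(s))\circ P_s-\mathrm{Hess} f(x)\|_{\mathrm{op}}\le L\|s\|$. ARC algorithm with retraction $\mathrm{R}$. Parameters: $\theta>0$, $\varsigma_{\min}>0$, $0<\eta_1\le\eta_2<1$, $0<\gamma_1<1<\gamma_2<\gamma_3$. Input: $x_0\in\mathcal{M}$, $\varsigma_0\ge\varsigma_{\min}$. For $k=0,1,2,\ldots$: let $\hat f_k=f\circ\mathrm{R}_{x_k}\colon\mathrm{T}_{x_k}\mathcal{M}\to\mathbb{R}$ (the pullback) and define the model $m_k(s)=\hat f_k(0)+\langle s,\nabla\hat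 f_k(0)\rangle+\frac12\langle s,\nabla^2\hat f_k(0)[s]\rangle+\frac{\varsigma_k}{3}\|s\|^3$ on $\mathrm{T}_{x_k}\mathcal{M}$. A subproblem solver returns any $s_k\in\mathrm{T}_{x_k}\mathcal{M}$ satisfying the first-order progress conditions $m_k(s_k)\le m_k(0)$ and $\|\nabla m_k(s_k)\|\le\theta\|s_k\|^2$; optionally (when "second-order progress is enforced") $s_k$ must also satisfy $\lambda_{\min}(\nabla^2m_k(s_k))\ge-\theta\|s_k\|$. If $s_k=0$, terminate. Otherwise compute $\rho_k=\dfrac{f(x_k)-f(\mathrm{R}_{x_k}(s_k))}{m_k(0)-m_k(s_k)+\frac{\varsigma_k}{3}\|s_k\|^3}$. If $\rho_k\ge\eta_1$ (iteration $k$ is successful), set $x_{k+1}=\mathrm{R}_{x_k}(s_k)$; otherwise (unsuccessful) set $x_{k+1}=x_k$. Choose $\varsigma_{k+1}\in[\max(\varsigma_{\min},\gamma_1\varsigma_k),\varsigma_k]$ if $\rho_k\ge\eta_2$; $\varsigma_{k+1}\in[\varsigma_k,\gamma_2\varsigma_k]$ if $\rho_k\in[\eta_1,\eta_2)$; $\varsigma_{k+1}\in[\gamma_2\varsigma_k,\gamma_3\varsigma_k]$ if $\rho_k<\eta_1$. *)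

theory Defs
  imports "HOL-Analysis.Analysis"
begin

section \<open>Gradients and Hessians with respect to an inner product\<close>

text \<open>
  Tangent spaces are represented by the model space 'e equipped with a point-dependent inner
  product B. In finite dimension the Frechet derivative does not depend on the norm, so the
  derivative of the type class can be used; only the Riesz representation involves B.
\<close>

definition inner_product :: "('e::real_vector \<Rightarrow> 'e \<Rightarrow> real) \<Rightarrow> bool" where
  "inner_product B \<longleftrightarrow>
     bilinear B \<and> (\<forall>u v. B u v = B v u) \<and> (\<forall>v. v \<noteq> 0 \<longrightarrow> B v v > 0)"

definition norm_wrt :: "('e \<Rightarrow> 'e \<Rightarrow> real) \<Rightarrow> 'e \<Rightarrow> real" where
  "norm_wrt B v = sqrt (B v v)"

definition op_norm_wrt ::
  "('e \<Rightarrow> 'e \<Rightarrow> real) \<Rightarrow> ('e \<Rightarrow> 'e) \<Rightarrow> real" where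
  "op_norm_wrt B A = (SUP v\<in>{v. norm_wrt B v \<le> 1}. norm_wrt B (A v))"

definition gradient ::
  "('e \<Rightarrow> 'e \<Rightarrow> real) \<Rightarrow> ('e::euclidean_space \<Rightarrow> real) \<Rightarrow> 'e \<Rightarrow> 'e" where
  "gradient B h s = (THE g. (h has_derivative (\<lambda>v. B g v)) (at s))"

definition hessian ::
  "('e \<Rightarrow> 'e \<Rightarrow> real) \<Rightarrow> ('e::euclidean_space \<Rightarrow> real) \<Rightarrow> 'e \<Rightarrow> 'e \<Rightarrow> 'e" where
  "hessian B h s = frechet_derivative (gradient B h) (at s)"

definition min_eigenvalue :: "('e::real_vector \<Rightarrow> 'e) \<Rightarrow> real" where
  "min_eigenvalue A = (LEAST l. \<exists>v. v \<noteq> 0 \<and> A v = l *\<^sub>R v)"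


section \<open>Riemannian manifolds\<close>

fun Ck_on :: "nat \<Rightarrow> ('a::euclidean_space \<Rightarrow> 'b::real_normed_vector) \<Rightarrow> 'a set \<Rightarrow> bool" where
  "Ck_on 0 f S \<longleftrightarrow> continuous_on S f"
| "Ck_on (Suc k) f S \<longleftrightarrow>
     (\<forall>x\<in>S. f differentiable (at x)) \<and> (\<forall>v. Ck_on k (\<lambda>x. frechet_derivative f (at x) v) S)"

definition smooth_on :: "('a::euclidean_space \<Rightarrow> 'b::real_normed_vector) \<Rightarrow> 'a set \<Rightarrow> bool" where
  "smooth_on f S \<longleftrightarrow> (\<forall>k. Ck_on k f S)"

record ('m, 'e) chart =
  chart_dom :: "'m set"
  chart_map :: "'m \<Rightarrow> 'e"

definition chart_inv :: "('m, 'e) chart \<Rightarrow> 'e \<Rightarrow> 'm" where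
  "chart_inv c = inv_into (chart_dom c) (chart_map c)"

definition chart_img :: "('m, 'e) chart \<Rightarrow> 'e set" where
  "chart_img c = chart_map c ` chart_dom c"

text \<open>
  The manifold is the whole type 'm. Every point x has a preferred chart, and a tangent vector at x
  is identified with its coordinates in that chart, so that every tangent space is a copy of 'e.
  The field metric gives the inner product on the tangent space at x in these coordinates.
\<close>

record ('m, 'e) riem =
  atlas :: "('m, 'e) chart set"
  chart_at :: "'m \<Rightarrow> ('m, 'e) chart"
  metric :: "'m \<Rightarrow> 'e \<Rightarrow> 'e \<Rightarrow> real"

text \<open>Coordinates in the chart c of a tangent vector at x, and the inverse conversion.\<close>

definition to_chart ::
  "('m, 'e::euclidean_space) riem \<Rightarrow> ('m, 'e) chart \<Rightarrow> 'm \<Rightarrow> 'e \<Rightarrow> 'e" where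
  "to_chart M c x =
     frechet_derivative (chart_map c \<circ> chart_inv (chart_at M x)) (at (chart_map (chart_at M x) x))"

definition from_chart ::
  "('m, 'e::euclidean_space) riem \<Rightarrow> ('m, 'e) chart \<Rightarrow> 'm \<Rightarrow> 'e \<Rightarrow> 'e" where
  "from_chart M c x =
     frechet_derivative (chart_map (chart_at M x) \<circ> chart_inv c) (at (chart_map c x))"

definition chart_metric ::
  "('m, 'e::euclidean_space) riem \<Rightarrow> ('m, 'e) chart \<Rightarrow> 'e \<Rightarrow> 'e \<Rightarrow> 'e \<Rightarrow> real" where
  "chart_metric M c p u v =
     metric M (chart_inv c p) (from_chart M c (chart_inv c p) u) (from_chart M c (chart_inv c p) v)"

definition riemannian_manifold ::
  "('m::{t2_space, second_countable_topology}, 'e::euclidean_space) riem \<Rightarrow> bool" where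
  "riemannian_manifold M \<longleftrightarrow>
     (\<forall>c\<in>atlas M. open (chart_dom c) \<and> open (chart_img c) \<and>
        homeomorphism (chart_dom c) (chart_img c) (chart_map c) (chart_inv c)) \<and>
     (\<forall>x. chart_at M x \<in> atlas M \<and> x \<in> chart_dom (chart_at M x)) \<and>
     (\<forall>c\<in>atlas M. \<forall>d\<in>atlas M.
        smooth_on (chart_map d \<circ> chart_inv c) (chart_map c ` (chart_dom c \<inter> chart_dom d))) \<and>
     (\<forall>x. inner_product (metric M x)) \<and>
     (\<forall>c\<in>atlas M. \<forall>u v. smooth_on (\<lambda>p. chart_metric M c p u v) (chart_img c))"

text \<open>
  Christoffel symbols of the Levi-Civita connection in the chart c, as a bilinear map: the
  component formula with the first index lowered.
\<close>

definition christoffel ::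
  "('m, 'e::euclidean_space) riem \<Rightarrow> ('m, 'e) chart \<Rightarrow> 'e \<Rightarrow> 'e \<Rightarrow> 'e \<Rightarrow> 'e" where
  "christoffel M c p u v =
     (let D = (\<lambda>a b w. frechet_derivative (\<lambda>q. chart_metric M c q a b) (at p) w)
      in THE z. \<forall>w. chart_metric M c p z w = (D v w u + D u w v - D u v w) / 2)"

text \<open>
  A vector field assigns to x a tangent vector at x. Its covariant derivative at x is computed in
  the preferred chart of x, whose coordinates are those of the tangent space at x.
\<close>

definition cov_deriv ::
  "('m, 'e::euclidean_space) riem \<Rightarrow> ('m \<Rightarrow> 'e) \<Rightarrow> 'm \<Rightarrow> 'e \<Rightarrow> 'e" where
  "cov_deriv M V x v =
     (let c = chart_at M x; p = chart_map c x
      in frechet_derivative (\<lambda>q. to_chart M c (chart_inv c q) (V (chart_inv c q))) (at p) v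
         + christoffel M c p v (V x))"

definition rgrad ::
  "('m, 'e::euclidean_space) riem \<Rightarrow> ('m \<Rightarrow> real) \<Rightarrow> 'm \<Rightarrow> 'e" where
  "rgrad M f x =
     (let c = chart_at M x in gradient (metric M x) (f \<circ> chart_inv c) (chart_map c x))"

definition rhess ::
  "('m, 'e::euclidean_space) riem \<Rightarrow> ('m \<Rightarrow> real) \<Rightarrow> 'm \<Rightarrow> 'e \<Rightarrow> 'e" where
  "rhess M f x = cov_deriv M (rgrad M f) x"

definition C2_on_manifold ::
  "('m, 'e::euclidean_space) riem \<Rightarrow> ('m \<Rightarrow> real) \<Rightarrow> bool" where
  "C2_on_manifold M f \<longleftrightarrow> (\<forall>c\<in>atlas M. Ck_on 2 (f \<circ> chart_inv c) (chart_img c))"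


section \<open>Geodesics, exponential map and parallel transport\<close>

text \<open>
  V is a parallel vector field along the curve g on the interval I: its covariant derivative along
  g vanishes, in every chart around every point of the curve.
\<close>

definition parallel_along ::
  "('m, 'e::euclidean_space) riem \<Rightarrow> (real \<Rightarrow> 'm) \<Rightarrow> real set \<Rightarrow> (real \<Rightarrow> 'e) \<Rightarrow> bool" where
  "parallel_along M g I V \<longleftrightarrow>
     (\<forall>c\<in>atlas M. \<forall>t\<in>I. g t \<in> chart_dom c \<longrightarrow>
        ((\<lambda>r. to_chart M c (g r) (V r)) has_vector_derivative
           - christoffel M c (chart_map c (g t))
               (vector_derivative (chart_map c \<circ> g) (at t within I))
               (to_chart M c (g t) (V t))) (at t within I))"

definition velocity ::
  "('m, 'e::euclidean_space) riem \<Rightarrow> (real \<Rightarrow> 'm) \<Rightarrow> real \<Rightarrow> 'e" where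
  "velocity M g t = vector_derivative (chart_map (chart_at M (g t)) \<circ> g) (at t)"

definition geodesic ::
  "('m::topological_space, 'e::euclidean_space) riem \<Rightarrow> (real \<Rightarrow> 'm) \<Rightarrow> bool" where
  "geodesic M g \<longleftrightarrow>
     continuous_on UNIV g \<and>
     (\<forall>c\<in>atlas M. \<forall>t. g t \<in> chart_dom c \<longrightarrow> (chart_map c \<circ> g) differentiable (at t)) \<and>
     parallel_along M g UNIV (velocity M g)"

text \<open>Geodesic completeness: every geodesic extends to the whole real line.\<close>

definition complete_riemannian_manifold ::
  "('m::{t2_space, second_countable_topology}, 'e::euclidean_space) riem \<Rightarrow> bool" where
  "complete_riemannian_manifold M \<longleftrightarrow>
     riemannian_manifold M \<and> (\<forall>x s. \<exists>g. geodesic M g \<and> g 0 = x \<and> velocity M g 0 = s)"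

text \<open>
  Only geodesics on the whole line are considered, which is the right notion on a complete
  manifold; there the exponential map is defined on all tangent vectors.
\<close>

definition Exp ::
  "('m::topological_space, 'e::euclidean_space) riem \<Rightarrow> 'm \<Rightarrow> 'e \<Rightarrow> 'm" where
  "Exp M x s = (THE y. \<exists>g. geodesic M g \<and> g 0 = x \<and> velocity M g 0 = s \<and> g 1 = y)"

definition transport ::
  "('m::topological_space, 'e::euclidean_space) riem \<Rightarrow> 'm \<Rightarrow> 'e \<Rightarrow> 'e \<Rightarrow> 'e" where
  "transport M x s u =
     (THE w. \<exists>V. parallel_along M (\<lambda>t. Exp M x (t *\<^sub>R s)) {0..1} V \<and> V 0 = u \<and> V 1 = w)"

definition lipschitz_hessian ::
  "('m::topological_space, 'e::euclidean_space) riem \<Rightarrow> ('m \<Rightarrow> real) \<Rightarrow> real \<Rightarrow> bool" where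
  "lipschitz_hessian M f L \<longleftrightarrow>
     (\<forall>x s. op_norm_wrt (metric M x)
        (\<lambda>v. inv (transport M x s) (rhess M f (Exp M x s) (transport M x s v)) - rhess M f x v)
        \<le> L * norm_wrt (metric M x) s)"


section \<open>Adaptive regularization with cubics\<close>

record arc_params =
  theta :: real
  sigma_min :: real
  eta1 :: real
  eta2 :: real
  gamma1 :: real
  gamma2 :: real
  gamma3 :: real

definition valid_params :: "arc_params \<Rightarrow> bool" where
  "valid_params P \<longleftrightarrow>
     theta P > 0 \<and> sigma_min P > 0 \<and> 0 < eta1 P \<and> eta1 P \<le> eta2 P \<and> eta2 P < 1 \<and>
     0 < gamma1 P \<and> gamma1 P < 1 \<and> 1 < gamma2 P \<and> gamma2 P < gamma3 P"

definition cubic_model ::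
  "('m, 'e::euclidean_space) riem \<Rightarrow> ('m \<Rightarrow> 'e \<Rightarrow> 'm) \<Rightarrow> ('m \<Rightarrow> real) \<Rightarrow> 'm \<Rightarrow> real \<Rightarrow> 'e \<Rightarrow> real" where
  "cubic_model M R f x \<sigma> s =
     (let B = metric M x; h = (\<lambda>u. f (R x u))
      in h 0 + B s (gradient B h 0) + B s (hessian B h 0 s) / 2 + \<sigma> / 3 * norm_wrt B s ^ 3)"

definition first_order_progress ::
  "('m, 'e::euclidean_space) riem \<Rightarrow> ('m \<Rightarrow> 'e \<Rightarrow> 'm) \<Rightarrow> ('m \<Rightarrow> real) \<Rightarrow> arc_params \<Rightarrow>
     'm \<Rightarrow> real \<Rightarrow> 'e \<Rightarrow> bool" where
  "first_order_progress M R f P x \<sigma> s \<longleftrightarrow>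
     (let B = metric M x; m = cubic_model M R f x \<sigma>
      in m s \<le> m 0 \<and> norm_wrt B (gradient B m s) \<le> theta P * (norm_wrt B s)\<^sup>2)"

definition second_order_progress ::
  "('m, 'e::euclidean_space) riem \<Rightarrow> ('m \<Rightarrow> 'e \<Rightarrow> 'm) \<Rightarrow> ('m \<Rightarrow> real) \<Rightarrow> arc_params \<Rightarrow>
     'm \<Rightarrow> real \<Rightarrow> 'e \<Rightarrow> bool" where
  "second_order_progress M R f P x \<sigma> s \<longleftrightarrow>
     (let B = metric M x; m = cubic_model M R f x \<sigma>
      in min_eigenvalue (hessian B m s) \<ge> - theta P * norm_wrt B s)"

definition arc_ratio ::
  "('m, 'e::euclidean_space) riem \<Rightarrow> ('m \<Rightarrow> 'e \<Rightarrow> 'm) \<Rightarrow> ('m \<Rightarrow> real) \<Rightarrow> 'm \<Rightarrow> real \<Rightarrow> 'e \<Rightarrow> real" where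
  "arc_ratio M R f x \<sigma> s =
     (let B = metric M x; m = cubic_model M R f x \<sigma>
      in (f x - f (R x s)) / (m 0 - m s + \<sigma> / 3 * norm_wrt B s ^ 3))"

text \<open>
  A run is encoded by infinite sequences that are constrained only until termination: iterate k is
  produced iff no earlier step vanishes, and nothing is required beyond the first zero step.
\<close>

definition produced :: "(nat \<Rightarrow> 'e::zero) \<Rightarrow> nat \<Rightarrow> bool" where
  "produced s k \<longleftrightarrow> (\<forall>j<k. s j \<noteq> 0)"

definition arc_run ::
  "('m, 'e::euclidean_space) riem \<Rightarrow> ('m \<Rightarrow> 'e \<Rightarrow> 'm) \<Rightarrow> ('m \<Rightarrow> real) \<Rightarrow> arc_params \<Rightarrow>
     (nat \<Rightarrow> 'm) \<Rightarrow> (nat \<Rightarrow> 'e) \<Rightarrow> (nat \<Rightarrow> real) \<Rightarrow> bool" where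
  "arc_run M R f P x s \<sigma> \<longleftrightarrow>
     \<sigma> 0 \<ge> sigma_min P \<and>
     (\<forall>k. produced s k \<longrightarrow>
        first_order_progress M R f P (x k) (\<sigma> k) (s k) \<and>
        (s k \<noteq> 0 \<longrightarrow>
           (let \<rho> = arc_ratio M R f (x k) (\<sigma> k) (s k)
            in x (Suc k) = (if \<rho> \<ge> eta1 P then R (x k) (s k) else x k) \<and>
               \<sigma> (Suc k) \<in>
                 (if \<rho> \<ge> eta2 P then {max (sigma_min P) (gamma1 P * \<sigma> k) .. \<sigma> k}
                  else if \<rho> \<ge> eta1 P then {\<sigma> k .. gamma2 P * \<sigma> k}
                  else {gamma2 P * \<sigma> k .. gamma3 P * \<sigma> k}))))"

definition second_order_enforced ::
  "('m, 'e::euclidean_space) riem \<Rightarrow> ('m \<Rightarrow> 'e \<Rightarrow> 'm) \<Rightarrow> ('m \<Rightarrow> real) \<Rightarrow> arc_params \<Rightarrow>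
     (nat \<Rightarrow> 'm) \<Rightarrow> (nat \<Rightarrow> 'e) \<Rightarrow> (nat \<Rightarrow> real) \<Rightarrow> bool" where
  "second_order_enforced M R f P x s \<sigma> \<longleftrightarrow>
     (\<forall>k. produced s k \<longrightarrow> second_order_progress M R f P (x k) (\<sigma> k) (s k))"

text \<open>
  The constant of the complexity bound. HOL cannot quantify over the types 'm and 'e inside a
  formula, so a constant obtained from an existential quantifier in a statement about one manifold
  type could depend on the dimension. An explicit real function of f(x_0) - f_low, L and the
  parameters of the algorithm cannot. Here sigma_max bounds all regularization parameters from
  above, the middle term counts successful iterations through the decrease each of them achieves,
  and the first factor and the additive term account for the unsuccessful ones.
\<close>

definition sigma_max :: "arc_params \<Rightarrow> real \<Rightarrow> real \<Rightarrow> real" where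
  "sigma_max P \<sigma>0 L = max \<sigma>0 (gamma3 P * L / (2 * (1 - eta2 P)))"

definition arc_const :: "arc_params \<Rightarrow> real \<Rightarrow> real \<Rightarrow> real \<Rightarrow> real" where
  "arc_const P \<sigma>0 L \<Delta> =
     (1 + ln (1 / gamma1 P) / ln (gamma2 P)) *
       (3 * (1 + theta P + L + 2 * sigma_max P \<sigma>0 L) ^ 3 * \<Delta> / (eta1 P * sigma_min P))
     + ln (sigma_max P \<sigma>0 L / \<sigma>0) / ln (gamma2 P) + 1"

end

theory Submission
  imports Defs
begin

text \<open>
  Along a geodesic with initial velocity s the velocity is the parallel transport of s, so the
  Lipschitz condition on the Hessian integrates to Taylor expansions of f and of its gradient with
  remainders L |s|^3 / 6 and L |s|^2 / 2. The function-value expansion shows that a step with a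
  regularization parameter of at least L / (2 (1 - eta2)) is very successful, which bounds all
  regularization parameters; the gradient expansion shows that a successful step arriving at a
  point that is not yet approximately critical is so long that it decreases f by a multiple of
  eps^(3/2). Hence there are O(eps^(-3/2)) such steps, and since the parameters stay bounded, each
  unsuccessful step is paid for by a successful one.

  The model uses derivatives of the pullback of f at the origin, so the argument also needs that
  Exp is differentiable near the origin and twice differentiable at it. This comes from the
  linearized geodesic equation in a chart, whose solutions are estimated up to second order.
\<close>

section \<open>Finite-dimensional inner products\<close>

text \<open>The bound is free of curvature because the quantitative estimates behind
  \<open>arc_const\<close> compare data along a geodesic by parallel transport, an isometry, and use
  no bound on the differential of \<open>Exp\<close>. The chart-dependent constants in the local
  study of \<open>Exp\<close> only serve to identify the gradient and Hessian of the pullback at the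
  origin with \<open>rgrad\<close> and \<open>rhess\<close>. What shapes the proof is that
  \<open>gradient\<close>, \<open>christoffel\<close>, \<open>Exp\<close>, \<open>transport\<close>
  and \<open>min_eigenvalue\<close> are descriptions, which mean something only once existence and
  uniqueness are known. Completeness provides a geodesic for every initial velocity, so only linear
  equations have to be solved; dependence on initial values comes from Gronwall's inequality. A
  further difficulty is that tangent vectors are written in a preferred chart that may jump from
  point to point, so a field is differentiated only after conversion to one fixed chart.\<close>

locale inner_prod =
  fixes B :: "'e::euclidean_space \<Rightarrow> 'e \<Rightarrow> real"
  assumes ip: "inner_product B"
begin

abbreviation nrm :: "'e \<Rightarrow> real" where "nrm \<equiv> norm_wrt B"

lemma bil: "bilinear B" using ip by (simp add: inner_product_def)
lemma bounded_bil: "bounded_bilinear B" using bil bilinear_conv_bounded_bilinear by blast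
lemmas Badd = bounded_bilinear.add_left[OF bounded_bil] bounded_bilinear.add_right[OF bounded_bil]
lemmas Bdiff = bounded_bilinear.diff_left[OF bounded_bil] bounded_bilinear.diff_right[OF bounded_bil]
lemmas Bscale = bounded_bilinear.scaleR_left[OF bounded_bil] bounded_bilinear.scaleR_right[OF bounded_bil]
lemmas Bminus = bounded_bilinear.minus_left[OF bounded_bil] bounded_bilinear.minus_right[OF bounded_bil]
lemmas Bzero [simp] = bounded_bilinear.zero_left[OF bounded_bil] bounded_bilinear.zero_right[OF bounded_bil]
lemmas Bsum = bounded_bilinear.sum_left[OF bounded_bil] bounded_bilinear.sum_right[OF bounded_bil]
lemmas Bsimps = Badd Bdiff Bscale Bminus

lemma commute: "B u v = B v u" using ip by (simp add: inner_product_def)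
lemma pos: "v \<noteq> 0 \<Longrightarrow> B v v > 0" using ip by (simp add: inner_product_def)
lemma nonneg: "B v v \<ge> 0" using pos[of v] by (cases "v = 0") auto
lemma eq0_iff: "B v v = 0 \<longleftrightarrow> v = 0" using pos[of v] by (cases "v = 0") auto
lemma nrm_sq: "(nrm v)\<^sup>2 = B v v" by (simp add: norm_wrt_def nonneg)
lemma nrm_nonneg [simp]: "nrm v \<ge> 0" by (simp add: norm_wrt_def nonneg)
lemma nrm_zero [simp]: "nrm 0 = 0" by (simp add: norm_wrt_def)
lemma nrm_eq0_iff [simp]: "nrm v = 0 \<longleftrightarrow> v = 0" by (simp add: norm_wrt_def eq0_iff)
lemma nrm_pos: "v \<noteq> 0 \<Longrightarrow> nrm v > 0" using nrm_nonneg[of v] nrm_eq0_iff[of v] by linarith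
lemma nrm_scaleR: "nrm (a *\<^sub>R v) = \<bar>a\<bar> * nrm v"
  by (simp add: norm_wrt_def Bscale real_sqrt_mult flip: power2_eq_square mult.assoc)

lemma ext: assumes "\<And>w. B u w = B v w" shows "u = v"
proof -
  have "B (u - v) (u - v) = 0" using assms by (simp add: Bdiff)
  then show ?thesis by (simp add: eq0_iff)
qed

lemma cauchy_schwarz: "\<bar>B u v\<bar> \<le> nrm u * nrm v"
proof (cases "v = 0")
  case False
  let ?t = "B u v / B v v"
  have p: "B v v > 0" using pos False by auto
  have "0 \<le> B (u - ?t *\<^sub>R v) (u - ?t *\<^sub>R v)" by (rule nonneg)
  also have "\<dots> = B u u - (B u v)\<^sup>2 / B v v"
    using p by (simp add: Bsimps commute[of v u] power2_eq_square field_simps)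
  finally have "(B u v)\<^sup>2 \<le> B u u * B v v" using p by (simp add: field_simps)
  then have "(B u v)\<^sup>2 \<le> (nrm u * nrm v)\<^sup>2" by (simp add: nrm_sq power_mult_distrib)
  then show ?thesis by (metis abs_le_square_iff abs_of_nonneg mult_nonneg_nonneg nrm_nonneg)
qed simp

text \<open>Testing with \<open>w = u\<close> cancels one factor \<open>nrm u\<close>. This turns a
  bound on a functional into a bound on the vector representing it, such as a gradient.\<close>

lemma dual_bound: assumes "\<And>w. \<bar>B u w\<bar> \<le> K * nrm w" shows "nrm u \<le> K"
proof (cases "u = 0")
  case True
  \<comment> \<open>For \<open>u = 0\<close> the claim is \<open>K \<ge> 0\<close>, which testing
    against any nonzero vector gives.\<close>
  obtain b :: 'e where "b \<in> Basis" using nonempty_Basis by blast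
  then have "nrm b > 0" by (intro nrm_pos) auto
  moreover have "0 \<le> K * nrm b" using assms[of b] True by simp
  ultimately show ?thesis using True by (simp add: zero_le_mult_iff)
next
  case False
  have "nrm u * nrm u \<le> K * nrm u" using assms[of u] nonneg[of u] by (simp add: nrm_sq flip: power2_eq_square)
  then show ?thesis using nrm_pos[OF False] by simp
qed

text \<open>\<open>F\<close> collects the values of \<open>B g\<close> on the basis. It is injective
  since \<open>B\<close> is nondegenerate, hence surjective in finite dimension.\<close>

lemma riesz: assumes "linear l" shows "\<exists>!g. \<forall>v. B g v = l v"
proof -
  define F where "F g = (\<Sum>b\<in>Basis. B g b *\<^sub>R b)" for g
  have lF: "linear F" by (rule linearI) (simp_all add: F_def Bsimps scaleR_add_left sum.distrib scaleR_sum_right)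
  have F_inner: "F g \<bullet> b = B g b" if "b \<in> Basis" for g b
    using that by (simp add: F_def inner_sum_left inner_Basis if_distrib cong: if_cong)
  have expand: "B g v = (\<Sum>b\<in>Basis. (v \<bullet> b) * B g b)" for g v
    by (subst (1) euclidean_representation[of v, symmetric]) (simp only: Bsum Bscale real_scaleR_def)
  have "inj F"
    unfolding linear_injective_0[OF lF]
  proof safe
    fix g assume "F g = 0"
    then have "B g v = B 0 v" for v using F_inner[of _ g] by (subst expand) simp
    then show "g = 0" by (rule ext)
  qed
  then have "surj F" using lF linear_injective_imp_surjective by blast
  then obtain g where g: "F g = (\<Sum>b\<in>Basis. l b *\<^sub>R b)" by (metis surjD)
  have gb: "B g b = l b" if "b \<in> Basis" for b
    using F_inner[OF that, of g] that by (simp add: g inner_sum_left inner_Basis if_distrib cong: if_cong)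
  have "l v = (\<Sum>b\<in>Basis. (v \<bullet> b) * l b)" for v
    using linear_sum[OF assms, of "\<lambda>b. (v \<bullet> b) *\<^sub>R b" Basis] linear_scale[OF assms]
    by (simp add: euclidean_representation)
  moreover have "B g v = (\<Sum>b\<in>Basis. (v \<bullet> b) * l b)" for v
    by (subst expand) (simp add: gb)
  ultimately have "B g v = l v" for v by metis
  then show ?thesis using ext by metis
qed

text \<open>By homogeneity it suffices to minimise \<open>nrm\<close> over the compact unit sphere
  of the type-class norm. With the upper bound that follows, topology can be done in the type-class
  norm and estimates in \<open>B\<close>.\<close>

lemma nrm_equiv_lower: obtains c where "c > 0" "\<And>v. c * norm v \<le> nrm v"
proof -
  have c: "continuous_on (sphere 0 1) nrm"
    unfolding norm_wrt_def
    by (intro continuous_intros bounded_bilinear.continuous_on[OF bounded_bil])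
  obtain b :: 'e where b: "b \<in> Basis" using nonempty_Basis by blast
  then have ne: "sphere (0::'e) 1 \<noteq> {}" by (auto intro!: exI[of _ b])
  obtain v0 where v0: "v0 \<in> sphere 0 1" "\<And>v. v \<in> sphere 0 1 \<Longrightarrow> nrm v0 \<le> nrm v"
    using continuous_attains_inf[OF compact_sphere ne c] by blast
  show ?thesis
  proof
    show "nrm v0 > 0" using v0(1) by (intro nrm_pos) auto
    show "nrm v0 * norm v \<le> nrm v" for v
    proof (cases "v = 0")
      case False
      have "nrm v0 \<le> nrm ((1 / norm v) *\<^sub>R v)" using False by (intro v0) simp
      then show ?thesis using False by (simp add: nrm_scaleR field_simps)
    qed simp
  qed
qed

lemma nrm_equiv_upper: obtains C where "C > 0" "\<And>v. nrm v \<le> C * norm v"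
proof -
  obtain K where K: "K > 0" "\<And>a b. norm (B a b) \<le> norm a * norm b * K"
    using bounded_bilinear.pos_bounded[OF bounded_bil] by blast
  show ?thesis
  proof
    show "sqrt K > 0" using K by simp
    show "nrm v \<le> sqrt K * norm v" for v
    proof (rule power2_le_imp_le)
      show "(nrm v)\<^sup>2 \<le> (sqrt K * norm v)\<^sup>2"
        using K(2)[of v v] K(1) unfolding nrm_sq power_mult_distrib by (simp add: power2_eq_square mult_ac)
      show "0 \<le> sqrt K * norm v" using K(1) by simp
    qed
  qed
qed

lemma gradient_eqI:
  assumes "(h has_derivative (\<lambda>v. B g v)) (at s)" shows "gradient B h s = g"
  unfolding gradient_def
proof (rule the_equality[where P = "\<lambda>g. (h has_derivative (\<lambda>v. B g v)) (at s)", OF assms])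
  fix g' assume "(h has_derivative (\<lambda>v. B g' v)) (at s)"
  then have "(\<lambda>v. B g' v) = (\<lambda>v. B g v)" using assms has_derivative_unique by blast
  then show "g' = g" by (intro ext) metis
qed

lemma gradient_has_derivative:
  assumes "(h has_derivative h') (at s)"
  shows "(h has_derivative (\<lambda>v. B (gradient B h s) v)) (at s)"
    and "B (gradient B h s) v = h' v"
proof -
  obtain g where g: "\<forall>v. B g v = h' v" using riesz has_derivative_linear[OF assms] by blast
  then have *: "B g = h'" by auto
  then have "gradient B h s = g" using assms by (intro gradient_eqI) simp
  with * assms show "(h has_derivative (\<lambda>v. B (gradient B h s) v)) (at s)"
    and "B (gradient B h s) v = h' v" by simp_all
qed

text \<open>\<open>op_norm_wrt\<close> is a supremum of reals and dominates its members only if they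
  are bounded above; equivalence of \<open>nrm\<close> with the type-class norm provides that.
  Scaling to \<open>nrm v = 1\<close> does the rest.\<close>

lemma op_norm_bound:
  assumes "linear A" "op_norm_wrt B A \<le> K"
  shows "nrm (A v) \<le> K * nrm v"
proof (cases "v = 0")
  case True then show ?thesis using linear_0[OF assms(1)] by simp
next
  case False
  obtain c where c: "c > 0" "\<And>v. c * norm v \<le> nrm v" by (rule nrm_equiv_lower) blast
  obtain C where C: "C > 0" "\<And>v. nrm v \<le> C * norm v" by (rule nrm_equiv_upper) blast
  obtain D where D: "D > 0" "\<And>v. norm (A v) \<le> D * norm v"
    using linear_bounded_pos[OF assms(1)] by blast
  have bdd: "bdd_above ((\<lambda>v. nrm (A v)) ` {v. nrm v \<le> 1})"
  proof (rule bdd_aboveI2)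
    fix v assume "v \<in> {v. nrm v \<le> 1}"
    then have "norm v \<le> 1 / c" using c(2)[of v] c(1) by (simp add: field_simps)
    then have "norm (A v) \<le> D * (1 / c)" using D(2)[of v] D(1) by (meson less_imp_le mult_left_mono order_trans)
    then show "nrm (A v) \<le> C * (D * (1/c))" using C(2)[of "A v"] C(1) by (meson less_imp_le mult_left_mono order_trans)
  qed
  let ?w = "(1 / nrm v) *\<^sub>R v"
  have "nrm ?w = 1" using nrm_pos[OF False] False by (simp add: nrm_scaleR)
  then have "nrm (A ?w) \<le> K" using cSUP_upper[OF _ bdd, of ?w] assms(2) by (simp add: op_norm_wrt_def)
  moreover have "nrm (A ?w) = nrm (A v) / nrm v"
    using linear_scale[OF assms(1)] nrm_pos[OF False] by (simp add: nrm_scaleR)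
  ultimately show ?thesis using nrm_pos[OF False] by (simp add: field_simps)
qed

text \<open>Without self-adjointness the set of eigenvalues could be empty and LEAST a junk value.\<close>

lemma min_eigenvalue:
  assumes lin: "linear A" and sa: "\<And>u v. B (A u) v = B u (A v)"
  shows min_eigenvalue_le: "\<And>v. min_eigenvalue A * B v v \<le> B v (A v)"
    and min_eigenvalue_attained: "\<exists>v. v \<noteq> 0 \<and> A v = min_eigenvalue A *\<^sub>R v"
proof -
  let ?S = "{v. B v v = 1}"
  obtain c where c: "c > 0" "\<And>v. c * norm v \<le> nrm v" by (rule nrm_equiv_lower) blast
  have contB: "continuous_on UNIV (\<lambda>v. B v v)"
    by (intro bounded_bilinear.continuous_on[OF bounded_bil] continuous_intros)
  have "bounded ?S"
  proof (rule boundedI)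
    fix v assume "v \<in> ?S"
    then show "norm v \<le> 1 / c" using c(2)[of v] c(1) by (simp add: norm_wrt_def field_simps)
  qed
  moreover have "closed ?S" using continuous_closed_preimage_constant[OF contB closed_UNIV, of 1] by simp
  ultimately have comp: "compact ?S" by (simp add: compact_eq_bounded_closed)
  obtain b :: 'e where b: "b \<in> Basis" using nonempty_Basis by blast
  then have "(1 / nrm b) *\<^sub>R b \<in> ?S"
    using nrm_pos[of b] nonzero_Basis[of b] by (simp add: nrm_scaleR flip: nrm_sq)
  then have ne: "?S \<noteq> {}" by blast
  have contA: "continuous_on ?S (\<lambda>v. B v (A v))"
    by (intro bounded_bilinear.continuous_on[OF bounded_bil] continuous_intros
        linear_continuous_on[OF linear_linear[THEN iffD2, OF lin]])
  \<comment> \<open>\<open>v0\<close> minimises the Rayleigh quotient; its value \<open>l\<close>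
    will be the least eigenvalue.\<close>
  obtain v0 where v0: "B v0 v0 = 1" "\<And>v. B v v = 1 \<Longrightarrow> B v0 (A v0) \<le> B v (A v)"
    using continuous_attains_inf[OF comp ne contA] by auto
  define l where "l = B v0 (A v0)"
  have ray: "l * B v v \<le> B v (A v)" for v
  proof (cases "v = 0")
    case False
    have p: "B v v > 0" by (rule pos[OF False])
    have "l \<le> B ((1 / nrm v) *\<^sub>R v) (A ((1 / nrm v) *\<^sub>R v))"
      unfolding l_def using p nrm_pos[OF False]
      using False by (intro v0(2)) (simp add: nrm_scaleR flip: nrm_sq)
    also have "\<dots> = B v (A v) / B v v"
      by (simp add: linear_scale[OF lin] Bscale power2_eq_square flip: nrm_sq)
    finally show ?thesis using p by (simp add: field_simps)
  qed (simp add: linear_0[OF lin])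
  have eig: "A v0 = l *\<^sub>R v0"
  proof -
    let ?w = "A v0 - l *\<^sub>R v0"
    \<comment> \<open>The Rayleigh inequality at \<open>v0 + t *\<^sub>R ?w\<close>, with
      \<open>?w\<close> the residual of the eigenvalue equation. The constant term vanishes, and
      minimality will force the term linear in \<open>t\<close> to vanish too.\<close>
    have q: "0 \<le> 2 * t * B ?w ?w + t\<^sup>2 * (B ?w (A ?w) - l * B ?w ?w)" for t
    proof -
      have "0 \<le> B (v0 + t *\<^sub>R ?w) (A (v0 + t *\<^sub>R ?w)) - l * B (v0 + t *\<^sub>R ?w) (v0 + t *\<^sub>R ?w)"
        using ray[of "v0 + t *\<^sub>R ?w"] by simp
      also have "\<dots> = (B v0 (A v0) - l * B v0 v0) + t * (B v0 (A ?w) + B ?w (A v0) - l * B v0 ?w - l * B ?w v0)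
          + t\<^sup>2 * (B ?w (A ?w) - l * B ?w ?w)"
        by (simp only: linear_add[OF lin] linear_scale[OF lin] Badd Bscale real_scaleR_def) algebra
      also have "B v0 (A ?w) = B ?w (A v0)" by (metis sa commute)
      also have "B v0 ?w = B ?w v0" by (rule commute)
      also have "B ?w (A v0) + B ?w (A v0) - l * B ?w v0 - l * B ?w v0 = 2 * B ?w ?w"
        by (simp only: Bdiff(2)[of ?w "A v0"] Bscale real_scaleR_def) (simp add: algebra_simps)
      finally show ?thesis using v0(1) by (simp add: l_def algebra_simps)
    qed
    have "B ?w ?w = 0"
    proof (rule ccontr)
      assume "B ?w ?w \<noteq> 0"
      define a where "a = B ?w ?w"
      define d where "d = B ?w (A ?w) - l * a"
      have a: "a > 0" using \<open>B ?w ?w \<noteq> 0\<close> nonneg[of ?w] unfolding a_def by linarith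
      \<comment> \<open>With \<open>t = - (a / e)\<close> the linear term wins as soon as
        \<open>d < 2 * e\<close>, which this choice ensures for either sign of
        \<open>d\<close>.\<close>
      define e where "e = \<bar>d\<bar> + 1"
      have e: "e > 0" "d < 2 * e" by (auto simp: e_def)
      have "0 \<le> 2 * (- (a / e)) * a + (- (a / e))\<^sup>2 * d"
        using q[of "- (a / e)"] by (simp add: a_def d_def)
      also have "\<dots> = a\<^sup>2 / e * (d / e - 2)"
        using e by (simp add: power2_eq_square field_simps)
      also have "\<dots> < 0" using a e by (intro mult_pos_neg) (auto simp: field_simps)
      finally show False by simp
    qed
    then show ?thesis by (simp add: eq0_iff)
  qed
  have "min_eigenvalue A = l"
    unfolding min_eigenvalue_def
  proof (rule Least_equality)
    show "\<exists>v. v \<noteq> 0 \<and> A v = l *\<^sub>R v" using eig v0(1) by (intro exI[of _ v0]) auto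
    fix y assume "\<exists>v. v \<noteq> 0 \<and> A v = y *\<^sub>R v"
    then obtain v where "v \<noteq> 0" "A v = y *\<^sub>R v" by blast
    then show "l \<le> y" using ray[of v] pos[of v] by (simp add: Bscale)
  qed
  then show "\<And>v. min_eigenvalue A * B v v \<le> B v (A v)" "\<exists>v. v \<noteq> 0 \<and> A v = min_eigenvalue A *\<^sub>R v"
    using ray eig v0(1) by (auto intro!: exI[of _ v0])
qed

end

section \<open>Calculus and ordinary differential equations\<close>

text \<open>The squared norm is differentiable also where u vanishes; the price is the constant 2 K + 1.\<close>

lemma gronwall_sq:
  fixes u :: "real \<Rightarrow> 'a::real_inner"
  assumes der: "\<And>t. t \<in> {a..b} \<Longrightarrow> (u has_vector_derivative u' t) (at t within {a..b})"
    and le: "\<And>t. t \<in> {a..b} \<Longrightarrow> norm (u' t) \<le> K * norm (u t) + \<beta>"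
    and K: "K \<ge> 0" and t: "t \<in> {a..b}"
  shows "(norm (u t))\<^sup>2 \<le> exp ((2 * K + 1) * (t - a)) * ((norm (u a))\<^sup>2 + \<beta>\<^sup>2 * (t - a))"
proof -
  let ?L = "2 * K + 1"
  \<comment> \<open>The damped energy minus the accumulated forcing is nonincreasing. The
    \<open>+ 1\<close> in the exponent absorbs the square of \<open>norm (u r)\<close> that comes
    from \<open>2 * norm (u r) * \<beta> \<le> (norm (u r))\<^sup>2 +
    \<beta>\<^sup>2\<close>.\<close>
  define \<phi> where "\<phi> r = exp (- ?L * (r - a)) * (u r \<bullet> u r) - \<beta>\<^sup>2 * (r - a)" for r
  define \<phi>' where "\<phi>' r = exp (- ?L * (r - a)) * (- ?L * (u r \<bullet> u r) + 2 * (u r \<bullet> u' r)) - \<beta>\<^sup>2" for r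
  have cu: "continuous_on {a..b} u"
    by (meson continuous_on_eq_continuous_within der has_vector_derivative_continuous)
  have "\<phi> t \<le> \<phi> a"
  proof (rule DERIV_nonpos_imp_decreasing_open[where f = \<phi>])
    show "a \<le> t" using t by simp
    show "continuous_on {a..t} \<phi>" unfolding \<phi>_def
      using t by (intro continuous_intros continuous_on_subset[OF cu]) auto
    fix r assume r: "a < r" "r < t"
    then have "(u has_vector_derivative u' r) (at r)"
      using der[of r] t at_within_Icc_at[of a r b] by auto
    then have u: "(u has_derivative (\<lambda>x. x *\<^sub>R u' r)) (at r)" by (simp add: has_vector_derivative_def)
    have "(\<phi> has_real_derivative \<phi>' r) (at r)"
      unfolding \<phi>_def \<phi>'_def has_field_derivative_def
      by (rule has_derivative_eq_rhs, (rule derivative_intros u)+)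
         (auto simp: algebra_simps inner_commute fun_eq_iff)
    moreover have "\<phi>' r \<le> 0"
    proof -
      have "2 * (u r \<bullet> u' r) \<le> 2 * norm (u r) * norm (u' r)" using norm_cauchy_schwarz[of "u r" "u' r"] by simp
      also have "\<dots> \<le> 2 * norm (u r) * (K * norm (u r) + \<beta>)" using le[of r] r t by (intro mult_left_mono) auto
      also have "\<dots> \<le> ?L * (u r \<bullet> u r) + \<beta>\<^sup>2"
        using sum_squares_bound[of "norm (u r)" \<beta>]
        by (simp add: power2_norm_eq_inner[symmetric] power2_eq_square algebra_simps)
      finally have "- ?L * (u r \<bullet> u r) + 2 * (u r \<bullet> u' r) \<le> \<beta>\<^sup>2" by (simp add: algebra_simps)
      moreover have "exp (- ?L * (r - a)) \<le> 1" using K r by (simp add: mult_nonpos_nonneg)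
      ultimately have "exp (- ?L * (r - a)) * (- ?L * (u r \<bullet> u r) + 2 * (u r \<bullet> u' r)) \<le> 1 * \<beta>\<^sup>2"
        by (meson exp_ge_zero mult_left_mono mult_right_mono order_trans zero_le_power2)
      then show ?thesis by (simp add: \<phi>'_def)
    qed
    ultimately show "\<exists>y. (\<phi> has_real_derivative y) (at r) \<and> y \<le> 0" by blast
  qed
  then have "exp (- ?L * (t - a)) * (u t \<bullet> u t) \<le> (norm (u a))\<^sup>2 + \<beta>\<^sup>2 * (t - a)"
    by (simp add: \<phi>_def power2_norm_eq_inner)
  then have "exp (?L * (t - a)) * (exp (- ?L * (t - a)) * (u t \<bullet> u t)) \<le>
      exp (?L * (t - a)) * ((norm (u a))\<^sup>2 + \<beta>\<^sup>2 * (t - a))" by (intro mult_left_mono) auto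
  moreover have "exp (?L * (t - a)) * exp (- ?L * (t - a)) = 1" by (simp add: algebra_simps flip: exp_add)
  ultimately show ?thesis by (simp only: mult.assoc[symmetric] mult_1_left power2_norm_eq_inner)
qed

text \<open>Picard iteration written as a series: \<open>D n\<close> is the n-fold iterated
  integral, bounded by \<open>norm u * (K * (t - a)) ^ n / fact n\<close>, so that the series and
  its termwise derivative converge uniformly.\<close>

lemma linear_ode_exists:
  fixes A :: "real \<Rightarrow> 'a::euclidean_space \<Rightarrow>\<^sub>L 'a"
  assumes cA: "continuous_on {a..b} A" and ab: "a \<le> b"
  shows "\<exists>Y. Y a = u \<and> (\<forall>t\<in>{a..b}. (Y has_vector_derivative A t (Y t)) (at t within {a..b}))"
proof -
  have "bounded (A ` {a..b})" using cA compact_continuous_image compact_imp_bounded by blast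
  then obtain K where K: "K > 0" "\<And>t. t \<in> {a..b} \<Longrightarrow> norm (A t) \<le> K"
    unfolding bounded_pos by blast
  define D where "D = rec_nat (\<lambda>t. u) (\<lambda>n d t. integral {a..t} (\<lambda>r. A r (d r)))"
  have D0: "D 0 = (\<lambda>t. u)" and DS: "D (Suc n) = (\<lambda>t. integral {a..t} (\<lambda>r. A r (D n r)))" for n
    by (auto simp: D_def)
  have cAD: "continuous_on {a..b} (\<lambda>r. A r (D n r))" if "continuous_on {a..b} (D n)" for n
    using that cA by (intro continuous_intros)
  have dS: "(D (Suc n) has_vector_derivative A t (D n t)) (at t within {a..b})"
    if "continuous_on {a..b} (D n)" "t \<in> {a..b}" for n t
    unfolding DS using integral_has_vector_derivative[OF cAD[OF that(1)] that(2)] .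
  have cD: "continuous_on {a..b} (D n)" for n
  proof (induction n)
    case (Suc n) then show ?case
      by (meson continuous_on_eq_continuous_within dS has_vector_derivative_continuous)
  qed (simp add: D0)
  have bD: "norm (D n t) \<le> norm u * (K * (t - a)) ^ n / fact n" if "t \<in> {a..b}" for n t
    using that
  proof (induction n arbitrary: t)
    case (Suc n)
    let ?g = "\<lambda>r. K * (norm u * (K * (r - a)) ^ n / fact n)"
    let ?G = "\<lambda>r. norm u * (K * (r - a)) ^ Suc n / fact (Suc n)"
    have G: "(?G has_vector_derivative ?g r) (at r within {a..t})" for r
    proof -
      have "((\<lambda>r. K * (r - a)) has_real_derivative K) (at r within {a..t})"
        by (auto intro!: derivative_eq_intros)
      from DERIV_cdivide[OF DERIV_cmult[OF DERIV_power_Suc[OF this, of n], of "norm u"], of "fact (Suc n)"]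
      have "(?G has_real_derivative norm u * ((1 + real n) * (K * (K * (r - a)) ^ n)) / fact (Suc n)) (at r within {a..t})"
        by simp
      also have "norm u * ((1 + real n) * (K * (K * (r - a)) ^ n)) / fact (Suc n) = ?g r"
        by (simp add: divide_simps)
      finally show ?thesis by (simp add: has_real_derivative_iff_has_vector_derivative)
    qed
    have I: "(?g has_integral ?G t - ?G a) {a..t}"
      using Suc.prems by (intro fundamental_theorem_of_calculus G) simp
    have "norm (D (Suc n) t) \<le> integral {a..t} ?g"
      unfolding DS
    proof (rule integral_norm_bound_integral)
      show "(\<lambda>r. A r (D n r)) integrable_on {a..t}"
        using Suc.prems by (intro integrable_continuous_real continuous_on_subset[OF cAD[OF cD]]) auto
      show "?g integrable_on {a..t}" using I by blast
      fix r assume r: "r \<in> {a..t}"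
      have "norm (A r (D n r)) \<le> norm (A r) * norm (D n r)" by (rule norm_blinfun)
      also have "\<dots> \<le> ?g r"
        using r Suc.prems K by (intro mult_mono K Suc.IH) auto
      finally show "norm (A r (D n r)) \<le> ?g r" .
    qed
    also have "\<dots> = ?G t" by (subst integral_unique[OF I]) simp
    finally show ?case .
  qed (simp add: D0)
  let ?M = "\<lambda>n. norm u * (K * (b - a)) ^ n / fact n"
  have sM: "summable ?M"
    using summable_mult[OF summable_exp[of "K * (b - a)"], of "norm u"] by (simp add: field_simps)
  have bM: "norm (D n t) \<le> ?M n" if "t \<in> {a..b}" for n t
    by (rule order_trans[OF bD[OF that]])
       (use that K in \<open>auto intro!: divide_right_mono mult_left_mono power_mono\<close>)
  define Y where "Y t = (\<Sum>n. D n t)" for t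
  have smD: "summable (\<lambda>n. D n t)" if "t \<in> {a..b}" for t
    by (rule summable_comparison_test[OF _ sM]) (use bM that in auto)
  have ul: "uniform_limit {a..b} (\<lambda>n t. \<Sum>i<n. D i t) Y sequentially"
    unfolding Y_def by (rule Weierstrass_m_test[OF bM sM])
  \<comment> \<open>The derivative of \<open>D n\<close> involves \<open>D (n - 1)\<close>, and that
    of the constant \<open>D 0\<close> is zero. The derivative of a partial sum therefore lags one
    term behind, as \<open>sf'\<close> records.\<close>
  define f' where "f' n t = (if n = 0 then 0 else A t (D (n - 1) t))" for n t
  have sf': "(\<Sum>i<Suc n. f' i t) = A t (\<Sum>i<n. D i t)" for n t
    unfolding sum.lessThan_Suc_shift by (simp add: f'_def blinfun.sum_right)
  have "\<exists>g. \<forall>t\<in>{a..b}. (\<lambda>n. D n t) sums g t \<and> (g has_derivative (\<lambda>h. h *\<^sub>R A t (Y t))) (at t within {a..b})"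
  proof (rule has_derivative_series)
    show "convex {a..b}" by simp
    show "(D n has_derivative (\<lambda>h. h *\<^sub>R f' n t)) (at t within {a..b})" if "t \<in> {a..b}" for n t
    proof (cases n)
      case 0 then show ?thesis by (simp add: D0 f'_def)
    next
      case (Suc m) then show ?thesis
        using dS[OF cD that] by (simp add: f'_def has_vector_derivative_def)
    qed
    show "a \<in> {a..b}" using ab by simp
    show "(\<lambda>n. D n a) sums Y a" unfolding Y_def using smD ab by (simp add: summable_sums)
    fix e :: real assume e: "e > 0"
    have "\<forall>\<^sub>F n in sequentially. \<forall>t\<in>{a..b}. dist (\<Sum>i<n. D i t) (Y t) < e / K"
      using uniform_limitD[OF ul, of "e / K"] e K by simp
    then obtain N where N: "\<And>n t. n \<ge> N \<Longrightarrow> t \<in> {a..b} \<Longrightarrow> dist (\<Sum>i<n. D i t) (Y t) < e / K"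
      unfolding eventually_sequentially by blast
    show "\<forall>\<^sub>F n in sequentially. \<forall>t\<in>{a..b}. \<forall>h. norm ((\<Sum>i<n. h *\<^sub>R f' i t) - h *\<^sub>R A t (Y t)) \<le> e * norm h"
      unfolding eventually_sequentially
    proof (intro exI[of _ "Suc N"] allI impI ballI)
      fix n t and h :: real assume n: "Suc N \<le> n" and t: "t \<in> {a..b}"
      then obtain m where m: "n = Suc m" "m \<ge> N" by (cases n) auto
      have "(\<Sum>i<n. h *\<^sub>R f' i t) - h *\<^sub>R A t (Y t) = h *\<^sub>R A t ((\<Sum>i<m. D i t) - Y t)"
        unfolding m(1) scaleR_right.sum[symmetric] sf' by (simp add: blinfun.diff_right scaleR_diff_right)
      also have "norm \<dots> \<le> \<bar>h\<bar> * (K * (e / K))"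
        unfolding norm_scaleR
      proof (intro mult_left_mono)
        have "norm (A t ((\<Sum>i<m. D i t) - Y t)) \<le> norm (A t) * norm ((\<Sum>i<m. D i t) - Y t)" by (rule norm_blinfun)
        also have "\<dots> \<le> K * (e / K)"
          using N[OF m(2) t] K t by (intro mult_mono K) (auto simp: dist_norm)
        finally show "norm (A t ((\<Sum>i<m. D i t) - Y t)) \<le> K * (e / K)" .
      qed simp
      finally show "norm ((\<Sum>i<n. h *\<^sub>R f' i t) - h *\<^sub>R A t (Y t)) \<le> e * norm h" using K by (simp add: mult.commute)
    qed
  qed
  then obtain g where g: "\<And>t. t \<in> {a..b} \<Longrightarrow> (\<lambda>n. D n t) sums g t"
    "\<And>t. t \<in> {a..b} \<Longrightarrow> (g has_derivative (\<lambda>h. h *\<^sub>R A t (Y t))) (at t within {a..b})" by blast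
  have gY: "g t = Y t" if "t \<in> {a..b}" for t using g(1)[OF that] by (simp add: Y_def sums_iff)
  have "D (Suc n) a = 0" for n by (simp add: DS)
  then have "D n a = (if n = 0 then u else 0)" for n by (cases n) (auto simp: D0)
  then have "(\<lambda>n. D n a) sums u" using sums_single[of 0 "\<lambda>_. u"] by simp
  then have "g a = u" using g(1)[of a] ab sums_unique2 by auto
  with g(2) gY show ?thesis by (intro exI[of _ g]) (auto simp: has_vector_derivative_def)
qed

text \<open>The remainder z (y + w) - z y - J w solves the linearized equation with initial value 0 up to an
  error of order o(w), so it is o(w) by Gronwall's inequality.\<close>

lemma flow_has_derivative:
  fixes X :: "'a::euclidean_space \<Rightarrow> 'a" and z :: "'p::euclidean_space \<Rightarrow> real \<Rightarrow> 'a"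
  assumes K: "compact K" "convex K"
    and dX: "\<And>x. x \<in> K \<Longrightarrow> (X has_derivative blinfun_apply (X' x)) (at x within K)"
    and cX: "continuous_on K X'"
    and S: "open S" "y \<in> S"
    and zK: "\<And>y t. y \<in> S \<Longrightarrow> t \<in> {0..1} \<Longrightarrow> z y t \<in> K"
    and z: "\<And>y t. y \<in> S \<Longrightarrow> t \<in> {0..1} \<Longrightarrow> (z y has_vector_derivative X (z y t)) (at t within {0..1})"
    and z0: "\<And>y. y \<in> S \<Longrightarrow> z y 0 = c + I y" and I: "bounded_linear I"
    and J: "\<And>w t. t \<in> {0..1} \<Longrightarrow> (J w has_vector_derivative X' (z y t) (J w t)) (at t within {0..1})"
    and J0: "\<And>w. J w 0 = I w"
  shows "((\<lambda>y. z y 1) has_derivative (\<lambda>w. J w 1)) (at y)"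
proof -
  have "bounded (X' ` K)" using cX K compact_continuous_image compact_imp_bounded by blast
  then obtain L where L: "L > 0" "\<And>x. x \<in> K \<Longrightarrow> norm (X' x) \<le> L" unfolding bounded_pos by blast
  obtain CI where CI: "CI > 0" "\<And>w. norm (I w) \<le> norm w * CI" using bounded_linear.pos_bounded[OF I] by blast
  \<comment> \<open>\<open>E\<close> is the Gronwall growth factor over unit time, and
    \<open>M\<close> below is the resulting Lipschitz constant of the flow in the parameter.\<close>
  define E where "E = sqrt (exp (2 * L + 1))"
  have E: "E > 0" by (simp add: E_def)
  define M where "M = E * CI"
  have M: "M > 0" using E CI by (simp add: M_def)
  have gr: "norm (v t) \<le> E * sqrt ((norm (v 0))\<^sup>2 + \<beta>\<^sup>2)"
    if "\<And>t. t \<in> {0..1} \<Longrightarrow> (v has_vector_derivative v' t) (at t within {0..1})"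
      "\<And>t. t \<in> {0..1} \<Longrightarrow> norm (v' t) \<le> L * norm (v t) + \<beta>" "t \<in> {0..1}"
    for v v' :: "real \<Rightarrow> 'a" and t \<beta>
  proof -
    have "(norm (v t))\<^sup>2 \<le> exp ((2 * L + 1) * (t - 0)) * ((norm (v 0))\<^sup>2 + \<beta>\<^sup>2 * (t - 0))"
      using that L by (intro gronwall_sq[where b = 1]) auto
    also have "\<dots> \<le> exp (2 * L + 1) * ((norm (v 0))\<^sup>2 + \<beta>\<^sup>2)"
      using that(3) L(1) by (intro mult_mono) (auto intro!: mult_left_le)
    also have "\<dots> = (E * sqrt ((norm (v 0))\<^sup>2 + \<beta>\<^sup>2))\<^sup>2" by (simp add: E_def power_mult_distrib)
    finally show ?thesis by (rule power2_le_imp_le) (use E in simp)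
  qed
  have X'_le: "norm (X' x w) \<le> L * norm w" if "x \<in> K" for x w
    using norm_blinfun[of "X' x" w] L(2)[OF that] mult_right_mono[OF L(2)[OF that] norm_ge_zero[of w]] by linarith
  have lin_le: "norm (v 1) \<le> E * norm (v 0)"
    if "\<And>t. t \<in> {0..1} \<Longrightarrow> (v has_vector_derivative X' (z y t) (v t)) (at t within {0..1})" for v
    using gr[OF that, of 0 1] X'_le[OF zK[OF S(2)]] by simp
  \<comment> \<open>\<open>J\<close> is just some family of solutions; it is linear in
    \<open>w\<close> at time 1 because the deviation from linearity solves the same linear equation
    with initial value zero.\<close>
  have "linear (\<lambda>w. J w 1)"
  proof (rule linearI)
    fix w1 w2
    have "norm (J (w1 + w2) 1 - (J w1 1 + J w2 1)) \<le> E * norm (J (w1 + w2) 0 - (J w1 0 + J w2 0))"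
      using J by (intro lin_le) (auto intro!: derivative_eq_intros simp: blinfun.add_right blinfun.diff_right)
    also have "\<dots> = 0" by (simp add: J0 bounded_linear.linear[OF I] linear_add)
    finally show "J (w1 + w2) 1 = J w1 1 + J w2 1" by simp
  next
    fix r w
    have "norm (J (r *\<^sub>R w) 1 - r *\<^sub>R J w 1) \<le> E * norm (J (r *\<^sub>R w) 0 - r *\<^sub>R J w 0)"
      using J by (intro lin_le) (auto intro!: derivative_eq_intros simp: blinfun.scaleR_right blinfun.diff_right)
    also have "\<dots> = 0" by (simp add: J0 bounded_linear.linear[OF I] linear_scale)
    finally show "J (r *\<^sub>R w) 1 = r *\<^sub>R J w 1" by simp
  qed
  then have bl: "bounded_linear (\<lambda>w. J w 1)" by (simp add: linear_conv_bounded_linear)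
  have zdiff: "norm (z y' t - z y t) \<le> M * norm (y' - y)" if "y' \<in> S" "t \<in> {0..1}" for y' t
  proof -
    have "norm (z y' t - z y t) \<le> E * sqrt ((norm (z y' 0 - z y 0))\<^sup>2 + 0\<^sup>2)"
    proof (rule gr[OF _ _ that(2)])
      fix t :: real assume t: "t \<in> {0..1}"
      show "((\<lambda>t. z y' t - z y t) has_vector_derivative X (z y' t) - X (z y t)) (at t within {0..1})"
        using z that(1) S(2) t by (auto intro!: derivative_intros)
      show "norm (X (z y' t) - X (z y t)) \<le> L * norm (z y' t - z y t) + 0"
        using differentiable_bound[OF K(2) dX, of L "z y' t" "z y t"] zK[OF that(1) t] zK[OF S(2) t] L(2)
        by (simp add: norm_blinfun.rep_eq)
    qed
    also have "\<dots> = E * norm (I (y' - y))"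
      using that(1) S(2) by (simp add: z0 bounded_linear.linear[OF I] linear_diff)
    also have "\<dots> \<le> E * (norm (y' - y) * CI)" using E by (intro mult_left_mono CI) auto
    finally show ?thesis by (simp add: M_def mult_ac)
  qed
  show ?thesis
    unfolding has_derivative_at_alt
  proof (intro conjI allI impI bl)
    fix e :: real assume e: "e > 0"
    \<comment> \<open>Chosen so that the final Gronwall estimate
      \<open>E * (\<eta> * (M * norm (y' - y)))\<close> equals
      \<open>e * norm (y' - y)\<close>.\<close>
    define \<eta> where "\<eta> = e / (E * M)"
    have \<eta>: "\<eta> > 0" using e E M by (simp add: \<eta>_def)
    have "uniformly_continuous_on K X'" using cX K(1) compact_uniformly_continuous by blast
    then obtain \<delta> where \<delta>: "\<delta> > 0" "\<And>x x'. x \<in> K \<Longrightarrow> x' \<in> K \<Longrightarrow> dist x' x < \<delta> \<Longrightarrow> dist (X' x') (X' x) < \<eta>"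
      using \<eta> unfolding uniformly_continuous_on_def by metis
    \<comment> \<open>A first-order remainder of \<open>X\<close> that is uniform on
      \<open>K\<close>: the mean value inequality on segments, which stay in \<open>K\<close> by
      convexity, combined with uniform continuity of \<open>X'\<close>.\<close>
    have rem: "norm (X x' - X x - X' x (x' - x)) \<le> norm (x' - x) * \<eta>"
      if x: "x \<in> K" "x' \<in> K" "dist x' x < \<delta>" for x x'
    proof (rule differentiable_bound_linearization[where S = "closed_segment x x'" and f' = "\<lambda>w. blinfun_apply (X' w)"])
      have sub: "closed_segment x x' \<subseteq> K" using K(2) x by (simp add: closed_segment_subset)
      show "x + t *\<^sub>R (x' - x) \<in> closed_segment x x'" if "t \<in> {0..1}" for t
        using that by (auto simp: in_segment algebra_simps intro!: exI[of _ t])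
      show "(X has_derivative blinfun_apply (X' w)) (at w within closed_segment x x')"
        if "w \<in> closed_segment x x'" for w
        using dX[of w] sub that has_derivative_subset by blast
      show "onorm (blinfun_apply (X' w) - blinfun_apply (X' x)) \<le> \<eta>" if "w \<in> closed_segment x x'" for w
      proof -
        have "dist w x \<le> dist x' x" using that
          by (metis dist_commute dist_in_closed_segment(1))
        then have "dist (X' w) (X' x) < \<eta>" using \<delta>(2)[of x w] sub that x by auto
        then show ?thesis by (simp add: dist_norm norm_blinfun.rep_eq minus_blinfun.rep_eq fun_diff_def)
      qed
    qed simp
    obtain d where d: "d > 0" "\<And>y'. dist y' y < d \<Longrightarrow> y' \<in> S"
      using S unfolding open_dist by blast
    show "\<exists>d>0. \<forall>y'. norm (y' - y) < d \<longrightarrow> norm (z y' 1 - z y 1 - J (y' - y) 1) \<le> e * norm (y' - y)"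
    proof (intro exI[of _ "min d (\<delta> / M)"] conjI allI impI)
      show "min d (\<delta> / M) > 0" using d \<delta> M by simp
      fix y' assume "norm (y' - y) < min d (\<delta> / M)"
      then have y': "y' \<in> S" "M * norm (y' - y) < \<delta>"
        using d(2)[of y'] M by (auto simp: dist_norm field_simps)
      have "norm (z y' 1 - z y 1 - J (y' - y) 1)
          \<le> E * sqrt ((norm (z y' 0 - z y 0 - J (y' - y) 0))\<^sup>2 + (\<eta> * (M * norm (y' - y)))\<^sup>2)"
      proof (rule gr[where v = "\<lambda>t. z y' t - z y t - J (y' - y) t"
            and v' = "\<lambda>t. X (z y' t) - X (z y t) - X' (z y t) (J (y' - y) t)"])
        fix t :: real assume t: "t \<in> {0..1}"
        let ?r = "z y' t - z y t - J (y' - y) t"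
        show "((\<lambda>t. z y' t - z y t - J (y' - y) t) has_vector_derivative
            X (z y' t) - X (z y t) - X' (z y t) (J (y' - y) t)) (at t within {0..1})"
          using z y'(1) S(2) t J by (auto intro!: derivative_intros)
        have "dist (z y' t) (z y t) < \<delta>" using zdiff[OF y'(1) t] y'(2) by (simp add: dist_norm)
        then have "norm (X (z y' t) - X (z y t) - X' (z y t) (z y' t - z y t)) \<le> norm (z y' t - z y t) * \<eta>"
          by (intro rem zK t S(2) y'(1))
        also have "\<dots> \<le> (M * norm (y' - y)) * \<eta>" using zdiff[OF y'(1) t] \<eta> by (intro mult_right_mono) auto
        finally have "norm (X' (z y t) ?r + (X (z y' t) - X (z y t) - X' (z y t) (z y' t - z y t)))
            \<le> L * norm ?r + \<eta> * (M * norm (y' - y))"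
          using X'_le[OF zK[OF S(2) t], of ?r] norm_triangle_mono by (simp add: mult_ac norm_triangle_mono)
        moreover have "X' (z y t) ?r + (X (z y' t) - X (z y t) - X' (z y t) (z y' t - z y t)) =
            X (z y' t) - X (z y t) - X' (z y t) (J (y' - y) t)" by (simp add: blinfun.diff_right)
        ultimately show "norm (X (z y' t) - X (z y t) - X' (z y t) (J (y' - y) t))
            \<le> L * norm ?r + \<eta> * (M * norm (y' - y))" by simp
      qed simp
      also have "z y' 0 - z y 0 - J (y' - y) 0 = 0"
        using y'(1) S(2) by (simp add: z0 J0 bounded_linear.linear[OF I] linear_diff)
      also have "E * sqrt ((norm (0::'a))\<^sup>2 + (\<eta> * (M * norm (y' - y)))\<^sup>2) = e * norm (y' - y)"
        using \<eta> M E e by (simp add: \<eta>_def)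
      finally show "norm (z y' 1 - z y 1 - J (y' - y) 1) \<le> e * norm (y' - y)" .
    qed
  qed
qed

text \<open>The mean value theorem is used along \<open>u\<close> for the increment in the direction
  \<open>v\<close>, and then along \<open>v\<close>. The quotient becomes a value of
  \<open>DD\<close> at a point of the small parallelogram, and continuity at \<open>x\<close>
  concludes.\<close>

lemma second_difference_limit:
  fixes f :: "'a::real_normed_vector \<Rightarrow> real"
  assumes S: "open S" "x \<in> S"
    and D: "\<And>y. y \<in> S \<Longrightarrow> (f has_derivative D y) (at y)"
    and DD: "\<And>y. y \<in> S \<Longrightarrow> ((\<lambda>y. D y u) has_derivative DD y) (at y)"
    and c: "continuous_on S (\<lambda>y. DD y v)"
  shows "((\<lambda>h. (f (x + h *\<^sub>R u + h *\<^sub>R v) - f (x + h *\<^sub>R u) - f (x + h *\<^sub>R v) + f x) / h\<^sup>2) \<longlongrightarrow> DD x v) (at_right 0)"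
proof (rule tendstoI)
  let ?Q = "\<lambda>h. (f (x + h *\<^sub>R u + h *\<^sub>R v) - f (x + h *\<^sub>R u) - f (x + h *\<^sub>R v) + f x) / h\<^sup>2" and ?y = "\<lambda>a b. x + a *\<^sub>R u + b *\<^sub>R v"
  fix e :: real assume e: "e > 0"
  have "continuous (at x) (\<lambda>y. DD y v)" using c S continuous_on_eq_continuous_at by blast
  then obtain \<delta> where \<delta>: "\<delta> > 0" "\<And>y. dist y x < \<delta> \<Longrightarrow> dist (DD y v) (DD x v) < e"
    using e unfolding continuous_at_eps_delta by metis
  obtain r where r: "r > 0" "\<And>y. dist y x < r \<Longrightarrow> y \<in> S" using S unfolding open_dist by blast
  let ?d = "min \<delta> r / (norm u + norm v + 1)"
  have d: "?d > 0" using \<delta> r by (auto intro!: divide_pos_pos add_nonneg_pos)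
  show "\<forall>\<^sub>F h in at_right 0. dist (?Q h) (DD x v) < e"
    unfolding eventually_at_right_field
  proof (intro exI[of _ ?d] conjI d allI impI)
    fix h :: real assume h: "0 < h" "h < ?d"
    have near: "dist (?y a b) x < min \<delta> r" if "0 \<le> a" "a \<le> h" "0 \<le> b" "b \<le> h" for a b
    proof -
      have "dist (?y a b) x \<le> a * norm u + b * norm v"
        using norm_triangle_ineq[of "a *\<^sub>R u" "b *\<^sub>R v"] that by (simp add: dist_norm)
      also have "\<dots> \<le> h * norm u + h * norm v" using that by (intro add_mono mult_right_mono) auto
      also have "\<dots> \<le> h * (norm u + norm v + 1)" using h by (simp add: algebra_simps)
      also have "\<dots> < min \<delta> r" using h(2) by (simp add: pos_less_divide_eq add_nonneg_pos)
      finally show ?thesis .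
    qed
    have inS: "?y a b \<in> S" if "0 \<le> a" "a \<le> h" "0 \<le> b" "b \<le> h" for a b
      using near[OF that] r(2) by simp
    define \<phi> where "\<phi> a = f (?y a h) - f (x + a *\<^sub>R u)" for a
    have "(\<phi> has_derivative (\<lambda>t. t * (D (?y a h) u - D (x + a *\<^sub>R u) u))) (at a)" if a: "0 \<le> a" "a \<le> h" for a
    proof -
      have 1: "((\<lambda>a. f (?y a b)) has_derivative (\<lambda>t. D (?y a b) (t *\<^sub>R u))) (at a)"
        if "0 \<le> b" "b \<le> h" for b
        using that a h by (intro has_derivative_compose[of _ "\<lambda>t. t *\<^sub>R u" _ _ f "D (?y a b)"] D inS)
           (auto intro!: derivative_eq_intros)
      have 2: "D y (t *\<^sub>R u) = t * D y u" if "y \<in> S" for y t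
        using linear_scale[OF has_derivative_linear[OF D[OF that]]] by simp
      show ?thesis unfolding \<phi>_def
        using has_derivative_diff[OF 1[of h] 1[of 0]] h 2[OF inS[of a h]] 2[OF inS[of a 0]] a
        by (simp add: algebra_simps)
    qed
    from mvt_simple[OF h(1), of \<phi>, OF has_derivative_at_withinI, OF this]
    obtain a where a: "a \<in> {0<..<h}" "\<phi> h - \<phi> 0 = h * (D (?y a h) u - D (x + a *\<^sub>R u) u)" by auto
    have "((\<lambda>b. D (?y a b) u) has_derivative (\<lambda>t. t * DD (?y a b) v)) (at b)"
      if b: "0 \<le> b" "b \<le> h" for b
    proof -
      have S': "?y a b \<in> S" using inS[of a b] a b by simp
      have "((\<lambda>b. D (?y a b) u) has_derivative (\<lambda>t. DD (?y a b) (t *\<^sub>R v))) (at b)"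
        by (rule has_derivative_compose[of "\<lambda>b. ?y a b" "\<lambda>t. t *\<^sub>R v" _ _ "\<lambda>y. D y u", OF _ DD[OF S']])
           (auto intro!: derivative_eq_intros)
      then show ?thesis using linear_scale[OF has_derivative_linear[OF DD[OF S']]] by simp
    qed
    from mvt_simple[OF h(1), of "\<lambda>b. D (?y a b) u", OF has_derivative_at_withinI, OF this]
    obtain b where b: "b \<in> {0<..<h}" "D (?y a h) u - D (x + a *\<^sub>R u) u = h * DD (?y a b) v" by auto
    have "f (?y h h) - f (x + h *\<^sub>R u) - f (x + h *\<^sub>R v) + f x = h\<^sup>2 * DD (?y a b) v"
      using a(2) b(2) by (simp add: \<phi>_def power2_eq_square)
    then have "?Q h = DD (?y a b) v"
      using h by simp
    then show "dist (?Q h) (DD x v) < e"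
      using \<delta>(2) near[of a b] a b by simp
  qed
qed

text \<open>Both sides are the limit of the same second difference quotient.\<close>

lemma second_derivative_symmetric:
  fixes f :: "'a::real_normed_vector \<Rightarrow> real"
  assumes S: "open S" "x \<in> S"
    and D: "\<And>y. y \<in> S \<Longrightarrow> (f has_derivative D y) (at y)"
    and DD: "\<And>y w. y \<in> S \<Longrightarrow> ((\<lambda>y. D y w) has_derivative DD w y) (at y)"
    and c: "\<And>v w. continuous_on S (\<lambda>y. DD w y v)"
  shows "DD u x v = DD v x u"
proof (rule tendsto_unique[OF trivial_limit_at_right_real])
  let ?Q = "\<lambda>u v h. (f (x + h *\<^sub>R u + h *\<^sub>R v) - f (x + h *\<^sub>R u) - f (x + h *\<^sub>R v) + f x) / h\<^sup>2"
  show "(?Q u v \<longlongrightarrow> DD u x v) (at_right 0)" by (rule second_difference_limit[OF S D DD c])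
  have "(?Q v u \<longlongrightarrow> DD v x u) (at_right 0)" by (rule second_difference_limit[OF S D DD c])
  moreover have "?Q v u = ?Q u v" by (auto simp: fun_eq_iff algebra_simps)
  ultimately show "(?Q u v \<longlongrightarrow> DD v x u) (at_right 0)" by simp
qed

section \<open>Regularity of parametrized linear problems\<close>

lemma linear_basis_sum:
  fixes f :: "'a::euclidean_space \<Rightarrow> 'b::real_vector"
  assumes "linear f" shows "f v = (\<Sum>b\<in>Basis. (v \<bullet> b) *\<^sub>R f b)"
  using linear_sum[OF assms, of "\<lambda>b. (v \<bullet> b) *\<^sub>R b" Basis] linear_scale[OF assms]
  by (simp add: euclidean_representation)

text \<open>Expanding \<open>v\<close> in the basis expresses every \<open>A' v\<close> through the
  \<open>A' b\<close>, by uniqueness of derivatives. This supplies multilinearity for the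
  derivatives of the metric and of the Christoffel symbols.\<close>

lemma has_derivative_param_linear:
  fixes A :: "'a::real_normed_vector \<Rightarrow> 'c::euclidean_space \<Rightarrow> 'b::real_normed_vector"
  assumes S: "open S" "x \<in> S" and lin: "\<And>y. y \<in> S \<Longrightarrow> linear (A y)"
    and A': "\<And>v. ((\<lambda>y. A y v) has_derivative A' v) (at x)"
  shows "linear (\<lambda>v. A' v h)"
proof -
  have *: "A' v = (\<lambda>h. \<Sum>b\<in>Basis. (v \<bullet> b) *\<^sub>R A' b h)" for v
  proof (rule has_derivative_unique[OF A'])
    have "((\<lambda>y. \<Sum>b\<in>Basis. (v \<bullet> b) *\<^sub>R A y b) has_derivative (\<lambda>h. \<Sum>b\<in>Basis. (v \<bullet> b) *\<^sub>R A' b h)) (at x)"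
      by (intro derivative_intros A')
    then show "((\<lambda>y. A y v) has_derivative (\<lambda>h. \<Sum>b\<in>Basis. (v \<bullet> b) *\<^sub>R A' b h)) (at x)"
      by (rule has_derivative_transform_within_open[OF _ S]) (metis linear_basis_sum[OF lin])
  qed
  show ?thesis
    by (subst *) (auto intro!: linearI simp: inner_add_left scaleR_add_left sum.distrib scaleR_sum_right)
qed

text \<open>A product rule for an \<open>A\<close> that is known to be differentiable only for each
  fixed argument. Linearity reduces it to the finitely many basis vectors, so no operator-valued
  derivative occurs.\<close>

lemma has_derivative_apply_linear:
  fixes A :: "'a::real_normed_vector \<Rightarrow> 'c::euclidean_space \<Rightarrow> 'b::real_normed_vector"
    and t :: "'d::real_normed_vector"
  assumes S: "open S" "q t \<in> S" and lin: "\<And>y. y \<in> S \<Longrightarrow> linear (A y)"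
    and A': "\<And>v. ((\<lambda>y. A y v) has_derivative A' v) (at (q t))"
    and q: "(q has_derivative q') (at t within I)" and Y: "(Y has_derivative Y') (at t within I)"
    and t: "t \<in> I"
  shows "((\<lambda>r. A (q r) (Y r)) has_derivative (\<lambda>h. A' (Y t) (q' h) + A (q t) (Y' h))) (at t within I)"
proof -
  have "((\<lambda>r. \<Sum>b\<in>Basis. (Y r \<bullet> b) *\<^sub>R A (q r) b) has_derivative
      (\<lambda>h. \<Sum>b\<in>Basis. (Y t \<bullet> b) *\<^sub>R A' b (q' h) + (Y' h \<bullet> b) *\<^sub>R A (q t) b)) (at t within I)"
    by (intro derivative_intros Y has_derivative_compose[OF q A'])
  also have "(\<lambda>h. \<Sum>b\<in>Basis. (Y t \<bullet> b) *\<^sub>R A' b (q' h) + (Y' h \<bullet> b) *\<^sub>R A (q t) b) =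
      (\<lambda>h. A' (Y t) (q' h) + A (q t) (Y' h))"
  proof
    fix h
    have "A' (Y t) (q' h) = (\<Sum>b\<in>Basis. (Y t \<bullet> b) *\<^sub>R A' b (q' h))"
      by (rule linear_basis_sum[OF has_derivative_param_linear[OF S lin A']])
    moreover have "A (q t) (Y' h) = (\<Sum>b\<in>Basis. (Y' h \<bullet> b) *\<^sub>R A (q t) b)"
      by (rule linear_basis_sum[OF lin[OF S(2)]])
    ultimately show "(\<Sum>b\<in>Basis. (Y t \<bullet> b) *\<^sub>R A' b (q' h) + (Y' h \<bullet> b) *\<^sub>R A (q t) b) =
      A' (Y t) (q' h) + A (q t) (Y' h)" by (simp only: sum.distrib)
  qed
  finally show ?thesis
  proof (rule has_derivative_transform_eventually)
    have "continuous (at t within I) q" using q has_derivative_continuous by blast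
    then have "\<forall>\<^sub>F r in at t within I. q r \<in> S"
      using S by (simp add: continuous_within topological_tendstoD)
    then show "\<forall>\<^sub>F r in at t within I. (\<Sum>b\<in>Basis. (Y r \<bullet> b) *\<^sub>R A (q r) b) = A (q r) (Y r)"
      by eventually_elim (metis linear_basis_sum[OF lin])
    show "(\<Sum>b\<in>Basis. (Y t \<bullet> b) *\<^sub>R A (q t) b) = A (q t) (Y t)"
      by (metis linear_basis_sum[OF lin] S(2))
  qed (rule t)
qed

lemma has_vector_derivative_apply_linear:
  fixes A :: "'a::real_normed_vector \<Rightarrow> 'c::euclidean_space \<Rightarrow> 'b::real_normed_vector"
  assumes S: "open S" "q t \<in> S" and lin: "\<And>y. y \<in> S \<Longrightarrow> linear (A y)"
    and A': "\<And>v. ((\<lambda>y. A y v) has_derivative A' v) (at (q t))"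
    and q: "(q has_vector_derivative q') (at t within I)"
    and Y: "(Y has_vector_derivative Y') (at t within I)" and t: "t \<in> I"
  shows "((\<lambda>r. A (q r) (Y r)) has_vector_derivative A' (Y t) q' + A (q t) Y') (at t within I)"
  using has_derivative_apply_linear[OF S lin A' q[unfolded has_vector_derivative_def]
      Y[unfolded has_vector_derivative_def] t]
    linear_scale[OF has_derivative_linear[OF A']] linear_scale[OF lin[OF S(2)]]
  by (simp add: has_vector_derivative_def scaleR_add_right)

text \<open>Implicit differentiation in which differentiability of the solution is part of the
  conclusion. It serves for everything defined by duality with an inner product: Christoffel
  symbols, their derivatives, and gradient fields.\<close>

lemma solve_has_derivative:
  fixes b :: "'p::euclidean_space \<Rightarrow> 'e::euclidean_space \<Rightarrow> 'e \<Rightarrow> real"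
  assumes S: "open S" "p \<in> S" and ipb: "\<And>q. q \<in> S \<Longrightarrow> inner_product (b q)"
    and b': "\<And>u v. ((\<lambda>q. b q u v) has_derivative b' u v) (at p)"
    and k': "\<And>v. ((\<lambda>q. k q v) has_derivative k' v) (at p)"
    and z: "\<And>q v. q \<in> S \<Longrightarrow> b q (z q) v = k q v"
  obtains z' where "(z has_derivative z') (at p)"
    and "\<And>h v. b p (z' h) v = k' v h - b' (z p) v h"
proof -
  interpret p: inner_prod "b p" using ipb[OF S(2)] by unfold_locales
  define n where "n q v = k q v - b q (z p) v" for q v
  define N where "N v h = k' v h - b' (z p) v h" for v h
  have nN: "((\<lambda>q. n q v) has_derivative N v) (at p)" for v
    unfolding n_def N_def by (intro derivative_intros k' b')
  have n_eq: "n q v = b q (z q - z p) v" if "q \<in> S" for q v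
    using z[OF that] bounded_bilinear.diff_left[OF inner_prod.bounded_bil, of "b q" "z q" "z p" v] ipb[OF that]
    by (simp add: n_def inner_prod_def)
  have lin_n: "linear (n q)" if "q \<in> S" for q
    unfolding n_eq[OF that, abs_def] using ipb[OF that] by (auto simp: inner_product_def bilinear_def)
  have lin_N: "linear (\<lambda>v. N v h)" for h by (rule has_derivative_param_linear[OF S lin_n nN])
  have "\<exists>g. \<forall>v. b p g v = N v h" for h using p.riesz[OF lin_N] by blast
  then obtain z' where z': "\<And>h v. b p (z' h) v = N v h" by metis
  have "linear z'"
    by (rule linearI; rule p.ext)
       (simp_all add: z' p.Bsimps linear_add[OF has_derivative_linear[OF nN]] linear_scale[OF has_derivative_linear[OF nN]])
  then have blz': "bounded_linear z'" by (simp add: linear_conv_bounded_linear)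
  then obtain C where C: "C > 0" "\<And>h. norm (z' h) \<le> norm h * C" using bounded_linear.pos_bounded by blast
  obtain c where c: "c > 0" "\<And>v. c * norm v \<le> norm_wrt (b p) v" by (rule p.nrm_equiv_lower) blast
  define \<delta> where "\<delta> q = (\<Sum>i\<in>Basis. \<Sum>j\<in>Basis. \<bar>b q i j - b p i j\<bar>)" for q
  have bd: "\<bar>b q u v - b p u v\<bar> \<le> norm u * norm v * \<delta> q" if q: "q \<in> S" for q u v
  proof -
    have ex: "b q u v = (\<Sum>i\<in>Basis. \<Sum>j\<in>Basis. (u \<bullet> i) * ((v \<bullet> j) * b q i j))" if "q \<in> S" for q
    proof -
      have l: "linear (\<lambda>u. b q u v)" "\<And>u. linear (b q u)" for v
        using ipb[OF that] by (auto simp: inner_product_def bilinear_def)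
      show ?thesis
        by (subst linear_basis_sum[OF l(1)], subst linear_basis_sum[OF l(2)]) (simp add: sum_distrib_left)
    qed
    have "b q u v - b p u v = (\<Sum>i\<in>Basis. \<Sum>j\<in>Basis. (u \<bullet> i) * ((v \<bullet> j) * (b q i j - b p i j)))"
      unfolding ex[OF q] ex[OF S(2)] by (simp add: algebra_simps sum_subtractf)
    also have "\<bar>\<dots>\<bar> \<le> (\<Sum>i\<in>Basis. \<Sum>j\<in>Basis. \<bar>(u \<bullet> i) * ((v \<bullet> j) * (b q i j - b p i j))\<bar>)"
      by (rule order_trans[OF sum_abs]) (intro sum_mono sum_abs)
    also have "\<dots> \<le> (\<Sum>i\<in>Basis. \<Sum>j\<in>Basis. norm u * (norm v * \<bar>b q i j - b p i j\<bar>))"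
      by (intro sum_mono) (auto simp: abs_mult intro!: mult_mono Basis_le_norm)
    also have "\<dots> = norm u * norm v * \<delta> q" by (simp add: \<delta>_def sum_distrib_left mult.assoc)
    finally show ?thesis .
  qed
  have "continuous (at p) \<delta>" unfolding \<delta>_def
    using has_derivative_continuous[OF b'] by (intro continuous_intros) auto
  then have \<delta>0: "(\<delta> \<longlongrightarrow> 0) (at p)" by (simp add: continuous_at \<delta>_def)
  define R where "R q = z q - z p - z' (q - p)" for q
  \<comment> \<open>The equation is tested with the remainder \<open>R q\<close> itself. Coercivity
    of \<open>b p\<close>, weakened by the deviation \<open>\<delta> q\<close> of \<open>b q\<close>
    from it, bounds \<open>R q\<close> by quantities that are small relative to
    \<open>q - p\<close>.\<close>
  have key: "(c\<^sup>2 - \<delta> q) * norm (R q) \<le> (\<Sum>i\<in>Basis. \<bar>n q i - n p i - N i (q - p)\<bar>) + C * \<delta> q * norm (q - p)"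
    if q: "q \<in> S" for q
  proof (cases "R q = 0")
    case True
    have "\<delta> q \<ge> 0" by (auto simp: \<delta>_def intro!: sum_nonneg)
    then show ?thesis using True C by (auto intro!: add_nonneg_nonneg sum_nonneg mult_nonneg_nonneg)
  next
    case False
    let ?r = "R q" and ?h = "q - p"
    have \<delta>q: "\<delta> q \<ge> 0" by (auto simp: \<delta>_def intro!: sum_nonneg)
    interpret q: inner_prod "b q" using ipb[OF q] by unfold_locales
    have np: "n p v = 0" for v using n_eq[OF S(2)] by simp
    have "c\<^sup>2 * (norm ?r)\<^sup>2 \<le> (norm_wrt (b p) ?r)\<^sup>2"
      using c(2)[of ?r] c(1) by (simp flip: power_mult_distrib add: power_mono)
    also have "\<dots> = b p ?r ?r" by (rule p.nrm_sq)
    also have "\<dots> \<le> b q ?r ?r + norm ?r * norm ?r * \<delta> q" using bd[OF q, of ?r ?r] by linarith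
    also have "b q ?r ?r = n q ?r - b q (z' ?h) ?r"
      using n_eq[OF q] by (simp add: R_def q.Bdiff)
    also have "\<dots> \<le> n q ?r - n p ?r - N ?r ?h + norm (z' ?h) * norm ?r * \<delta> q"
      using bd[OF q, of "z' ?h" ?r] by (simp add: np z')
    also have "n q ?r - n p ?r - N ?r ?h = (\<Sum>i\<in>Basis. (?r \<bullet> i) * (n q i - n p i - N i ?h))"
      by (subst linear_basis_sum[OF lin_n[OF q]], subst linear_basis_sum[OF lin_n[OF S(2)]], subst linear_basis_sum[OF lin_N])
         (simp add: sum_subtractf sum.distrib algebra_simps)
    also have "\<dots> \<le> (\<Sum>i\<in>Basis. norm ?r * \<bar>n q i - n p i - N i ?h\<bar>)"
    proof (intro sum_mono)
      fix i :: 'e assume "i \<in> Basis"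
      then have "\<bar>?r \<bullet> i\<bar> * \<bar>n q i - n p i - N i ?h\<bar> \<le> norm ?r * \<bar>n q i - n p i - N i ?h\<bar>"
        by (intro mult_right_mono Basis_le_norm) auto
      then show "(?r \<bullet> i) * (n q i - n p i - N i ?h) \<le> norm ?r * \<bar>n q i - n p i - N i ?h\<bar>"
        using abs_ge_self[of "(?r \<bullet> i) * (n q i - n p i - N i ?h)"] unfolding abs_mult by linarith
    qed
    also have "\<dots> = norm ?r * (\<Sum>i\<in>Basis. \<bar>n q i - n p i - N i ?h\<bar>)" by (simp add: sum_distrib_left)
    also have "norm (z' ?h) * norm ?r * \<delta> q \<le> (norm ?h * C) * norm ?r * \<delta> q"
      using C \<delta>q by (intro mult_right_mono) auto
    finally have "norm ?r * ((c\<^sup>2 - \<delta> q) * norm ?r) \<le> norm ?r * ((\<Sum>i\<in>Basis. \<bar>n q i - n p i - N i ?h\<bar>) + C * \<delta> q * norm ?h)"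
      by (simp add: algebra_simps power2_eq_square)
    then show ?thesis using False by simp
  qed
  have "(z has_derivative z') (at p)"
    unfolding has_derivative_iff_norm
  proof (intro conjI blz')
    let ?X = "\<lambda>q. (\<Sum>i\<in>Basis. \<bar>n q i - n p i - N i (q - p)\<bar> / norm (q - p)) + C * \<delta> q"
    have "((\<lambda>q. ?X q / (c\<^sup>2 - \<delta> q)) \<longlongrightarrow> ((\<Sum>i\<in>(Basis::'e set). 0) + C * 0) / (c\<^sup>2 - 0)) (at p)"
      using nN c(1) by (intro tendsto_intros \<delta>0) (auto simp: has_derivative_iff_norm)
    then have lim: "((\<lambda>q. ?X q / (c\<^sup>2 - \<delta> q)) \<longlongrightarrow> 0) (at p)" by simp
    have "\<forall>\<^sub>F q in at p. \<delta> q < c\<^sup>2" using \<delta>0 c(1) by (intro order_tendstoD) auto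
    with eventually_at_in_open[OF S]
    have "\<forall>\<^sub>F q in at p. norm (R q) / norm (q - p) \<le> ?X q / (c\<^sup>2 - \<delta> q)"
    proof eventually_elim
      case (elim q)
      then have h: "norm (q - p) > 0" by simp
      have "norm (R q) * (c\<^sup>2 - \<delta> q) \<le> ?X q * norm (q - p)"
        using key[of q] elim h by (simp add: algebra_simps flip: sum_divide_distrib)
      then show ?case using h elim by (simp add: divide_simps mult.commute)
    qed
    then show "((\<lambda>q. norm (z q - z p - z' (q - p)) / norm (q - p)) \<longlongrightarrow> 0) (at p)"
      unfolding R_def by (intro tendsto_sandwich[OF _ _ tendsto_const lim]) auto
  qed
  then show ?thesis using that z' by (simp add: N_def)
qed

section \<open>The Levi-Civita connection in a chart\<close>

lemma smooth_on_differentiable: "smooth_on f S \<Longrightarrow> x \<in> S \<Longrightarrow> f differentiable (at x)"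
  unfolding smooth_on_def by (metis Ck_on.simps(2))

lemma smooth_on_has_derivative:
  "smooth_on f S \<Longrightarrow> x \<in> S \<Longrightarrow> (f has_derivative frechet_derivative f (at x)) (at x)"
  using smooth_on_differentiable frechet_derivative_works by blast

lemma smooth_on_derivative: "smooth_on f S \<Longrightarrow> smooth_on (\<lambda>x. frechet_derivative f (at x) v) S"
  unfolding smooth_on_def by (metis Ck_on.simps(2))

lemma smooth_on_continuous: "smooth_on f S \<Longrightarrow> continuous_on S f"
  unfolding smooth_on_def by (metis Ck_on.simps(1))

locale local_metric =
  fixes g :: "'e::euclidean_space \<Rightarrow> 'e \<Rightarrow> 'e \<Rightarrow> real" and U :: "'e set"
  assumes openU: "open U" and ipg: "\<And>p. p \<in> U \<Longrightarrow> inner_product (g p)"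
    and smooth: "\<And>u v. smooth_on (\<lambda>p. g p u v) U"
begin

definition "dg p a b = frechet_derivative (\<lambda>q. g q a b) (at p)"
text \<open>Right-hand side of the Koszul formula for constant coordinate fields, whose Lie brackets
  vanish.\<close>

definition "koszul p u v w = (dg p v w u + dg p u w v - dg p u v w) / 2"
definition "Gam p u v = (THE z. \<forall>w. g p z w = koszul p u v w)"

lemma ipr: "p \<in> U \<Longrightarrow> inner_prod (g p)" by (simp add: ipg inner_prod.intro)

lemma dg: "p \<in> U \<Longrightarrow> ((\<lambda>q. g q a b) has_derivative dg p a b) (at p)"
  unfolding dg_def by (rule smooth_on_has_derivative[OF smooth])

lemma g_linear: "p \<in> U \<Longrightarrow> linear (\<lambda>u. g p u v)" "p \<in> U \<Longrightarrow> linear (g p u)"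
  using ipg by (auto simp: inner_product_def bilinear_def)

lemma g_commute: "p \<in> U \<Longrightarrow> g p u v = g p v u" using inner_prod.commute[OF ipr] .

lemma dg_linear:
  assumes "p \<in> U"
  shows "linear (\<lambda>a. dg p a b h)" "linear (\<lambda>b. dg p a b h)" "linear (dg p a b)"
  using has_derivative_param_linear[OF openU assms g_linear(1) dg[OF assms]]
    has_derivative_param_linear[OF openU assms g_linear(2) dg[OF assms]] has_derivative_linear[OF dg[OF assms]]
  by auto

lemma dg_commute: assumes "p \<in> U" shows "dg p a b = dg p b a"
proof (rule has_derivative_unique[OF dg[OF assms]])
  show "((\<lambda>q. g q a b) has_derivative dg p b a) (at p)"
    by (rule has_derivative_transform_within_open[OF dg[OF assms] openU assms]) (rule g_commute)
qed

lemma koszul_linear: "p \<in> U \<Longrightarrow> linear (koszul p u v)"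
  unfolding koszul_def
  by (intro linearI) (simp_all add: linear_add[OF dg_linear(1)] linear_add[OF dg_linear(2)] linear_add[OF dg_linear(3)]
      linear_scale[OF dg_linear(1)] linear_scale[OF dg_linear(2)] linear_scale[OF dg_linear(3)] field_simps)

lemma Gam_eq: assumes "p \<in> U" shows "g p (Gam p u v) w = koszul p u v w"
proof -
  interpret inner_prod "g p" by (rule ipr[OF assms])
  have "\<forall>w. g p (Gam p u v) w = koszul p u v w"
    unfolding Gam_def by (rule theI'[OF riesz[OF koszul_linear[OF assms]]])
  then show ?thesis by blast
qed

lemma Gam_commute: assumes "p \<in> U" shows "Gam p u v = Gam p v u"
  by (rule inner_prod.ext[OF ipr[OF assms]])
     (simp add: Gam_eq[OF assms] koszul_def dg_commute[OF assms, of u v])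

lemma Gam_linear_left: assumes "p \<in> U" shows "linear (\<lambda>u. Gam p u v)"
proof (rule linearI)
  interpret inner_prod "g p" by (rule ipr[OF assms])
  show "Gam p (a + b) v = Gam p a v + Gam p b v" for a b
    by (rule ext) (simp add: Bsimps Gam_eq[OF assms] koszul_def dg_linear[OF assms] linear_add
        linear_add[OF dg_linear(1)[OF assms]] add_divide_distrib diff_divide_distrib)
  show "Gam p (r *\<^sub>R a) v = r *\<^sub>R Gam p a v" for r a
    by (rule ext) (simp add: Bsimps Gam_eq[OF assms] koszul_def linear_scale[OF dg_linear(3)[OF assms]]
        linear_scale[OF dg_linear(1)[OF assms]] algebra_simps)
qed

lemma Gam_linear: assumes "p \<in> U" shows "linear (\<lambda>u. Gam p u v)" "linear (Gam p u)"
proof -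
  show "linear (\<lambda>u. Gam p u v)" by (rule Gam_linear_left[OF assms])
  have "Gam p u = (\<lambda>v. Gam p v u)" by (simp add: fun_eq_iff Gam_commute[OF assms, of u])
  then show "linear (Gam p u)" using Gam_linear_left[OF assms] by simp
qed

text \<open>Implicit differentiation of the Koszul identity makes \<open>Gam\<close> differentiable.
  The derivative again solves an identity with differentiable data, so a second application makes it
  differentiable and hence continuous, as linearizing the geodesic equation requires.\<close>

lemma Gam_has_derivative:
  obtains Gam' where "\<And>p u v. p \<in> U \<Longrightarrow> ((\<lambda>p. Gam p u v) has_derivative Gam' p u v) (at p)"
    and "\<And>u v h. continuous_on U (\<lambda>p. Gam' p u v h)"
proof -
  define kd where "kd p u v w h = (frechet_derivative (\<lambda>q. dg q v w u) (at p) h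
    + frechet_derivative (\<lambda>q. dg q u w v) (at p) h - frechet_derivative (\<lambda>q. dg q u v w) (at p) h) / 2" for p u v w h
  have sdg: "smooth_on (\<lambda>p. dg p a b h) U" for a b h
    unfolding dg_def by (rule smooth_on_derivative[OF smooth])
  have dk: "((\<lambda>p. koszul p u v w) has_derivative kd p u v w) (at p)" if "p \<in> U" for p u v w
    unfolding koszul_def kd_def
    by (intro bounded_linear.has_derivative[OF bounded_linear_divide] has_derivative_add has_derivative_diff
        smooth_on_has_derivative[OF sdg that])
  have ddk: "\<exists>k'. ((\<lambda>p. kd p u v w h) has_derivative k') (at p)" if "p \<in> U" for p u v w h
    unfolding kd_def
    by (rule exI, rule bounded_linear.has_derivative[OF bounded_linear_divide], rule has_derivative_diff,
        rule has_derivative_add, (rule smooth_on_has_derivative[OF smooth_on_derivative[OF sdg] that])+)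
  have "\<exists>z'. ((\<lambda>p. Gam p u v) has_derivative z') (at p) \<and>
      (\<forall>h w. g p (z' h) w = kd p u v w h - dg p (Gam p u v) w h)" if "p \<in> U" for p u v
    by (rule solve_has_derivative[OF openU that ipg dg[OF that] dk[OF that] Gam_eq]) auto
  then obtain G where G: "\<And>p u v. p \<in> U \<Longrightarrow> ((\<lambda>p. Gam p u v) has_derivative G p u v) (at p)"
    and Geq: "\<And>p u v h w. p \<in> U \<Longrightarrow> g p (G p u v h) w = kd p u v w h - dg p (Gam p u v) w h"
    by metis
  have "continuous_on U (\<lambda>p. G p u v h)" for u v h
  proof (intro continuous_at_imp_continuous_on ballI)
    fix p assume p: "p \<in> U"
    have "\<exists>k'. ((\<lambda>p. kd p u v w h - dg p (Gam p u v) w h) has_derivative k') (at p)" for w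
    proof -
      obtain k1 where k1: "((\<lambda>p. kd p u v w h) has_derivative k1) (at p)" using ddk[OF p] by blast
      have k2: "((\<lambda>p. dg p (Gam p u v) w h) has_derivative
          (\<lambda>k. frechet_derivative (\<lambda>q. dg q (Gam p u v) w h) (at p) k + dg p (G p u v k) w h)) (at p)"
        by (rule has_derivative_apply_linear[where A = "\<lambda>p a. dg p a w h" and q = "\<lambda>p. p", OF openU p dg_linear(1)])
           (auto intro!: smooth_on_has_derivative[OF sdg p] G[OF p])
      show ?thesis by (rule exI, rule has_derivative_diff[OF k1 k2])
    qed
    then obtain k' where k': "\<And>w. ((\<lambda>p. kd p u v w h - dg p (Gam p u v) w h) has_derivative k' w) (at p)"
      by metis
    obtain z' where "((\<lambda>p. G p u v h) has_derivative z') (at p)"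
      by (rule solve_has_derivative[OF openU p ipg dg[OF p] k' Geq]) auto
    then show "isCont (\<lambda>p. G p u v h) p" by (rule has_derivative_continuous)
  qed
  with G show ?thesis using that by blast
qed

text \<open>In these coordinates a parallel field along q satisfies Y' = - Gam q q' Y.\<close>

lemma parallel_inner_constant:
  assumes q: "(q has_vector_derivative q') (at t within I)" and t: "t \<in> I" "q t \<in> U"
    and Y: "(Y has_vector_derivative - Gam (q t) q' (Y t)) (at t within I)"
    and Z: "(Z has_vector_derivative - Gam (q t) q' (Z t)) (at t within I)"
  shows "((\<lambda>r. g (q r) (Y r) (Z r)) has_vector_derivative 0) (at t within I)"
proof -
  let ?p = "q t"
  let ?A = "\<lambda>(p, y) z. g p y z"
  have 1: "((\<lambda>(p, y). g p y z) has_derivative (\<lambda>(h, k). dg ?p (Y t) z h + g ?p k z)) (at (?p, Y t))" for z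
    using has_derivative_apply_linear[where q = fst and Y = snd and A = "\<lambda>p y. g p y z" and t = "(?p, Y t)" and I = UNIV,
        OF openU _ g_linear(1) _ has_derivative_fst[OF has_derivative_ident] has_derivative_snd[OF has_derivative_ident], of "\<lambda>y. dg ?p y z"] t(2)
    by (simp add: split_def dg)
  have "((\<lambda>r. ?A (q r, Y r) (Z r)) has_vector_derivative
     (\<lambda>(h, k). dg ?p (Y t) (Z t) h + g ?p k (Z t)) (q', - Gam ?p q' (Y t)) + ?A (?p, Y t) (- Gam ?p q' (Z t))) (at t within I)"
  proof (rule has_vector_derivative_apply_linear[where S = "U \<times> UNIV" and A = ?A])
    show "open (U \<times> (UNIV::'e set))" by (simp add: open_Times openU)
    show "linear (?A y)" if "y \<in> U \<times> UNIV" for y using g_linear(2) that by auto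
    show "((\<lambda>y. ?A y z) has_derivative (\<lambda>(h, k). dg ?p (Y t) z h + g ?p k z)) (at (?p, Y t))" for z
      using 1[of z] by (simp add: split_def)
    show "((\<lambda>r. (q r, Y r)) has_vector_derivative (q', - Gam ?p q' (Y t))) (at t within I)"
      using q Y by (rule has_vector_derivative_Pair)
  qed (use t Z in auto)
  moreover have "(\<lambda>(h, k). dg ?p (Y t) (Z t) h + g ?p k (Z t)) (q', - Gam ?p q' (Y t)) + ?A (?p, Y t) (- Gam ?p q' (Z t)) = 0"
  proof -
    interpret inner_prod "g ?p" by (rule ipr[OF t(2)])
    \<comment> \<open>Metric compatibility: in the sum of the two Koszul identities only the
      derivative of the metric along \<open>q'\<close> survives, and the other terms cancel in
      pairs.\<close>
    have "2 * g ?p (Gam ?p q' (Y t)) (Z t) = dg ?p (Y t) (Z t) q' + dg ?p q' (Z t) (Y t) - dg ?p q' (Y t) (Z t)"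
      "2 * g ?p (Gam ?p q' (Z t)) (Y t) = dg ?p (Z t) (Y t) q' + dg ?p q' (Y t) (Z t) - dg ?p q' (Z t) (Y t)"
      by (simp_all add: Gam_eq[OF t(2)] koszul_def)
    then show ?thesis
      using commute[of "Y t" "Gam ?p q' (Z t)"] dg_commute[OF t(2), of "Y t" "Z t"] by (simp add: Bminus)
  qed
  ultimately show ?thesis by simp
qed

end

section \<open>Charts and transition maps\<close>

locale riem_mfd =
  fixes M :: "('m::{t2_space, second_countable_topology}, 'e::euclidean_space) riem"
  assumes mfd: "riemannian_manifold M"
begin

abbreviation "tch \<equiv> to_chart M"

definition "transition c d = chart_map d \<circ> chart_inv c"
definition "overlap c d = chart_map c ` (chart_dom c \<inter> chart_dom d)"
text \<open>The differential of a change of coordinates is indexed by the point of the manifold, so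
  that composition takes the cocycle form of \<open>DT_chain\<close> without inverse charts.\<close>

definition "DT c d y = frechet_derivative (transition c d) (at (chart_map c y))"

context fixes c assumes c: "c \<in> atlas M"
begin

lemma open_chart_dom: "open (chart_dom c)" and open_chart_img: "open (chart_img c)"
  and chart_homeo: "homeomorphism (chart_dom c) (chart_img c) (chart_map c) (chart_inv c)"
  using mfd c by (auto simp: riemannian_manifold_def)

lemma chart_inv_map [simp]: "y \<in> chart_dom c \<Longrightarrow> chart_inv c (chart_map c y) = y"
  using chart_homeo by (simp add: homeomorphism_def)
lemma chart_map_inv [simp]: "p \<in> chart_img c \<Longrightarrow> chart_map c (chart_inv c p) = p"
  using chart_homeo by (simp add: homeomorphism_def)
lemma chart_map_img [simp]: "y \<in> chart_dom c \<Longrightarrow> chart_map c y \<in> chart_img c"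
  by (simp add: chart_img_def)
lemma chart_inv_dom [simp]: "p \<in> chart_img c \<Longrightarrow> chart_inv c p \<in> chart_dom c"
  by (auto simp: chart_img_def)
lemma continuous_chart_map: "continuous_on (chart_dom c) (chart_map c)"
  using chart_homeo by (simp add: homeomorphism_def)
lemma continuous_chart_inv: "continuous_on (chart_img c) (chart_inv c)"
  using chart_homeo by (simp add: homeomorphism_def)

end

lemma chart_at_atlas [simp]: "chart_at M y \<in> atlas M" and chart_at_dom [simp]: "y \<in> chart_dom (chart_at M y)"
  using mfd by (auto simp: riemannian_manifold_def)

lemma metric_ip: "inner_product (metric M y)" using mfd by (simp add: riemannian_manifold_def)
lemma metric_inner_prod: "inner_prod (metric M y)" by (simp add: metric_ip inner_prod.intro)

lemma overlap_alt:
  assumes "c \<in> atlas M"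
  shows "overlap c d = {p \<in> chart_img c. chart_inv c p \<in> chart_dom d}"
  using assms unfolding overlap_def by (force simp: chart_img_def)

lemma open_overlap: assumes "c \<in> atlas M" "d \<in> atlas M" shows "open (overlap c d)"
proof -
  have "overlap c d = chart_img c \<inter> chart_inv c -` chart_dom d" unfolding overlap_alt[OF assms(1)] by auto
  then show ?thesis
    using continuous_open_preimage[OF continuous_chart_inv[OF assms(1)] open_chart_img[OF assms(1)] open_chart_dom[OF assms(2)]]
    by simp
qed

lemma overlapI: "y \<in> chart_dom c \<Longrightarrow> y \<in> chart_dom d \<Longrightarrow> chart_map c y \<in> overlap c d"
  by (auto simp: overlap_def)

lemma smooth_transition: "c \<in> atlas M \<Longrightarrow> d \<in> atlas M \<Longrightarrow> smooth_on (transition c d) (overlap c d)"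
  using mfd by (simp add: riemannian_manifold_def transition_def overlap_def)

lemma transition_map: "c \<in> atlas M \<Longrightarrow> y \<in> chart_dom c \<Longrightarrow> transition c d (chart_map c y) = chart_map d y"
  by (simp add: transition_def)

lemma DT: 
  assumes "c \<in> atlas M" "d \<in> atlas M" "y \<in> chart_dom c" "y \<in> chart_dom d"
  shows "(transition c d has_derivative DT c d y) (at (chart_map c y))"
  unfolding DT_def by (rule smooth_on_has_derivative[OF smooth_transition overlapI]) (use assms in auto)

lemma DT_linear: 
  assumes "c \<in> atlas M" "d \<in> atlas M" "y \<in> chart_dom c" "y \<in> chart_dom d"
  shows "linear (DT c d y)"
  using DT[OF assms] by (rule has_derivative_linear)

lemma DT_chain:
  assumes "c \<in> atlas M" "d \<in> atlas M" "e \<in> atlas M"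
    and y: "y \<in> chart_dom c" "y \<in> chart_dom d" "y \<in> chart_dom e"
  shows "DT d e y (DT c d y v) = DT c e y v"
proof -
  have "(transition d e \<circ> transition c d has_derivative DT d e y \<circ> DT c d y) (at (chart_map c y))"
    using DT[OF assms(2,3) y(2,3)] by (intro diff_chain_at DT assms) (simp add: transition_map assms)
  then have "(transition c e has_derivative DT d e y \<circ> DT c d y) (at (chart_map c y))"
  proof (rule has_derivative_transform_within_open)
    show "open (overlap c d)" "chart_map c y \<in> overlap c d" using assms by (auto intro: open_overlap overlapI)
    fix p assume "p \<in> overlap c d"
    then show "(transition d e \<circ> transition c d) p = transition c e p"
      unfolding overlap_def using assms by (auto simp: transition_map)
  qed
  then have "DT d e y \<circ> DT c d y = DT c e y" using DT[of c e y] assms has_derivative_unique by blast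
  then show ?thesis by (metis comp_apply)
qed

lemma DT_self: assumes "c \<in> atlas M" "y \<in> chart_dom c" shows "DT c c y v = v"
proof -
  have "(transition c c has_derivative (\<lambda>v. v)) (at (chart_map c y))"
    by (rule has_derivative_transform_within_open[OF has_derivative_ident open_chart_img[OF assms(1)]])
       (use assms in \<open>auto simp: transition_def\<close>)
  then show ?thesis using DT[of c c y] assms has_derivative_unique by metis
qed

lemma to_chart_DT: "tch c y = DT (chart_at M y) c y"
  and from_chart_DT: "from_chart M c y = DT c (chart_at M y) y"
  by (auto simp: to_chart_def from_chart_def DT_def transition_def)

context fixes c y assumes cy: "c \<in> atlas M" "y \<in> chart_dom c"
begin

lemma to_chart_linear: "linear (tch c y)" using cy by (simp add: to_chart_DT DT_linear)
lemma from_chart_linear: "linear (from_chart M c y)" using cy by (simp add: from_chart_DT DT_linear)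
lemma to_from_chart [simp]: "tch c y (from_chart M c y v) = v"
  using cy by (simp add: to_chart_DT from_chart_DT DT_chain DT_self)
lemma from_to_chart [simp]: "from_chart M c y (tch c y v) = v"
  using cy by (simp add: to_chart_DT from_chart_DT DT_chain DT_self)
lemma DT_to_chart: "d \<in> atlas M \<Longrightarrow> y \<in> chart_dom d \<Longrightarrow> DT c d y (tch c y v) = tch d y v"
  using cy by (simp add: to_chart_DT DT_chain)
lemma chart_metric_map: "chart_metric M c (chart_map c y) (tch c y u) (tch c y v) = metric M y u v"
  using cy by (simp add: chart_metric_def)
lemma to_chart_inj: "tch c y u = tch c y v \<Longrightarrow> u = v" by (metis from_to_chart)

end

lemma to_chart_self [simp]: "tch (chart_at M y) y v = v" by (simp add: to_chart_DT DT_self)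

lemma chart_local_metric: assumes c: "c \<in> atlas M" shows "local_metric (chart_metric M c) (chart_img c)"
proof
  show "open (chart_img c)" by (rule open_chart_img[OF c])
  show "smooth_on (\<lambda>p. chart_metric M c p u v) (chart_img c)" for u v
    using mfd c by (simp add: riemannian_manifold_def)
  fix p assume p: "p \<in> chart_img c"
  let ?y = "chart_inv c p"
  interpret inner_prod "metric M ?y" by (rule metric_inner_prod)
  have y: "?y \<in> chart_dom c" using c p by simp
  have l: "linear (from_chart M c ?y)" by (rule from_chart_linear[OF c y])
  have nz: "from_chart M c ?y v \<noteq> 0" if "v \<noteq> 0" for v
    using to_from_chart[OF c y, of v] that linear_0[OF to_chart_linear[OF c y]] by auto
  show "inner_product (chart_metric M c p)"
    unfolding inner_product_def bilinear_def
    by (auto intro!: linearI simp: chart_metric_def linear_add[OF l] linear_scale[OF l] Bsimps commute pos nz)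
qed

abbreviation "Chr \<equiv> christoffel M"

lemma christoffel_Gam: "c \<in> atlas M \<Longrightarrow> Chr c = local_metric.Gam (chart_metric M c)"
  by (simp add: fun_eq_iff christoffel_def Let_def local_metric.Gam_def[OF chart_local_metric]
      local_metric.koszul_def[OF chart_local_metric] local_metric.dg_def[OF chart_local_metric])

lemma Chr_linear: 
  assumes "c \<in> atlas M" "p \<in> chart_img c" shows "linear (\<lambda>u. Chr c p u v)" "linear (Chr c p u)"
  using local_metric.Gam_linear[OF chart_local_metric] assms by (auto simp: christoffel_Gam)

lemma Chr_commute: assumes "c \<in> atlas M" "p \<in> chart_img c" shows "Chr c p u v = Chr c p v u"
  using local_metric.Gam_commute[OF chart_local_metric] assms by (auto simp: christoffel_Gam)

text \<open>Right-hand side of the parallel equation, with \<open>velocity\<close> in place of the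
  derivative of the curve within an interval. The two agree along geodesics on nondegenerate
  intervals.\<close>

abbreviation "par_rhs c g t v \<equiv> - Chr c (chart_map c (g t)) (tch c (g t) (velocity M g t)) v"

definition "D2T c d y u v = frechet_derivative (\<lambda>p. frechet_derivative (transition c d) (at p) u) (at (chart_map c y)) v"

lemma D2T:
  assumes "c \<in> atlas M" "d \<in> atlas M" "y \<in> chart_dom c" "y \<in> chart_dom d"
  shows "((\<lambda>p. frechet_derivative (transition c d) (at p) u) has_derivative D2T c d y u) (at (chart_map c y))"
  unfolding D2T_def[abs_def]
  by (rule smooth_on_has_derivative[OF smooth_on_derivative[OF smooth_transition] overlapI]) (use assms in auto)

lemma D2T_commute:
  assumes c: "c \<in> atlas M" "d \<in> atlas M" and y: "y \<in> chart_dom c" "y \<in> chart_dom d"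
  shows "D2T c d y u v = D2T c d y v u"
proof (rule euclidean_eqI)
  fix i :: 'e assume "i \<in> Basis"
  let ?F = "frechet_derivative (transition c d)"
  have s: "smooth_on (\<lambda>p. ?F (at p) w) (overlap c d)" for w
    by (rule smooth_on_derivative[OF smooth_transition[OF c]])
  have "frechet_derivative (\<lambda>p. ?F (at p) u) (at (chart_map c y)) v \<bullet> i =
      frechet_derivative (\<lambda>p. ?F (at p) v) (at (chart_map c y)) u \<bullet> i"
    by (rule second_derivative_symmetric[where f = "\<lambda>p. transition c d p \<bullet> i" and S = "overlap c d"
          and D = "\<lambda>p h. ?F (at p) h \<bullet> i" and DD = "\<lambda>w p h. frechet_derivative (\<lambda>p. ?F (at p) w) (at p) h \<bullet> i"])
       (use c y in \<open>auto intro!: open_overlap overlapI has_derivative_inner_left continuous_intros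
          smooth_on_has_derivative[OF smooth_transition] smooth_on_has_derivative[OF s] smooth_on_continuous[OF smooth_on_derivative[OF s]]\<close>)
  then show "D2T c d y u v \<bullet> i = D2T c d y v u \<bullet> i" by (simp add: D2T_def)
qed

lemma D2T_linear:
  assumes c: "c \<in> atlas M" "d \<in> atlas M" and y: "y \<in> chart_dom c" "y \<in> chart_dom d"
  shows "linear (D2T c d y u)" "linear (\<lambda>u. D2T c d y u v)"
proof -
  show 1: "linear (D2T c d y u)" for u by (rule has_derivative_linear[OF D2T[OF assms]])
  have "(\<lambda>u. D2T c d y u v) = D2T c d y v" by (simp add: fun_eq_iff D2T_commute[OF assms, of _ v])
  then show "linear (\<lambda>u. D2T c d y u v)" using 1 by simp
qed

lemma eventually_chart:
  assumes "continuous (at t within I) g" "c \<in> atlas M" "g t \<in> chart_dom c"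
  shows "\<forall>\<^sub>F r in at t within I. g r \<in> chart_dom c"
  using assms open_chart_dom[OF assms(2)] by (simp add: continuous_within topological_tendstoD)

lemma curve_change_chart:
  assumes c: "c \<in> atlas M" "d \<in> atlas M" and y: "g t \<in> chart_dom c" "g t \<in> chart_dom d"
    and g: "continuous (at t within I) g" and t: "t \<in> I"
    and q: "(chart_map c \<circ> g has_vector_derivative v) (at t within I)"
  shows "(chart_map d \<circ> g has_vector_derivative DT c d (g t) v) (at t within I)"
proof -
  have "((transition c d \<circ> (chart_map c \<circ> g)) has_derivative DT c d (g t) \<circ> (\<lambda>h. h *\<^sub>R v)) (at t within I)"
    using q unfolding has_vector_derivative_def
    by (rule diff_chain_within) (use DT[OF c y] in \<open>auto intro: has_derivative_at_withinI\<close>)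
  then have "(chart_map d \<circ> g has_derivative DT c d (g t) \<circ> (\<lambda>h. h *\<^sub>R v)) (at t within I)"
    by (rule has_derivative_transform_eventually)
       (use eventually_chart[OF g c(1) y(1)] y c t in \<open>auto elim!: eventually_mono simp: transition_map\<close>)
  then show ?thesis by (simp add: has_vector_derivative_def comp_def linear_scale[OF DT_linear[OF c y]])
qed

text \<open>Besides the transformed derivative there appears a second derivative of the transition
  map. It is this term that the inhomogeneous part of the transformation law for Christoffel symbols
  compensates.\<close>

lemma field_change_chart:
  assumes c: "c \<in> atlas M" "d \<in> atlas M" and y: "g t \<in> chart_dom c" "g t \<in> chart_dom d"
    and g: "continuous (at t within I) g" and t: "t \<in> I"
    and q: "(chart_map c \<circ> g has_vector_derivative v) (at t within I)"
    and Y: "((\<lambda>r. tch c (g r) (V r)) has_vector_derivative Y') (at t within I)"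
  shows "((\<lambda>r. tch d (g r) (V r)) has_vector_derivative
     D2T c d (g t) (tch c (g t) (V t)) v + DT c d (g t) Y') (at t within I)"
proof -
  let ?A = "\<lambda>p. frechet_derivative (transition c d) (at p)"
  have "((\<lambda>r. ?A ((chart_map c \<circ> g) r) (tch c (g r) (V r))) has_vector_derivative
     D2T c d (g t) (tch c (g t) (V t)) v + ?A ((chart_map c \<circ> g) t) Y') (at t within I)"
  proof (rule has_vector_derivative_apply_linear[OF open_overlap[OF c] _ _ _ q Y t])
    show "(chart_map c \<circ> g) t \<in> overlap c d" using y by (simp add: overlapI)
    show "linear (?A p)" if "p \<in> overlap c d" for p
      by (rule has_derivative_linear[OF smooth_on_has_derivative[OF smooth_transition[OF c] that]])
    show "((\<lambda>p. ?A p v) has_derivative D2T c d (g t) v) (at ((chart_map c \<circ> g) t))" for v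
      using D2T[OF c y] by simp
  qed
  then have *: "((\<lambda>r. DT c d (g r) (tch c (g r) (V r))) has_derivative
     (\<lambda>h. h *\<^sub>R (D2T c d (g t) (tch c (g t) (V t)) v + DT c d (g t) Y'))) (at t within I)"
    by (simp add: DT_def has_vector_derivative_def)
  have "\<forall>\<^sub>F r in at t within I. DT c d (g r) (tch c (g r) (V r)) = tch d (g r) (V r)"
    using eventually_chart[OF g c(1) y(1)] eventually_chart[OF g c(2) y(2)]
    by eventually_elim (simp add: DT_to_chart c)
  then show ?thesis unfolding has_vector_derivative_def
    by (rule has_derivative_transform_eventually[OF *]) (simp_all add: DT_to_chart c y t)
qed

text \<open>\<open>velocity\<close> sees only the preferred chart of each point. Transferring it to
  an arbitrary chart turns the definition of a geodesic into the usual second-order equation in that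
  chart.\<close>

lemma geodesic_chart:
  assumes g: "geodesic M g" and c: "c \<in> atlas M" "g t \<in> chart_dom c"
  shows geodesic_chart_velocity: "(chart_map c \<circ> g has_vector_derivative tch c (g t) (velocity M g t)) (at t)"
    and geodesic_chart_acceleration: "((\<lambda>r. tch c (g r) (velocity M g r)) has_vector_derivative
      par_rhs c g t (tch c (g t) (velocity M g t))) (at t)"
proof -
  have cont: "continuous (at t) g"
    using g by (simp add: geodesic_def continuous_on_eq_continuous_at)
  have "(chart_map (chart_at M (g t)) \<circ> g) differentiable (at t)" using g by (simp add: geodesic_def)
  then have "(chart_map (chart_at M (g t)) \<circ> g has_vector_derivative velocity M g t) (at t)"
    unfolding velocity_def using vector_derivative_works by blast
  from curve_change_chart[OF _ c(1) _ c(2) cont UNIV_I this]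
  show 1: "(chart_map c \<circ> g has_vector_derivative tch c (g t) (velocity M g t)) (at t)"
    by (simp add: to_chart_DT)
  have "parallel_along M g UNIV (velocity M g)" using g by (simp add: geodesic_def)
  then have "((\<lambda>r. tch c (g r) (velocity M g r)) has_vector_derivative
      - Chr c (chart_map c (g t)) (vector_derivative (chart_map c \<circ> g) (at t)) (tch c (g t) (velocity M g t))) (at t)"
    using c unfolding parallel_along_def by blast
  then show "((\<lambda>r. tch c (g r) (velocity M g r)) has_vector_derivative
      par_rhs c g t (tch c (g t) (velocity M g t))) (at t)"
    unfolding vector_derivative_at[OF 1] .
qed

lemma geodesic_cont: "geodesic M g \<Longrightarrow> continuous (at t within I) g"
  by (simp add: geodesic_def continuous_on_eq_continuous_at continuous_at_imp_continuous_within)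

end

section \<open>Transformation law of the Christoffel symbols\<close>

locale complete_mfd =
  fixes M :: "('m::{t2_space, second_countable_topology}, 'e::euclidean_space) riem"
  assumes complete: "complete_riemannian_manifold M"
begin

sublocale riem_mfd M by unfold_locales (use complete in \<open>simp add: complete_riemannian_manifold_def\<close>)

lemma geodesic_exists: obtains g where "geodesic M g" "g 0 = y" "velocity M g 0 = s"
  using complete by (auto simp: complete_riemannian_manifold_def)

text \<open>Geodesics in every direction satisfy the geodesic equation in both charts, which determines
  the quadratic form of the transformed Christoffel symbols; polarization gives the rest.\<close>

lemma Chr_change_chart:
  assumes c: "c \<in> atlas M" "d \<in> atlas M" and y: "y \<in> chart_dom c" "y \<in> chart_dom d"
  shows "Chr d (chart_map d y) (DT c d y u) (DT c d y v) = DT c d y (Chr c (chart_map c y) u v) - D2T c d y u v"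
proof -
  define E where "E u v = Chr d (chart_map d y) (DT c d y u) (DT c d y v) - DT c d y (Chr c (chart_map c y) u v) + D2T c d y u v" for u v
  have quad: "E u u = 0" for u
  proof -
    obtain g where g: "geodesic M g" "g 0 = y" "velocity M g 0 = from_chart M c y u" by (rule geodesic_exists)
    have y0: "g 0 \<in> chart_dom c" "g 0 \<in> chart_dom d" using y g by auto
    have v: "tch c (g 0) (velocity M g 0) = u" using c y by (simp add: g)
    have v': "tch d (g 0) (velocity M g 0) = DT c d y u"
      using DT_to_chart[OF c(1) y(1) c(2) y(2), of "velocity M g 0"] v by (simp add: g)
    note 1 = field_change_chart[OF c y0 geodesic_cont[OF g(1)] UNIV_I
        geodesic_chart_velocity[OF g(1) c(1) y0(1)] geodesic_chart_acceleration[OF g(1) c(1) y0(1)]]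
    note 2 = geodesic_chart_acceleration[OF g(1) c(2) y0(2)]
    have "D2T c d y u u + DT c d y (- Chr c (chart_map c y) u u) = - Chr d (chart_map d y) (DT c d y u) (DT c d y u)"
      using vector_derivative_unique_at[OF 1 2] unfolding v v' by (simp add: g(2))
    then show ?thesis by (simp add: E_def linear_neg[OF DT_linear[OF c y]] algebra_simps)
  qed
  have img: "chart_map c y \<in> chart_img c" "chart_map d y \<in> chart_img d" using c y by auto
  note lin = DT_linear[OF c y] D2T_linear[OF c y] Chr_linear[OF c(1) img(1)] Chr_linear[OF c(2) img(2)]
  have "E (u + v) (u + v) = E u u + E v v + E u v + E v u"
    by (simp add: E_def linear_add[OF lin(1)] linear_add[OF lin(2)] linear_add[OF lin(3)] linear_add[OF lin(4)]
        linear_add[OF lin(5)] linear_add[OF lin(6)] linear_add[OF lin(7)] algebra_simps)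
  moreover have "E u v = E v u"
    using Chr_commute[OF c(1) img(1), of u v] Chr_commute[OF c(2) img(2), of "DT c d y u" "DT c d y v"] D2T_commute[OF c y, of u v]
    by (simp add: E_def)
  ultimately have "E u v + E u v = 0" by (simp add: quad)
  then have "E u v = 0" by (metis add_cancel_right_right scaleR_2 scaleR_eq_0_iff zero_neq_numeral)
  then show ?thesis by (simp add: E_def algebra_simps)
qed

text \<open>The second-derivative terms of \<open>field_change_chart\<close> and
  \<open>Chr_change_chart\<close> cancel, so the parallel equation in one chart yields it in every
  other chart around the point.\<close>

lemma parallel_change_chart:
  assumes c: "c \<in> atlas M" "d \<in> atlas M" and y: "g t \<in> chart_dom c" "g t \<in> chart_dom d"
    and g: "continuous (at t within I) g" and t: "t \<in> I"
    and q: "(chart_map c \<circ> g has_vector_derivative v) (at t within I)"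
    and Y: "((\<lambda>r. tch c (g r) (V r)) has_vector_derivative - Chr c (chart_map c (g t)) v (tch c (g t) (V t))) (at t within I)"
  shows "((\<lambda>r. tch d (g r) (V r)) has_vector_derivative - Chr d (chart_map d (g t)) (DT c d (g t) v) (tch d (g t) (V t))) (at t within I)"
  using field_change_chart[OF c y g t q Y] Chr_change_chart[OF c y, of v "tch c (g t) (V t)"]
  by (simp add: DT_to_chart c y linear_neg[OF DT_linear[OF c y]] D2T_commute[OF c y, of v])

end

section \<open>Geodesics and the exponential map\<close>

context local_metric
begin

text \<open>The geodesic vector field on the phase space of a chart, that is, the geodesic equation
  in first-order form.\<close>

definition spray :: "'e \<times> 'e \<Rightarrow> 'e \<times> 'e" where "spray z = (snd z, - Gam (fst z) (snd z) (snd z))"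

lemma Gam_curve_has_derivative:
  assumes G: "\<And>p u v. p \<in> U \<Longrightarrow> ((\<lambda>p. Gam p u v) has_derivative G p u v) (at p)"
    and q: "(q has_derivative q') (at t within I)" and y: "(y has_derivative y') (at t within I)"
    and z: "(z has_derivative z') (at t within I)" and t: "t \<in> I" "q t \<in> U"
  shows "((\<lambda>r. Gam (q r) (y r) (z r)) has_derivative
    (\<lambda>h. G (q t) (y t) (z t) (q' h) + Gam (q t) (y' h) (z t) + Gam (q t) (y t) (z' h))) (at t within I)"
proof -
  let ?A = "\<lambda>x. Gam (fst x) (snd x)"
  have "((\<lambda>r. ?A (q r, y r) (z r)) has_derivative
     (\<lambda>h. (\<lambda>k. G (q t) (y t) (z t) (fst k) + Gam (q t) (snd k) (z t)) (q' h, y' h) + ?A (q t, y t) (z' h))) (at t within I)"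
  proof (rule has_derivative_apply_linear[where S = "U \<times> UNIV" and A = ?A and q = "\<lambda>r. (q r, y r)"
        and A' = "\<lambda>v k. G (q t) (y t) v (fst k) + Gam (q t) (snd k) v"])
    show "open (U \<times> (UNIV::'e set))" by (simp add: open_Times openU)
    show "linear (?A y)" if "y \<in> U \<times> UNIV" for y using Gam_linear(2) that by auto
    show "((\<lambda>x. ?A x v) has_derivative (\<lambda>k. G (q t) (y t) v (fst k) + Gam (q t) (snd k) v)) (at (q t, y t))" for v
      using has_derivative_apply_linear[where q = fst and Y = snd and A = "\<lambda>p y. Gam p y v" and t = "(q t, y t)" and I = UNIV,
        OF openU _ Gam_linear(1) _ has_derivative_fst[OF has_derivative_ident] has_derivative_snd[OF has_derivative_ident],
        of "\<lambda>u. G (q t) u v"] t(2) G by simp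
    show "((\<lambda>r. (q r, y r)) has_derivative (\<lambda>h. (q' h, y' h))) (at t within I)"
      using q y by (rule has_derivative_Pair)
  qed (use z t in auto)
  then show ?thesis by (simp add: add.assoc)
qed

text \<open>Multilinearity bounds both maps by their values on basis vectors, whose norms are
  continuous on the compact set. One constant serves for both because it bounds the sum of the
  two.\<close>

lemma bounded_multilinear_on_compact:
  assumes K: "compact K" "K \<subseteq> U"
    and G: "\<And>p u v. p \<in> U \<Longrightarrow> ((\<lambda>p. Gam p u v) has_derivative G p u v) (at p)"
    and cG: "\<And>u v h. continuous_on U (\<lambda>p. G p u v h)"
  obtains C where "C > 0" "\<And>p u v. p \<in> K \<Longrightarrow> norm (Gam p u v) \<le> C * norm u * norm v"
    and "\<And>p u v h. p \<in> K \<Longrightarrow> norm (G p u v h) \<le> C * norm u * norm v * norm h"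
proof -
  have gb: "norm (f v) \<le> norm v * (\<Sum>i\<in>Basis. norm (f i))" if "linear f" for f :: "'e \<Rightarrow> 'e" and v
  proof -
    have "norm (f v) \<le> (\<Sum>i\<in>Basis. norm ((v \<bullet> i) *\<^sub>R f i))"
      by (subst linear_basis_sum[OF that]) (rule norm_sum)
    also have "\<dots> \<le> (\<Sum>i\<in>Basis. norm v * norm (f i))"
      by (intro sum_mono) (auto intro!: mult_right_mono Basis_le_norm)
    finally show ?thesis by (simp add: sum_distrib_left)
  qed
  have linG: "linear (\<lambda>u. G p u v h)" "linear (\<lambda>v. G p u v h)" "linear (G p u v)" if "p \<in> U" for p u v h
    using has_derivative_param_linear[OF openU that Gam_linear(1) G[OF that]]
      has_derivative_param_linear[OF openU that Gam_linear(2) G[OF that]] has_derivative_linear[OF G[OF that]] by auto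
  have cGam: "continuous_on U (\<lambda>p. Gam p u v)" for u v
    using has_derivative_continuous[OF G] by (auto intro: continuous_at_imp_continuous_on)
  let ?S1 = "\<lambda>p. \<Sum>i\<in>Basis. \<Sum>j\<in>Basis. norm (Gam p i j)"
  let ?S2 = "\<lambda>p. \<Sum>i\<in>Basis. \<Sum>j\<in>Basis. \<Sum>k\<in>Basis. norm (G p i j k)"
  have "continuous_on K (\<lambda>p. ?S1 p + ?S2 p)"
    by (intro continuous_intros continuous_on_subset[OF cGam K(2)] continuous_on_subset[OF cG K(2)])
  then have "bounded ((\<lambda>p. ?S1 p + ?S2 p) ` K)" using K(1) compact_continuous_image compact_imp_bounded by blast
  then obtain C where C: "C > 0" "\<And>p. p \<in> K \<Longrightarrow> \<bar>?S1 p + ?S2 p\<bar> \<le> C" unfolding bounded_pos by fastforce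
  have nn: "?S1 p \<ge> 0" "?S2 p \<ge> 0" for p by (intro sum_nonneg norm_ge_zero)+
  show ?thesis
  proof
    show "C > 0" by (rule C(1))
    fix p u v assume p: "p \<in> K"
    then have pU: "p \<in> U" using K by blast
    have S: "?S1 p \<le> C" "?S2 p \<le> C" using C(2)[OF p] nn[of p] by linarith+
    have "norm (Gam p u v) \<le> norm u * (\<Sum>i\<in>Basis. norm (Gam p i v))" by (rule gb[OF Gam_linear(1)[OF pU]])
    also have "\<dots> \<le> norm u * (\<Sum>i\<in>Basis. norm v * (\<Sum>j\<in>Basis. norm (Gam p i j)))"
      by (intro mult_left_mono sum_mono gb[OF Gam_linear(2)[OF pU]]) auto
    also have "\<dots> = norm u * norm v * ?S1 p" by (simp add: sum_distrib_left mult_ac)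
    also have "\<dots> \<le> norm u * norm v * C" by (intro mult_left_mono S) auto
    finally show "norm (Gam p u v) \<le> C * norm u * norm v" by (simp add: mult_ac)
    fix h
    have "norm (G p u v h) \<le> norm u * (\<Sum>i\<in>Basis. norm (G p i v h))" by (rule gb[OF linG(1)[OF pU]])
    also have "\<dots> \<le> norm u * (\<Sum>i\<in>Basis. norm v * (\<Sum>j\<in>Basis. norm (G p i j h)))"
      by (intro mult_left_mono sum_mono gb[OF linG(2)[OF pU]]) auto
    also have "\<dots> \<le> norm u * (\<Sum>i\<in>Basis. norm v * (\<Sum>j\<in>Basis. norm h * (\<Sum>k\<in>Basis. norm (G p i j k))))"
      by (intro mult_left_mono sum_mono gb[OF linG(3)[OF pU]]) auto
    also have "\<dots> = norm u * norm v * norm h * ?S2 p" by (simp add: sum_distrib_left mult_ac)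
    also have "\<dots> \<le> norm u * norm v * norm h * C" by (intro mult_left_mono S) auto
    finally show "norm (G p u v h) \<le> C * norm u * norm v * norm h" by (simp add: mult_ac)
  qed
qed

text \<open>The derivative is packaged as a bounded linear operator so that continuity refers to the
  operator norm, as \<open>flow_has_derivative\<close> demands. It is checked on basis vectors,
  where multilinearity leaves sums of continuous functions of the base point weighted by coordinates
  of the velocity.\<close>

lemma spray_has_derivative:
  obtains X' :: "'e \<times> 'e \<Rightarrow> ('e \<times> 'e) \<Rightarrow>\<^sub>L ('e \<times> 'e)" and G
  where "\<And>z. fst z \<in> U \<Longrightarrow> (spray has_derivative X' z) (at z)"
    and "continuous_on (U \<times> UNIV) X'"
    and "\<And>p u v. p \<in> U \<Longrightarrow> ((\<lambda>p. Gam p u v) has_derivative G p u v) (at p)"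
    and "\<And>u v h. continuous_on U (\<lambda>p. G p u v h)"
    and "\<And>q v a b. q \<in> U \<Longrightarrow> X' (q, v) (a, b) = (b, - (G q v v a + Gam q b v + Gam q v b))"
proof -
  obtain G where G: "\<And>p u v. p \<in> U \<Longrightarrow> ((\<lambda>p. Gam p u v) has_derivative G p u v) (at p)"
    and cG: "\<And>u v h. continuous_on U (\<lambda>p. G p u v h)" by (rule Gam_has_derivative) blast
  let ?D = "\<lambda>z h. (snd h, - (G (fst z) (snd z) (snd z) (fst h) + Gam (fst z) (snd h) (snd z) + Gam (fst z) (snd z) (snd h)))"
  have d: "(spray has_derivative ?D z) (at z)" if "fst z \<in> U" for z
    unfolding spray_def
    by (intro has_derivative_Pair has_derivative_minus Gam_curve_has_derivative[OF G])
       (use that in \<open>auto intro!: derivative_eq_intros\<close>)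
  define X' where "X' z = Blinfun (?D z)" for z
  have X': "blinfun_apply (X' z) = ?D z" if "fst z \<in> U" for z
    unfolding X'_def by (rule bounded_linear_Blinfun_apply[OF has_derivative_bounded_linear[OF d[OF that]]])
  have linG: "linear (\<lambda>u. G p u v h)" "linear (\<lambda>v. G p u v h)" if "p \<in> U" for p u v h
    using has_derivative_param_linear[OF openU that Gam_linear(1) G[OF that]]
      has_derivative_param_linear[OF openU that Gam_linear(2) G[OF that]] by auto
  have cGam: "continuous_on U (\<lambda>p. Gam p u v)" for u v
    using has_derivative_continuous[OF G] by (auto intro: continuous_at_imp_continuous_on)
  have cfst: "continuous_on (U \<times> UNIV) (\<lambda>z. f (fst z))" if "continuous_on U f" for f :: "'e \<Rightarrow> 'e"
    by (rule continuous_on_compose2[OF that continuous_on_fst[OF continuous_on_id]]) auto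
  have "continuous_on (U \<times> UNIV) X'"
  proof (rule continuous_on_blinfun_componentwise)
    fix h :: "'e \<times> 'e" assume "h \<in> Basis"
    have "continuous_on (U \<times> UNIV) (\<lambda>z. (snd h, - ((\<Sum>i\<in>Basis. (snd z \<bullet> i) *\<^sub>R (\<Sum>j\<in>Basis. (snd z \<bullet> j) *\<^sub>R G (fst z) i j (fst h)))
        + (\<Sum>i\<in>Basis. (snd z \<bullet> i) *\<^sub>R Gam (fst z) (snd h) i) + (\<Sum>i\<in>Basis. (snd z \<bullet> i) *\<^sub>R Gam (fst z) i (snd h)))))"
      by (intro continuous_intros cfst cG cGam)
    moreover have "(snd h, - ((\<Sum>i\<in>Basis. (snd z \<bullet> i) *\<^sub>R (\<Sum>j\<in>Basis. (snd z \<bullet> j) *\<^sub>R G (fst z) i j (fst h)))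
        + (\<Sum>i\<in>Basis. (snd z \<bullet> i) *\<^sub>R Gam (fst z) (snd h) i) + (\<Sum>i\<in>Basis. (snd z \<bullet> i) *\<^sub>R Gam (fst z) i (snd h)))) = X' z h"
      if "z \<in> U \<times> UNIV" for z
    proof -
      have p: "fst z \<in> U" using that by auto
      show ?thesis unfolding X'[OF p]
        by (simp only: linear_basis_sum[OF linG(1)[OF p], of "snd z" "snd z" "fst h", symmetric]
          linear_basis_sum[OF linG(2)[OF p], of _ "snd z" "fst h", symmetric]
          linear_basis_sum[OF Gam_linear(2)[OF p], of "snd h" "snd z", symmetric]
          linear_basis_sum[OF Gam_linear(1)[OF p], of "snd z" "snd h", symmetric])
    qed
    ultimately show "continuous_on (U \<times> UNIV) (\<lambda>z. X' z h)" by (simp cong: continuous_on_cong)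
  qed
  then show ?thesis using d G cG X' by (intro that[of X' G]) auto
qed

lemma spray_locally_lipschitz:
  assumes "fst z0 \<in> U"
  obtains r L where "r > 0" "L \<ge> 0" 
    and "\<And>z w. z \<in> cball z0 r \<Longrightarrow> w \<in> cball z0 r \<Longrightarrow> norm (spray z - spray w) \<le> L * norm (z - w)"
proof -
  obtain X' :: "'e \<times> 'e \<Rightarrow> ('e \<times> 'e) \<Rightarrow>\<^sub>L ('e \<times> 'e)" where
    X': "\<And>z. fst z \<in> U \<Longrightarrow> (spray has_derivative X' z) (at z)" and cX': "continuous_on (U \<times> UNIV) X'"
    by (rule spray_has_derivative) blast
  have "open (U \<times> (UNIV :: 'e set))" "z0 \<in> U \<times> UNIV" using assms by (simp_all add: openU open_Times mem_Times_iff)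
  then obtain r where r: "r > 0" "cball z0 r \<subseteq> U \<times> UNIV" unfolding open_contains_cball by blast
  have "bounded (X' ` cball z0 r)"
    using continuous_on_subset[OF cX' r(2)] compact_continuous_image compact_cball compact_imp_bounded by blast
  then obtain L where L: "L > 0" "\<And>z. z \<in> cball z0 r \<Longrightarrow> norm (X' z) \<le> L" unfolding bounded_pos by blast
  show ?thesis
  proof (rule that[of r L])
    fix z w assume "z \<in> cball z0 r" "w \<in> cball z0 r"
    then show "norm (spray z - spray w) \<le> L * norm (z - w)"
      using r(2) L(2)
      by (intro differentiable_bound[where S = "cball z0 r" and f' = "\<lambda>z. X' z"])
         (auto simp flip: norm_blinfun.rep_eq intro!: has_derivative_at_withinI X')
  qed (use r L in auto)
qed

end

lemma ode_unique_local:
  fixes u :: "real \<Rightarrow> 'a::real_inner"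
  assumes u: "\<And>r. \<bar>r - t\<bar> < d \<Longrightarrow> (u has_vector_derivative u' r) (at r)"
    and le: "\<And>r. \<bar>r - t\<bar> < d \<Longrightarrow> norm (u' r) \<le> L * norm (u r)"
    and L: "L \<ge> 0" and u0: "u t = 0" and r: "\<bar>r - t\<bar> < d"
  shows "u r = 0"
proof (cases "r \<ge> t")
  case True
  have "(norm (u r))\<^sup>2 \<le> exp ((2 * L + 1) * (r - t)) * ((norm (u t))\<^sup>2 + 0\<^sup>2 * (r - t))"
    using L r True le by (intro gronwall_sq[where b = r and u' = u'] has_vector_derivative_at_within[OF u]) auto
  then show ?thesis by (simp add: u0)
next
  case False
  \<comment> \<open>Gronwall's inequality runs forward only; the past is reached by reversing
    time.\<close>
  let ?v = "\<lambda>x. u (- x)"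
  have "(norm (?v (- r)))\<^sup>2 \<le> exp ((2 * L + 1) * (- r - (- t))) * ((norm (?v (- t)))\<^sup>2 + 0\<^sup>2 * (- r - (- t)))"
  proof (rule gronwall_sq[where b = "- r" and u' = "\<lambda>x. - u' (- x)"])
    fix x assume x: "x \<in> {- t..- r}"
    have "(uminus has_vector_derivative (- 1)) (at x)" by (auto intro!: derivative_eq_intros)
    from vector_diff_chain_at[OF this, of u "u' (- x)"] u[of "- x"] x r
    have "(?v has_vector_derivative - u' (- x)) (at x)" by (auto simp: comp_def)
    then show "(?v has_vector_derivative - u' (- x)) (at x within {- t..- r})" by (rule has_vector_derivative_at_within)
    show "norm (- u' (- x)) \<le> L * norm (?v x) + 0" using le[of "- x"] x r by auto
  qed (use L False in auto)
  then show ?thesis by (simp add: u0)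
qed

section \<open>Uniqueness of geodesics and the exponential map\<close>

context riem_mfd
begin

lemma geodesic_phase:
  assumes "geodesic M g" "c \<in> atlas M" "g t \<in> chart_dom c"
  shows "((\<lambda>r. (chart_map c (g r), tch c (g r) (velocity M g r))) has_vector_derivative
    local_metric.spray (chart_metric M c) (chart_map c (g t), tch c (g t) (velocity M g t))) (at t)"
  using has_vector_derivative_Pair[OF geodesic_chart[OF assms]]
  by (simp add: comp_def local_metric.spray_def[OF chart_local_metric[OF assms(2)]] christoffel_Gam assms(2))

lemma geodesic_unique_local:
  assumes g: "geodesic M g" and h: "geodesic M h" and eq: "g t = h t" "velocity M g t = velocity M h t"
  shows "\<exists>d>0. \<forall>r. \<bar>r - t\<bar> < d \<longrightarrow> g r = h r \<and> velocity M g r = velocity M h r"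
proof -
  define c where "c = chart_at M (g t)"
  have c: "c \<in> atlas M" and ct: "g t \<in> chart_dom c" "h t \<in> chart_dom c" using eq by (auto simp: c_def)
  interpret local_metric "chart_metric M c" "chart_img c" by (rule chart_local_metric[OF c])
  define z where "z g r = (chart_map c (g r), tch c (g r) (velocity M g r))" for g r
  have dz: "(z k has_vector_derivative spray (z k r)) (at r)" if "geodesic M k" "k r \<in> chart_dom c" for k r
    unfolding z_def by (rule geodesic_phase[OF that(1) c that(2)])
  have z_eq: "z g t = z h t" using eq by (simp add: z_def)
  obtain r0 L where r0: "r0 > 0" and L: "L \<ge> 0"
    and lip: "\<And>a b. a \<in> cball (z g t) r0 \<Longrightarrow> b \<in> cball (z g t) r0 \<Longrightarrow> norm (spray a - spray b) \<le> L * norm (a - b)"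
    using spray_locally_lipschitz[of "z g t"] ct c by (auto simp: z_def)
  have ev: "\<forall>\<^sub>F r in nhds t. k r \<in> chart_dom c \<and> z k r \<in> cball (z g t) r0"
    if k: "geodesic M k" "k t \<in> chart_dom c" "z k t = z g t" for k
  proof -
    have "isCont k t" using k(1) geodesic_cont by blast
    then have "(k \<longlongrightarrow> k t) (nhds t)" by (simp add: isCont_def tendsto_at_iff_tendsto_nhds)
    from topological_tendstoD[OF this open_chart_dom[OF c] k(2)]
    have "\<forall>\<^sub>F r in nhds t. k r \<in> chart_dom c" .
    moreover have "isCont (z k) t" using dz[OF k(1,2)] by (rule has_vector_derivative_continuous)
    then have "(z k \<longlongrightarrow> z k t) (nhds t)" by (simp add: isCont_def tendsto_at_iff_tendsto_nhds)
    from topological_tendstoD[OF this open_ball, of "z g t" r0]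
    have "\<forall>\<^sub>F r in nhds t. z k r \<in> ball (z g t) r0" using r0 k(3) by simp
    ultimately show ?thesis by eventually_elim auto
  qed
  have "\<forall>\<^sub>F r in nhds t. (g r \<in> chart_dom c \<and> z g r \<in> cball (z g t) r0) \<and> (h r \<in> chart_dom c \<and> z h r \<in> cball (z g t) r0)"
    by (intro eventually_conj[OF ev[OF g ct(1) refl] ev[OF h ct(2) z_eq[symmetric]]])
  then obtain d where d: "d > 0" "\<And>r. \<bar>r - t\<bar> < d \<Longrightarrow>
      (g r \<in> chart_dom c \<and> z g r \<in> cball (z g t) r0) \<and> (h r \<in> chart_dom c \<and> z h r \<in> cball (z g t) r0)"
    unfolding eventually_nhds_metric dist_real_def by auto
  have "z g r - z h r = 0" if "\<bar>r - t\<bar> < d" for r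
    by (rule ode_unique_local[of t d "\<lambda>r. z g r - z h r" "\<lambda>r. spray (z g r) - spray (z h r)" L])
       (use d dz g h lip L z_eq that in \<open>auto intro!: has_vector_derivative_diff\<close>)
  then have zz: "chart_map c (g r) = chart_map c (h r)" "tch c (g r) (velocity M g r) = tch c (h r) (velocity M h r)"
    if "\<bar>r - t\<bar> < d" for r using that by (auto simp: z_def zero_prod_def)
  have "g r = h r \<and> velocity M g r = velocity M h r" if r: "\<bar>r - t\<bar> < d" for r
  proof -
    have "g r = h r" using zz(1)[OF r] d(2)[OF r] c by (metis chart_inv_map)
    then show ?thesis using zz(2)[OF r] d(2)[OF r] to_chart_inj[OF c, of "g r" "velocity M g r" "velocity M h r"] by simp
  qed
  then show ?thesis using d(1) by blast
qed

text \<open>The set of times at which positions and velocities agree is nonempty, open by local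
  uniqueness, and closed, while the line is connected.\<close>

lemma geodesic_unique:
  assumes g: "geodesic M g" and h: "geodesic M h" and eq: "g t = h t" "velocity M g t = velocity M h t"
  shows "g = h"
proof -
  define A where "A = {r. g r = h r \<and> velocity M g r = velocity M h r}"
  have "open A"
    unfolding open_dist dist_real_def A_def using geodesic_unique_local[OF g h] by blast
  moreover have "closed A"
    unfolding closed_def open_dist
  proof
    fix t assume t: "t \<in> - A"
    show "\<exists>e>0. \<forall>r. dist r t < e \<longrightarrow> r \<in> - A"
    proof (cases "g t = h t")
      case False
      have "closed {r. g r = h r}"
        using g h by (intro closed_Collect_eq) (auto simp: geodesic_def)
      then have "open (- {r. g r = h r})" by (simp add: open_closed)
      then show ?thesis using False unfolding open_dist A_def by blast
    next
      case True
      \<comment> \<open>\<open>velocity\<close> refers to the preferred chart of the moving point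
        and may jump. Different velocities at a common point are therefore separated by their
        coordinates in one fixed chart, which are continuous.\<close>
      define c where "c = chart_at M (g t)"
      have c: "c \<in> atlas M" and ct: "g t \<in> chart_dom c" "h t \<in> chart_dom c" using True by (auto simp: c_def)
      let ?y = "\<lambda>k r. tch c (k r) (velocity M k r)"
      have ne: "?y g t \<noteq> ?y h t" using t True to_chart_inj[OF c ct(1)] by (auto simp: A_def)
      have "isCont (\<lambda>r. ?y g r - ?y h r) t"
        using geodesic_chart_acceleration[OF g c ct(1)] geodesic_chart_acceleration[OF h c ct(2)]
        by (intro continuous_intros has_vector_derivative_continuous)
      then have "((\<lambda>r. ?y g r - ?y h r) \<longlongrightarrow> ?y g t - ?y h t) (nhds t)"
        unfolding isCont_def by (rule iffD1[OF tendsto_at_iff_tendsto_nhds[where g = "\<lambda>r. ?y g r - ?y h r"]])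
      from topological_tendstoD[OF this, of "- {0}"]
      have "\<forall>\<^sub>F r in nhds t. ?y g r - ?y h r \<in> - {0}" using ne by (simp add: open_Compl)
      then have "\<forall>\<^sub>F r in nhds t. r \<notin> A" by eventually_elim (auto simp: A_def)
      then show ?thesis unfolding eventually_nhds_metric by auto
    qed
  qed
  moreover have "A \<noteq> {}" using eq by (auto simp: A_def)
  ultimately have "A = UNIV" using clopen[of A] by simp
  then show ?thesis by (auto simp: A_def fun_eq_iff)
qed

text \<open>The acceleration acquires the factor \<open>a\<close> twice, and so does the Christoffel
  term, once for each linear argument. Rescaling is what makes
  \<open>Exp M x (t *\<^sub>R s)\<close> run along a single geodesic.\<close>

lemma geodesic_scale:
  assumes g: "geodesic M g"
  shows "geodesic M (\<lambda>t. g (a * t))" and "velocity M (\<lambda>t. g (a * t)) t = a *\<^sub>R velocity M g (a * t)"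
proof -
  let ?h = "\<lambda>t. g (a * t)"
  have sc: "((\<lambda>r. f (a * r)) has_vector_derivative a *\<^sub>R f') (at t)"
    if "(f has_vector_derivative f') (at (a * t))" for f :: "real \<Rightarrow> 'e" and f' t
  proof -
    have "((*) a has_vector_derivative a) (at t)" by (auto intro!: derivative_eq_intros)
    from vector_diff_chain_at[OF this that] show ?thesis by (simp add: comp_def)
  qed
  have v: "(chart_map c \<circ> ?h has_vector_derivative a *\<^sub>R tch c (g (a * t)) (velocity M g (a * t))) (at t)"
    if "c \<in> atlas M" "g (a * t) \<in> chart_dom c" for c t
    using sc[OF geodesic_chart_velocity[OF g that]] by (simp add: comp_def)
  show vel: "velocity M ?h t = a *\<^sub>R velocity M g (a * t)" for t
    unfolding velocity_def[of M ?h] using vector_derivative_at[OF v[OF chart_at_atlas chart_at_dom]] by simp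
  have "continuous_on UNIV (g \<circ> (*) a)"
    using g by (intro continuous_on_compose continuous_intros) (auto simp: geodesic_def intro: continuous_on_subset)
  moreover have "parallel_along M ?h UNIV (velocity M ?h)"
    unfolding parallel_along_def
  proof (intro ballI impI)
    fix c t assume c: "c \<in> atlas M" and t: "?h t \<in> chart_dom c"
    note l = to_chart_linear[OF c] and p = chart_map_img[OF c t]
    have "((\<lambda>r. a *\<^sub>R tch c (g (a * r)) (velocity M g (a * r))) has_vector_derivative
       a *\<^sub>R (a *\<^sub>R - Chr c (chart_map c (g (a * t))) (tch c (g (a * t)) (velocity M g (a * t))) (tch c (g (a * t)) (velocity M g (a * t))))) (at t)"
      by (rule bounded_linear.has_vector_derivative[OF bounded_linear_scaleR_right sc[OF geodesic_chart_acceleration[OF g c t]]])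
    then have A: "((\<lambda>r. a *\<^sub>R tch c (g (a * r)) (velocity M g (a * r))) has_vector_derivative
       - Chr c (chart_map c (?h t)) (a *\<^sub>R tch c (?h t) (velocity M g (a * t))) (tch c (?h t) (velocity M ?h t))) (at t)"
      by (simp add: vel linear_scale[OF l[OF t]] linear_scale[OF Chr_linear(1)[OF c p]] linear_scale[OF Chr_linear(2)[OF c p]])
    have "isCont ?h t" using \<open>continuous_on UNIV (g \<circ> (*) a)\<close> by (simp add: comp_def continuous_on_eq_continuous_at)
    then have ev: "\<forall>\<^sub>F r in at t. ?h r \<in> chart_dom c" using eventually_chart[OF _ c] t by blast
    have "((\<lambda>r. tch c (?h r) (velocity M ?h r)) has_vector_derivative
       - Chr c (chart_map c (?h t)) (a *\<^sub>R tch c (?h t) (velocity M g (a * t))) (tch c (?h t) (velocity M ?h t))) (at t)"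
      unfolding has_vector_derivative_def
      by (rule has_derivative_transform_eventually[OF A[unfolded has_vector_derivative_def]])
         (use ev t in \<open>auto elim!: eventually_mono simp: vel linear_scale[OF l]\<close>)
    then show "((\<lambda>r. tch c (?h r) (velocity M ?h r)) has_vector_derivative
       - Chr c (chart_map c (?h t)) (vector_derivative (chart_map c \<circ> ?h) (at t)) (tch c (?h t) (velocity M ?h t))) (at t)"
      unfolding vector_derivative_at[OF v[OF c t]] .
  qed
  ultimately show "geodesic M ?h"
    unfolding geodesic_def using v by (auto simp: comp_def intro: differentiableI_vector)
qed

lemma Exp_eq:
  assumes g: "geodesic M g" shows "Exp M (g 0) (t *\<^sub>R velocity M g 0) = g t"
  unfolding Exp_def
proof (rule the_equality)
  let ?h = "\<lambda>r. g (t * r)"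
  show "\<exists>h. geodesic M h \<and> h 0 = g 0 \<and> velocity M h 0 = t *\<^sub>R velocity M g 0 \<and> h 1 = g t"
    using geodesic_scale[OF g, of t] by (intro exI[of _ ?h]) simp
  fix y assume "\<exists>h. geodesic M h \<and> h 0 = g 0 \<and> velocity M h 0 = t *\<^sub>R velocity M g 0 \<and> h 1 = y"
  then obtain h where h: "geodesic M h" "h 0 = g 0" "velocity M h 0 = t *\<^sub>R velocity M g 0" "h 1 = y" by blast
  then have "h = ?h" using geodesic_scale[OF g, of t] by (intro geodesic_unique[where t = 0]) auto
  then show "y = g t" using h by auto
qed

end

section \<open>Parallel transport along geodesics\<close>

context riem_mfd
begin

text \<open>Formulated with \<open>velocity\<close> so that it stays meaningful for
  \<open>a = b\<close>, where the derivative of the curve within the interval is not determined. The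
  subdivision argument for existence includes such intervals.\<close>

definition par_on :: "(real \<Rightarrow> 'm) \<Rightarrow> real \<Rightarrow> real \<Rightarrow> (real \<Rightarrow> 'e) \<Rightarrow> bool" where
  "par_on g a b V \<longleftrightarrow> (\<forall>c\<in>atlas M. \<forall>t\<in>{a..b}. g t \<in> chart_dom c \<longrightarrow>
     ((\<lambda>r. tch c (g r) (V r)) has_vector_derivative
        par_rhs c g t (tch c (g t) (V t))) (at t within {a..b}))"

lemma par_onD: "par_on g a b V \<Longrightarrow> t \<in> {a..b} \<Longrightarrow> c \<in> atlas M \<Longrightarrow> g t \<in> chart_dom c \<Longrightarrow>
   ((\<lambda>r. tch c (g r) (V r)) has_vector_derivative
        par_rhs c g t (tch c (g t) (V t))) (at t within {a..b})"
  by (simp add: par_on_def)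

lemma at_within_Icc_not_bot: "a < b \<Longrightarrow> t \<in> {a..b} \<Longrightarrow> at t within {a..b} \<noteq> bot" for a b t :: real
  by (simp add: trivial_limit_within islimpt_Icc)

lemma parallel_along_iff_par_on:
  assumes g: "geodesic M g" and ab: "a < b"
  shows "parallel_along M g {a..b} V \<longleftrightarrow> par_on g a b V"
proof -
  have *: "vector_derivative (chart_map c \<circ> g) (at t within {a..b}) = tch c (g t) (velocity M g t)"
    if "t \<in> {a..b}" "c \<in> atlas M" "g t \<in> chart_dom c" for t c
    by (rule vector_derivative_within[OF at_within_Icc_not_bot[OF ab that(1)]
        has_vector_derivative_at_within[OF geodesic_chart_velocity[OF g that(2,3)]]])
  show ?thesis unfolding parallel_along_def par_on_def by (intro ball_cong imp_cong refl) (simp only: *)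
qed

lemma geodesic_par_on: assumes "geodesic M g" shows "par_on g a b (velocity M g)"
  using geodesic_chart_acceleration[OF assms] by (auto simp: par_on_def intro: has_vector_derivative_at_within)

lemma chart_transform:
  assumes g: "geodesic M g" and c: "c \<in> atlas M" "g t \<in> chart_dom c" and t: "t \<in> I"
    and f: "(f has_vector_derivative f') (at t within I)"
    and eq: "\<And>r. g r \<in> chart_dom c \<Longrightarrow> f r = h r"
  shows "(h has_vector_derivative f') (at t within I)"
  unfolding has_vector_derivative_def
proof (rule has_derivative_transform_eventually[OF f[unfolded has_vector_derivative_def]])
  show "\<forall>\<^sub>F r in at t within I. f r = h r"
    using eventually_chart[OF geodesic_cont[OF g] c] by eventually_elim (rule eq)
qed (use eq c t in auto)

lemma par_on_lincomb:
  assumes g: "geodesic M g" and V: "par_on g a b V" and W: "par_on g a b W"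
  shows "par_on g a b (\<lambda>t. \<alpha> *\<^sub>R V t + \<beta> *\<^sub>R W t)"
  unfolding par_on_def
proof (intro ballI impI)
  fix t c assume t: "t \<in> {a..b}" and c: "c \<in> atlas M" "g t \<in> chart_dom c"
  let ?G = "Chr c (chart_map c (g t)) (tch c (g t) (velocity M g t))"
  have lG: "linear ?G" using c by (intro Chr_linear) auto
  have ext: "\<alpha> *\<^sub>R tch c (g r) (V r) + \<beta> *\<^sub>R tch c (g r) (W r) = tch c (g r) (\<alpha> *\<^sub>R V r + \<beta> *\<^sub>R W r)"
    if "g r \<in> chart_dom c" for r
    using to_chart_linear[OF c(1) that] by (simp add: linear_add linear_scale)
  have "((\<lambda>r. \<alpha> *\<^sub>R tch c (g r) (V r) + \<beta> *\<^sub>R tch c (g r) (W r)) has_vector_derivative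
      \<alpha> *\<^sub>R - ?G (tch c (g t) (V t)) + \<beta> *\<^sub>R - ?G (tch c (g t) (W t))) (at t within {a..b})"
    by (intro has_vector_derivative_add bounded_linear.has_vector_derivative[OF bounded_linear_scaleR_right] par_onD[OF V t c] par_onD[OF W t c])
  from chart_transform[OF g c t this ext]
  show "((\<lambda>r. tch c (g r) (\<alpha> *\<^sub>R V r + \<beta> *\<^sub>R W r)) has_vector_derivative - ?G (tch c (g t) (\<alpha> *\<^sub>R V t + \<beta> *\<^sub>R W t))) (at t within {a..b})"
    by (simp add: ext[OF c(2), symmetric] linear_add[OF lG] linear_scale[OF lG])
qed

lemma par_on_inner:
  assumes g: "geodesic M g" and V: "par_on g a b V" and W: "par_on g a b W" and t: "t \<in> {a..b}"
  shows "metric M (g t) (V t) (W t) = metric M (g a) (V a) (W a)"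
proof -
  let ?f = "\<lambda>r. metric M (g r) (V r) (W r)"
  have "(?f has_derivative (\<lambda>h. 0)) (at r within {a..b})" if r: "r \<in> {a..b}" for r
  proof -
    define c where "c = chart_at M (g r)"
    have c: "c \<in> atlas M" "g r \<in> chart_dom c" by (simp_all add: c_def)
    interpret local_metric "chart_metric M c" "chart_img c" by (rule chart_local_metric[OF c(1)])
    have "((\<lambda>r. chart_metric M c ((chart_map c \<circ> g) r) (tch c (g r) (V r)) (tch c (g r) (W r))) has_vector_derivative 0) (at r within {a..b})"
      by (rule parallel_inner_constant[OF has_vector_derivative_at_within[OF geodesic_chart_velocity[OF g c]] r])
         (use par_onD[OF V r c] par_onD[OF W r c] c in \<open>simp_all add: christoffel_Gam\<close>)
    from chart_transform[OF g c r this, of ?f] show ?thesis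
      by (simp add: chart_metric_map c(1) has_vector_derivative_def)
  qed
  then obtain k where "\<forall>r\<in>{a..b}. ?f r = k"
    using has_derivative_zero_constant[of "{a..b}" ?f] by auto
  then show ?thesis using t by simp
qed

text \<open>The difference of two parallel fields is parallel, and parallel fields have constant
  norm, so this uniqueness comes directly from metric compatibility.\<close>

lemma par_on_unique:
  assumes g: "geodesic M g" and V: "par_on g a b V" and W: "par_on g a b W" and t: "t \<in> {a..b}" and eq: "V a = W a"
  shows "V t = W t"
proof -
  interpret inner_prod "metric M (g t)" by (rule metric_inner_prod)
  have "metric M (g t) (1 *\<^sub>R V t + (-1) *\<^sub>R W t) (1 *\<^sub>R V t + (-1) *\<^sub>R W t) = metric M (g a) 0 0"
    using par_on_inner[OF g par_on_lincomb[OF g V W, of 1 "-1"] par_on_lincomb[OF g V W, of 1 "-1"] t] eq by simp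
  also have "\<dots> = 0" using inner_prod.Bzero[OF metric_inner_prod] by blast
  finally show ?thesis by (simp add: eq0_iff)
qed

text \<open>The chain rule contributes a factor \<open>\<alpha>\<close>, which matches the rescaled
  velocity because the Christoffel symbol is linear in its first argument.\<close>

lemma par_on_scale:
  assumes g: "geodesic M g" and V: "par_on g 0 1 V" and \<alpha>: "0 \<le> \<alpha>" "\<alpha> \<le> 1"
  shows "par_on (\<lambda>r. g (\<alpha> * r)) 0 1 (\<lambda>r. V (\<alpha> * r))"
  unfolding par_on_def
proof (intro ballI impI)
  fix t :: real and c assume t: "t \<in> {0..1}" and c: "c \<in> atlas M" "g (\<alpha> * t) \<in> chart_dom c"
  have \<alpha>t: "\<alpha> * t \<in> {0..1}" using \<alpha> t by (auto simp: mult_le_one)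
  have "((*) \<alpha> has_vector_derivative \<alpha>) (at t within {0..1})" by (auto intro!: derivative_eq_intros)
  moreover have "((\<lambda>r. tch c (g r) (V r)) has_vector_derivative
      - Chr c (chart_map c (g (\<alpha> * t))) (tch c (g (\<alpha> * t)) (velocity M g (\<alpha> * t))) (tch c (g (\<alpha> * t)) (V (\<alpha> * t))))
      (at (\<alpha> * t) within (*) \<alpha> ` {0..1})"
    using par_onD[OF V \<alpha>t c] by (rule has_vector_derivative_within_subset) (use \<alpha> in \<open>auto simp: mult_le_one\<close>)
  ultimately have "((\<lambda>r. tch c (g (\<alpha> * r)) (V (\<alpha> * r))) has_vector_derivative
      \<alpha> *\<^sub>R - Chr c (chart_map c (g (\<alpha> * t))) (tch c (g (\<alpha> * t)) (velocity M g (\<alpha> * t))) (tch c (g (\<alpha> * t)) (V (\<alpha> * t))))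
      (at t within {0..1})"
    by (rule vector_diff_chain_within[unfolded comp_def])
  then show "((\<lambda>r. tch c (g (\<alpha> * r)) (V (\<alpha> * r))) has_vector_derivative
      - Chr c (chart_map c (g (\<alpha> * t))) (tch c (g (\<alpha> * t)) (velocity M (\<lambda>r. g (\<alpha> * r)) t)) (tch c (g (\<alpha> * t)) (V (\<alpha> * t))))
      (at t within {0..1})"
    using c by (simp add: geodesic_scale(2)[OF g] linear_scale[OF to_chart_linear] linear_scale[OF Chr_linear(1)])
qed

lemma par_on_join:
  assumes V: "par_on g a b V" and W: "par_on g b c W" and eq: "V b = W b" and ab: "a \<le> b" "b \<le> c"
  shows "par_on g a c (\<lambda>t. if t \<le> b then V t else W t)" (is "par_on g a c ?Z")
  unfolding par_on_def
proof (intro ballI impI)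
  fix t d assume t: "t \<in> {a..c}" and d: "d \<in> atlas M" "g t \<in> chart_dom d"
  let ?D = "par_rhs d g t (tch d (g t) (?Z t))"
  \<comment> \<open>Off a closed set \<open>S\<close> the filter \<open>at t within S\<close> is
    \<open>bot\<close>, so anything is a derivative there. Only at the joint do both pieces impose a
    condition, and there they impose the same one.\<close>
  have far: "(f has_vector_derivative f') (at t within S)" if "closed S" "t \<notin> S" for f :: "real \<Rightarrow> 'e" and f' S
  proof -
    have "at t within S = bot" using that by (meson closed_limpt trivial_limit_within)
    then show ?thesis unfolding has_vector_derivative_def has_derivative_within by (simp add: bounded_linear_scaleR_left)
  qed
  have 1: "((\<lambda>r. tch d (g r) (?Z r)) has_vector_derivative ?D) (at t within {a..b})"
  proof (cases "t \<le> b")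
    case True
    have "((\<lambda>r. tch d (g r) (V r)) has_vector_derivative ?D) (at t within {a..b})"
      using par_onD[OF V _ d] t True by simp
    then show ?thesis by (rule has_vector_derivative_transform[rotated 2]) (use t True in auto)
  qed (intro far, auto)
  have 2: "((\<lambda>r. tch d (g r) (?Z r)) has_vector_derivative ?D) (at t within {b..c})"
  proof (cases "b \<le> t")
    case True
    then have Z: "?Z t = W t" using eq by auto
    have "((\<lambda>r. tch d (g r) (W r)) has_vector_derivative ?D) (at t within {b..c})"
      unfolding Z using par_onD[OF W _ d] t True by simp
    then show ?thesis by (rule has_vector_derivative_transform[rotated 2]) (use t True eq in auto)
  qed (intro far, auto)
  have "{a..c} = {a..b} \<union> {b..c}" using ab by auto
  then show "((\<lambda>r. tch d (g r) (?Z r)) has_vector_derivative ?D) (at t within {a..c})"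
    using 1 2 unfolding has_vector_derivative_def has_derivative_within
    by (simp add: at_within_union filterlim_sup)
qed

end

section \<open>Existence of parallel fields\<close>

context complete_mfd
begin

text \<open>Within one chart the parallel equation is a linear differential equation with continuous
  coefficients. Its solution satisfies the equation of every other chart by the transformation
  law.\<close>

lemma par_on_exists_local:
  assumes g: "geodesic M g" and c: "c \<in> atlas M" and ab: "a \<le> b" and dom: "\<And>t. t \<in> {a..b} \<Longrightarrow> g t \<in> chart_dom c"
  shows "\<exists>V. par_on g a b V \<and> V a = u"
proof -
  interpret local_metric "chart_metric M c" "chart_img c" by (rule chart_local_metric[OF c])
  obtain G where G: "\<And>p u v. p \<in> chart_img c \<Longrightarrow> ((\<lambda>p. Gam p u v) has_derivative G p u v) (at p)"
    by (rule Gam_has_derivative) blast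
  let ?y = "\<lambda>t. tch c (g t) (velocity M g t)"
  define A where "A t = Blinfun (\<lambda>v. - Gam (chart_map c (g t)) (?y t) v)" for t
  have A: "blinfun_apply (A t) = (\<lambda>v. - Gam (chart_map c (g t)) (?y t) v)" if "t \<in> {a..b}" for t
  proof -
    have "linear (Gam (chart_map c (g t)) (?y t))" using dom[OF that] c by (intro Gam_linear) auto
    then have "bounded_linear (\<lambda>v. - Gam (chart_map c (g t)) (?y t) v)"
      by (intro bounded_linear_minus) (simp add: linear_conv_bounded_linear)
    then show ?thesis unfolding A_def by (rule bounded_linear_Blinfun_apply)
  qed
  have "continuous_on {a..b} A"
  proof (rule continuous_on_blinfun_componentwise)
    fix i :: 'e assume "i \<in> Basis"
    have "continuous (at t within {a..b}) (\<lambda>t. - Gam ((chart_map c \<circ> g) t) (?y t) i)" if "t \<in> {a..b}" for t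
    proof -
      note d = geodesic_chart[OF g c dom[OF that], unfolded has_vector_derivative_def, THEN has_derivative_at_withinI]
      have "(chart_map c \<circ> g) t \<in> chart_img c" using dom[OF that] c by simp
      from has_derivative_continuous[OF Gam_curve_has_derivative[OF G d has_derivative_const that this]]
      show ?thesis by (rule continuous_minus)
    qed
    then have "continuous_on {a..b} (\<lambda>t. - Gam ((chart_map c \<circ> g) t) (?y t) i)"
      by (simp add: continuous_on_eq_continuous_within)
    then show "continuous_on {a..b} (\<lambda>t. A t i)" by (rule continuous_on_eq) (simp add: A)
  qed
  from linear_ode_exists[OF this ab, of "tch c (g a) u"]
  obtain Y where Y: "Y a = tch c (g a) u" "\<And>t. t \<in> {a..b} \<Longrightarrow> (Y has_vector_derivative A t (Y t)) (at t within {a..b})" by blast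
  define V where "V t = from_chart M c (g t) (Y t)" for t
  have VY: "tch c (g t) (V t) = Y t" if "g t \<in> chart_dom c" for t using that c by (simp add: V_def)
  have "par_on g a b V"
    unfolding par_on_def
  proof (intro ballI impI)
    fix t d assume t: "t \<in> {a..b}" and d: "d \<in> atlas M" "g t \<in> chart_dom d"
    have "((\<lambda>r. tch c (g r) (V r)) has_vector_derivative - Chr c (chart_map c (g t)) (?y t) (tch c (g t) (V t))) (at t within {a..b})"
      using chart_transform[OF g c dom[OF t] t Y(2)[OF t] VY[symmetric]] by (simp add: A[OF t] VY[OF dom[OF t]] christoffel_Gam[OF c])
    from parallel_change_chart[OF c d(1) dom[OF t] d(2) geodesic_cont[OF g] t
        has_vector_derivative_at_within[OF geodesic_chart_velocity[OF g c dom[OF t]]] this]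
    show "((\<lambda>r. tch d (g r) (V r)) has_vector_derivative par_rhs d g t (tch d (g t) (V t))) (at t within {a..b})"
      by (simp add: DT_to_chart c dom[OF t] d)
  qed
  moreover have "V a = u" using dom[of a] ab c by (simp add: V_def Y(1))
  ultimately show ?thesis by blast
qed

lemma par_on_exists:
  assumes g: "geodesic M g" and ab: "a \<le> b"
  shows "\<exists>V. par_on g a b V \<and> V a = u"
proof -
  \<comment> \<open>The initial vector is quantified inside: joining two intervals requires a
    solution on the second one that starts from whatever value the first one ends with.\<close>
  have "\<forall>u. \<exists>V. par_on g a b V \<and> V a = u"
    using ab
  proof (induction rule: Bolzano)
    case (trans a b c)
    show ?case
    proof
      fix u
      obtain V where V: "par_on g a b V" "V a = u" using trans by blast
      obtain W where W: "par_on g b c W" "W b = V b" using trans by blast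
      show "\<exists>V. par_on g a c V \<and> V a = u"
        using par_on_join[OF V(1) W(1) W(2)[symmetric]] trans V(2) by (intro exI[of _ "\<lambda>t. if t \<le> b then V t else W t"]) auto
    qed
  next
    case (local x)
    let ?c = "chart_at M (g x)"
    have "isCont g x" using g geodesic_cont by blast
    then have "(g \<longlongrightarrow> g x) (nhds x)" by (simp add: isCont_def tendsto_at_iff_tendsto_nhds)
    from topological_tendstoD[OF this open_chart_dom[of ?c]]
    have "\<forall>\<^sub>F r in nhds x. g r \<in> chart_dom ?c" by simp
    then obtain d where d: "d > 0" "\<And>r. dist r x < d \<Longrightarrow> g r \<in> chart_dom ?c" unfolding eventually_nhds_metric by blast
    show ?case
    proof (intro exI[of _ d] conjI allI impI d)
      fix a b u assume "a \<le> x \<and> x \<le> b \<and> b - a < d"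
      then show "\<exists>V. par_on g a b V \<and> V a = u"
        by (intro par_on_exists_local[OF g chart_at_atlas[of "g x"]] d) (auto simp: dist_real_def)
    qed
  qed
  then show ?thesis by blast
qed

section \<open>Parallel transport as a linear isometry\<close>

context
  fixes g x s
  assumes g: "geodesic M g" and g0: "g 0 = x" "velocity M g 0 = s"
begin

lemma Exp_geodesic: "Exp M x (t *\<^sub>R s) = g t"
  using Exp_eq[OF g] g0 by simp

lemma transport_eq: assumes V: "par_on g 0 1 V" shows "transport M x s (V 0) = V 1"
  unfolding transport_def Exp_geodesic
proof (rule the_equality)
  have *: "parallel_along M g {0..1} W \<longleftrightarrow> par_on g 0 1 W" for W using parallel_along_iff_par_on[OF g] by simp
  show "\<exists>W. parallel_along M g {0..1} W \<and> W 0 = V 0 \<and> W 1 = V 1" using V unfolding * by blast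
  fix w assume "\<exists>W. parallel_along M g {0..1} W \<and> W 0 = V 0 \<and> W 1 = w"
  then show "w = V 1" unfolding * using par_on_unique[OF g _ V, of _ 1] by auto
qed

lemma transport_obtain:
  obtains V where "par_on g 0 1 V" "V 0 = u" "transport M x s u = V 1"
  using par_on_exists[OF g, of 0 1 u] transport_eq by auto

lemma transport_inner: "metric M (g 1) (transport M x s u) (transport M x s v) = metric M x u v"
proof -
  obtain V where V: "par_on g 0 1 V" "V 0 = u" "transport M x s u = V 1" by (rule transport_obtain)
  obtain W where W: "par_on g 0 1 W" "W 0 = v" "transport M x s v = W 1" by (rule transport_obtain)
  show ?thesis using par_on_inner[OF g V(1) W(1), of 1] V W g0 by simp
qed

lemma transport_linear: "linear (transport M x s)"
proof -
  have *: "transport M x s (\<alpha> *\<^sub>R u + \<beta> *\<^sub>R v) = \<alpha> *\<^sub>R transport M x s u + \<beta> *\<^sub>R transport M x s v" for \<alpha> \<beta> u v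
  proof -
    obtain V where V: "par_on g 0 1 V" "V 0 = u" "transport M x s u = V 1" by (rule transport_obtain)
    obtain W where W: "par_on g 0 1 W" "W 0 = v" "transport M x s v = W 1" by (rule transport_obtain)
    show ?thesis using transport_eq[OF par_on_lincomb[OF g V(1) W(1), of \<alpha> \<beta>]] V W by simp
  qed
  show ?thesis
  proof (rule linearI)
    show "transport M x s (u + v) = transport M x s u + transport M x s v" for u v using *[of 1 u 1 v] by simp
    show "transport M x s (r *\<^sub>R v) = r *\<^sub>R transport M x s v" for r v using *[of r v 0 0] by simp
  qed
qed

text \<open>A linear isometry between spaces of equal finite dimension is bijective. This makes the
  \<open>inv\<close> in \<open>lipschitz_hessian\<close> an actual inverse.\<close>

lemma transport_bij: "bij (transport M x s)"
proof -
  interpret inner_prod "metric M x" by (rule metric_inner_prod)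
  have "inj (transport M x s)"
    unfolding linear_injective_0[OF transport_linear]
  proof safe
    fix v assume "transport M x s v = 0"
    then have "metric M x v v = 0" using transport_inner[of v v] inner_prod.Bzero[OF metric_inner_prod] by metis
    then show "v = 0" by (simp add: eq0_iff)
  qed
  then show ?thesis using linear_injective_imp_surjective[OF transport_linear] by (simp add: bij_def)
qed

text \<open>An initial piece of a parallel field, reparametrized to the unit interval, is parallel
  along the rescaled geodesic. The Lipschitz condition speaks of transport over unit time, and this
  makes it usable at intermediate times.\<close>

lemma transport_scale:
  assumes V: "par_on g 0 1 V" and t: "0 \<le> t" "t \<le> 1"
  shows "transport M x (t *\<^sub>R s) (V 0) = V t"
proof -
  have h: "geodesic M (\<lambda>r. g (t * r))" "g (t * 0) = x" "velocity M (\<lambda>r. g (t * r)) 0 = t *\<^sub>R s"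
    using geodesic_scale[OF g, of t] g0 by auto
  have "parallel_along M (\<lambda>r. g (t * r)) {0..1} W \<longleftrightarrow> par_on (\<lambda>r. g (t * r)) 0 1 W" for W
    using parallel_along_iff_par_on[OF h(1)] by simp
  note * = this
  have E: "Exp M x (r *\<^sub>R t *\<^sub>R s) = g (t * r)" for r using Exp_eq[OF h(1), of r] h by simp
  show ?thesis
    unfolding transport_def E
  proof (rule the_equality)
    show "\<exists>W. parallel_along M (\<lambda>r. g (t * r)) {0..1} W \<and> W 0 = V 0 \<and> W 1 = V t"
      unfolding * using par_on_scale[OF g V t] by (intro exI[of _ "\<lambda>r. V (t * r)"]) simp
    fix w assume "\<exists>W. parallel_along M (\<lambda>r. g (t * r)) {0..1} W \<and> W 0 = V 0 \<and> W 1 = w"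
    then obtain W where W: "par_on (\<lambda>r. g (t * r)) 0 1 W" "W 0 = V 0" "W 1 = w" unfolding * by blast
    then show "w = V t" using par_on_unique[OF h(1) W(1) par_on_scale[OF g V t], of 1] by simp
  qed
qed

end

end

section \<open>Riemannian gradient and Hessian\<close>

locale C2_function = complete_mfd M
  for M :: "('m::{t2_space, second_countable_topology}, 'e::euclidean_space) riem" +
  fixes f :: "'m \<Rightarrow> real"
  assumes C2: "C2_on_manifold M f"
begin

definition "df c p = frechet_derivative (f \<circ> chart_inv c) (at p)"
definition "d2f c p u = frechet_derivative (\<lambda>p. df c p u) (at p)"

lemma C2_chart:
  assumes "c \<in> atlas M"
  shows "p \<in> chart_img c \<Longrightarrow> (f \<circ> chart_inv c) differentiable (at p)"
    and "p \<in> chart_img c \<Longrightarrow> (\<lambda>p. df c p u) differentiable (at p)"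
    and "continuous_on (chart_img c) (\<lambda>p. d2f c p u v)"
  using C2 assms unfolding C2_on_manifold_def numeral_2_eq_2 df_def d2f_def by auto

lemma df: "c \<in> atlas M \<Longrightarrow> p \<in> chart_img c \<Longrightarrow> (f \<circ> chart_inv c has_derivative df c p) (at p)"
  using C2_chart(1) frechet_derivative_works unfolding df_def by blast

lemma d2f: "c \<in> atlas M \<Longrightarrow> p \<in> chart_img c \<Longrightarrow> ((\<lambda>p. df c p u) has_derivative d2f c p u) (at p)"
  using C2_chart(2) frechet_derivative_works unfolding d2f_def by blast

lemma df_linear: "c \<in> atlas M \<Longrightarrow> p \<in> chart_img c \<Longrightarrow> linear (df c p)"
  by (rule has_derivative_linear[OF df])

lemma d2f_commute: assumes "c \<in> atlas M" "p \<in> chart_img c" shows "d2f c p u v = d2f c p v u"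
  by (rule second_derivative_symmetric[OF open_chart_img assms(2) df d2f C2_chart(3)]) (use assms in auto)

text \<open>\<open>rgrad\<close> is defined through a chart that varies with the point. This
  identity represents it by \<open>df\<close> in one fixed chart, where it can be
  differentiated.\<close>

lemma rgrad_chart:
  assumes c: "c \<in> atlas M" "y \<in> chart_dom c"
  shows "metric M y (rgrad M f y) v = df c (chart_map c y) (tch c y v)"
proof -
  let ?d = "chart_at M y"
  interpret inner_prod "metric M y" by (rule metric_inner_prod)
  have d: "?d \<in> atlas M" "y \<in> chart_dom ?d" by auto
  have "((f \<circ> chart_inv c) \<circ> transition ?d c has_derivative df c (chart_map c y) \<circ> DT ?d c y) (at (chart_map ?d y))"
    by (rule diff_chain_at[OF DT[OF d(1) c(1) d(2) c(2)]]) (simp add: transition_map df c)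
  then have "(f \<circ> chart_inv ?d has_derivative df c (chart_map c y) \<circ> DT ?d c y) (at (chart_map ?d y))"
  proof (rule has_derivative_transform_within_open)
    show "open (overlap ?d c)" "chart_map ?d y \<in> overlap ?d c" using c by (auto intro: open_overlap overlapI)
    fix p assume "p \<in> overlap ?d c"
    then show "(f \<circ> chart_inv c \<circ> transition ?d c) p = (f \<circ> chart_inv ?d) p"
      unfolding overlap_def using c d by (auto simp: transition_map)
  qed
  from gradient_has_derivative(2)[OF this] show ?thesis
    by (simp add: rgrad_def Let_def to_chart_DT)
qed

lemma rgrad_chart_metric:
  assumes c: "c \<in> atlas M" and p: "p \<in> chart_img c"
  shows "chart_metric M c p (tch c (chart_inv c p) (rgrad M f (chart_inv c p))) w = df c p w"
proof -
  have y: "chart_inv c p \<in> chart_dom c" using c p by simp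
  show ?thesis
    using chart_metric_map[OF c y, of "rgrad M f (chart_inv c p)" "from_chart M c (chart_inv c p) w"]
      rgrad_chart[OF c y, of "from_chart M c (chart_inv c p) w"] c p y by simp
qed

text \<open>Differentiating the identity between gradient and differential brings in derivatives of
  the metric. With the Christoffel term of \<open>cov_deriv\<close> they combine, by the Koszul
  formula, into the classical covariant Hessian.\<close>

lemma rhess_chart:
  assumes "c = chart_at M y" "p = chart_map c y"
  shows rhess_inner: "metric M y (rhess M f y v) w = d2f c p w v - df c p (Chr c p v w)" and "linear (rhess M f y)"
proof -
  note c_def = assms(1) and p_def = assms(2)
  have c: "c \<in> atlas M" "y \<in> chart_dom c" by (simp_all add: c_def)
  have p: "p \<in> chart_img c" using c by (simp add: p_def)
  have yp: "chart_inv c p = y" using c by (simp add: p_def)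
  have id: "tch c y v = v" for v by (simp add: c_def)
  have g: "metric M y = chart_metric M c p"
    using chart_metric_map[OF c] by (simp add: id p_def fun_eq_iff)
  interpret local_metric "chart_metric M c" "chart_img c" by (rule chart_local_metric[OF c(1)])
  interpret g: inner_prod "chart_metric M c p" by (rule ipr[OF p])
  let ?W = "\<lambda>q. tch c (chart_inv c q) (rgrad M f (chart_inv c q))"
  obtain z' where z': "(?W has_derivative z') (at p)"
    and z'_eq: "\<And>h v. chart_metric M c p (z' h) v = d2f c p v h - dg p (?W p) v h"
    by (rule solve_has_derivative[OF openU p ipg dg[OF p] d2f[OF c(1) p] rgrad_chart_metric[OF c(1)]]) auto
  have W: "?W p = rgrad M f y" by (simp add: yp id)
  have H: "rhess M f y v = z' v + Chr c p v (rgrad M f y)" for v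
    using frechet_derivative_at[OF z'] by (simp add: rhess_def cov_deriv_def Let_def c_def p_def)
  have "df c p (Chr c p v w) = chart_metric M c p (Chr c p v w) (rgrad M f y)"
    using rgrad_chart_metric[OF c(1) p, of "Chr c p v w"] by (simp add: yp id g.commute)
  then show "metric M y (rhess M f y v) w = d2f c p w v - df c p (Chr c p v w)"
    unfolding g H g.Badd(1) z'_eq W
    by (simp add: christoffel_Gam[OF c(1)] Gam_eq[OF p] koszul_def dg_commute[OF p, of "rgrad M f y" w] field_simps)
  show "linear (rhess M f y)"
    unfolding H[abs_def] using has_derivative_linear[OF z'] Chr_linear(1)[OF c(1) p] by (intro linear_compose_add)
qed

lemma rhess_linear: "linear (rhess M f y)" by (rule rhess_chart(2)) auto

text \<open>Mixed second derivatives commute, and the connection is torsion-free.\<close>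

lemma rhess_self_adjoint: "metric M y (rhess M f y u) v = metric M y u (rhess M f y v)"
proof -
  interpret inner_prod "metric M y" by (rule metric_inner_prod)
  let ?c = "chart_at M y"
  have "?c \<in> atlas M" "chart_map ?c y \<in> chart_img ?c" by auto
  from d2f_commute[OF this] Chr_commute[OF this]
  show ?thesis unfolding commute[of u] rhess_inner[OF refl refl] by simp
qed

lemma has_derivative_along_geodesic:
  assumes g: "geodesic M g"
  shows "((\<lambda>t. f (g t)) has_vector_derivative metric M (g t) (rgrad M f (g t)) (velocity M g t)) (at t)"
proof -
  let ?c = "chart_at M (g t)"
  have c: "?c \<in> atlas M" "g t \<in> chart_dom ?c" by auto
  have "((f \<circ> chart_inv ?c) \<circ> (chart_map ?c \<circ> g) has_derivative
      df ?c (chart_map ?c (g t)) \<circ> (\<lambda>h. h *\<^sub>R tch ?c (g t) (velocity M g t))) (at t)"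
    by (rule diff_chain_at[OF geodesic_chart_velocity[OF g c, unfolded has_vector_derivative_def]])
       (simp add: df)
  then have "((f \<circ> chart_inv ?c) \<circ> (chart_map ?c \<circ> g) has_vector_derivative
      metric M (g t) (rgrad M f (g t)) (velocity M g t)) (at t)"
    by (simp add: has_vector_derivative_def comp_def rgrad_chart[OF c] linear_scale[OF df_linear[OF c(1) chart_map_img[OF c]]])
  from chart_transform[OF g c _ this] show ?thesis by (simp add: c)
qed

text \<open>Since \<open>V\<close> is parallel, differentiating it contributes only the Christoffel
  term that completes the second derivative of \<open>f\<close> to the Hessian.\<close>

lemma gradient_along_geodesic:
  assumes g: "geodesic M g" and V: "par_on g a b V" and t: "t \<in> {a..b}"
  shows "((\<lambda>t. metric M (g t) (rgrad M f (g t)) (V t)) has_vector_derivative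
    metric M (g t) (rhess M f (g t) (velocity M g t)) (V t)) (at t within {a..b})"
proof -
  let ?c = "chart_at M (g t)"
  have c: "?c \<in> atlas M" "g t \<in> chart_dom ?c" by auto
  have p: "chart_map ?c (g t) \<in> chart_img ?c" by simp
  have "((\<lambda>r. df ?c ((chart_map ?c \<circ> g) r) (tch ?c (g r) (V r))) has_vector_derivative
      d2f ?c (chart_map ?c (g t)) (tch ?c (g t) (V t)) (tch ?c (g t) (velocity M g t))
      + df ?c ((chart_map ?c \<circ> g) t) (- Chr ?c (chart_map ?c (g t)) (tch ?c (g t) (velocity M g t)) (tch ?c (g t) (V t)))) (at t within {a..b})"
    by (rule has_vector_derivative_apply_linear[OF open_chart_img[OF c(1)] _ df_linear _
          has_vector_derivative_at_within[OF geodesic_chart_velocity[OF g c]] par_onD[OF V t c] t])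
       (use p c d2f in auto)
  from chart_transform[OF g c t this, of "\<lambda>r. metric M (g r) (rgrad M f (g r)) (V r)"]
  show ?thesis
    by (simp add: rgrad_chart[OF c(1)] rhess_inner[OF refl refl] linear_neg[OF df_linear[OF c(1) p]])
qed

end

section \<open>Taylor expansions under a Lipschitz Hessian\<close>

locale lipschitz_hessian_function = C2_function M f
  for M :: "('m::{t2_space, second_countable_topology}, 'e::euclidean_space) riem" and f +
  fixes L :: real
  assumes lip: "lipschitz_hessian M f L"
begin

abbreviation "mn x \<equiv> norm_wrt (metric M x)"

text \<open>Transport is an isometry, so its inverse can be moved to the other argument of the
  metric. The operator-norm condition becomes an inequality between the two Hessian forms on
  transported vectors.\<close>

lemma hessian_transport_diff:
  assumes g: "geodesic M g" and g0: "g 0 = x" "velocity M g 0 = s"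
  shows "\<bar>metric M (g 1) (rhess M f (g 1) (transport M x s u)) (transport M x s v) - metric M x (rhess M f x u) v\<bar>
    \<le> L * mn x s * mn x u * mn x v"
proof -
  interpret inner_prod "metric M x" by (rule metric_inner_prod)
  let ?P = "transport M x s"
  note bij = transport_bij[OF g g0] and lP = transport_linear[OF g g0]
  have Pinv: "?P (inv ?P w) = w" for w using bij by (simp add: bij_is_surj surj_f_inv_f)
  have linv: "linear (inv ?P)"
  proof (rule linearI)
    show "inv ?P (a + b) = inv ?P a + inv ?P b" for a b
      by (rule injD[OF bij_is_inj[OF bij]]) (simp add: linear_add[OF lP] Pinv)
    show "inv ?P (r *\<^sub>R a) = r *\<^sub>R inv ?P a" for r a
      by (rule injD[OF bij_is_inj[OF bij]]) (simp add: linear_scale[OF lP] Pinv)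
  qed
  let ?A = "\<lambda>v. inv ?P (rhess M f (g 1) (?P v)) - rhess M f x v"
  have "linear ?A"
    by (intro linear_compose_sub rhess_linear
        linear_compose[of "\<lambda>v. rhess M f (g 1) (?P v)" "inv ?P", unfolded comp_def]
        linear_compose[of ?P "rhess M f (g 1)", unfolded comp_def] lP linv)
  moreover have "op_norm_wrt (metric M x) ?A \<le> L * mn x s"
    using lip Exp_geodesic[OF g g0, of 1] unfolding lipschitz_hessian_def by (metis scaleR_one)
  ultimately have "mn x (?A u) \<le> L * mn x s * mn x u" by (rule op_norm_bound)
  have "metric M (g 1) (rhess M f (g 1) (?P u)) (?P v) = metric M x (inv ?P (rhess M f (g 1) (?P u))) v"
    using transport_inner[OF g g0, of "inv ?P (rhess M f (g 1) (?P u))" v] by (simp add: Pinv)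
  then have "\<bar>metric M (g 1) (rhess M f (g 1) (?P u)) (?P v) - metric M x (rhess M f x u) v\<bar> = \<bar>metric M x (?A u) v\<bar>"
    by (simp add: Bdiff)
  also have "\<dots> \<le> mn x (?A u) * mn x v" by (rule cauchy_schwarz)
  also have "\<dots> \<le> L * mn x s * mn x u * mn x v"
    using \<open>mn x (?A u) \<le> L * mn x s * mn x u\<close> by (intro mult_right_mono) auto
  finally show ?thesis .
qed

text \<open>At a nonzero tangent vector the right-hand side of the Lipschitz estimate dominates an
  absolute value.\<close>

lemma L_nonneg: "L \<ge> 0"
proof -
  fix x :: 'm
  interpret inner_prod "metric M x" by (rule metric_inner_prod)
  obtain s :: 'e where s: "s \<in> Basis" using nonempty_Basis by blast
  then have s0: "mn x s > 0" by (intro nrm_pos) auto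
  obtain g where g: "geodesic M g" "g 0 = x" "velocity M g 0 = s" by (rule geodesic_exists)
  have "0 \<le> L * mn x s * mn x s * mn x s" using hessian_transport_diff[OF g, of s s] by linarith
  then show ?thesis using s0 by (simp add: zero_le_mult_iff)
qed

text \<open>Stated for all \<open>t\<close> and an arbitrary parallel field: \<open>t = 1\<close>
  gives the expansion of the gradient, and with the velocity as field it can be integrated once more
  for the expansion of \<open>f\<close>.\<close>

lemma gradient_taylor_path:
  assumes g: "geodesic M g" and g0: "g 0 = x" "velocity M g 0 = s" and V: "par_on g 0 1 V" and t: "t \<in> {0..1}"
  shows "\<bar>metric M (g t) (rgrad M f (g t)) (V t) - metric M x (rgrad M f x) (V 0) - t * metric M x (rhess M f x s) (V 0)\<bar>
    \<le> L / 2 * t\<^sup>2 * (mn x s)\<^sup>2 * mn x (V 0)"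
proof (cases "t = 0")
  case False
  let ?H = "metric M x (rhess M f x s) (V 0)"
  let ?F = "\<lambda>r. metric M (g r) (rgrad M f (g r)) (V r) - r * ?H"
  let ?G = "\<lambda>r. L / 2 * r\<^sup>2 * (mn x s)\<^sup>2 * mn x (V 0)"
  \<comment> \<open>The Lipschitz condition is applied to the rescaled geodesic with initial
    velocity \<open>r *\<^sub>R s\<close>. This supplies the factor \<open>r\<close> that integrates
    to \<open>t\<^sup>2 / 2\<close>.\<close>
  have bound: "\<bar>metric M (g r) (rhess M f (g r) (velocity M g r)) (V r) - ?H\<bar> \<le> L * r * (mn x s)\<^sup>2 * mn x (V 0)"
    if r: "0 \<le> r" "r \<le> 1" for r
  proof -
    have h: "geodesic M (\<lambda>q. g (r * q))" "g (r * 0) = x" "velocity M (\<lambda>q. g (r * q)) 0 = r *\<^sub>R s"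
      using geodesic_scale[OF g, of r] g0 by auto
    show ?thesis
      using hessian_transport_diff[OF h, of s "V 0"] transport_scale[OF g g0 V r]
        transport_scale[OF g g0 geodesic_par_on[OF g] r] r inner_prod.nrm_scaleR[OF metric_inner_prod]
      by (simp add: g0 power2_eq_square mult_ac)
  qed
  have d: "(?F has_vector_derivative metric M (g r) (rhess M f (g r) (velocity M g r)) (V r) - 1 * ?H) (at r within {0..1})"
    if "r \<in> {0..1}" for r
    by (intro has_vector_derivative_diff gradient_along_geodesic[OF g V that])
       (auto intro!: derivative_eq_intros)
  have dG: "(?G has_real_derivative L * r * (mn x s)\<^sup>2 * mn x (V 0)) (at r)" for r
    by (auto intro!: derivative_eq_intros)
  have "norm (?F t - ?F 0) \<le> ?G t - ?G 0"
  proof (rule differentiable_bound_general[where a = 0 and b = t and f = ?F and \<phi> = ?G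
        and f' = "\<lambda>r. metric M (g r) (rhess M f (g r) (velocity M g r)) (V r) - 1 * ?H"
        and \<phi>' = "\<lambda>r. L * r * (mn x s)\<^sup>2 * mn x (V 0)"])
    show "0 < t" using t False by simp
    show "continuous_on {0..t} ?F"
    proof (rule continuous_on_subset[of "{0..1}"])
      show "continuous_on {0..1} ?F"
        unfolding continuous_on_eq_continuous_within using has_vector_derivative_continuous[OF d] by blast
    qed (use t in auto)
    show "continuous_on {0..t} ?G" by (intro continuous_intros)
    fix r assume r: "0 < r" "r < t"
    have "at r within {0..1} = at r" using r t by (intro at_within_Icc_at) auto
    then show "(?F has_vector_derivative metric M (g r) (rhess M f (g r) (velocity M g r)) (V r) - 1 * ?H) (at r)"
      using d[of r] r t by simp
    show "(?G has_vector_derivative L * r * (mn x s)\<^sup>2 * mn x (V 0)) (at r)"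
      using dG has_real_derivative_iff_has_vector_derivative by blast
    show "norm (metric M (g r) (rhess M f (g r) (velocity M g r)) (V r) - 1 * ?H) \<le> L * r * (mn x s)\<^sup>2 * mn x (V 0)"
      using bound[of r] r t by simp
  qed
  then show ?thesis by (simp add: g0 algebra_simps)
qed (simp add: g0)

lemma gradient_taylor:
  assumes g: "geodesic M g" and g0: "g 0 = x" "velocity M g 0 = s"
  shows "\<bar>metric M (g 1) (rgrad M f (g 1)) (transport M x s w) - metric M x (rgrad M f x + rhess M f x s) w\<bar>
    \<le> L / 2 * (mn x s)\<^sup>2 * mn x w"
proof -
  interpret inner_prod "metric M x" by (rule metric_inner_prod)
  obtain V where V: "par_on g 0 1 V" "V 0 = w" "transport M x s w = V 1" by (rule transport_obtain[OF g g0])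
  show ?thesis using gradient_taylor_path[OF g g0 V(1), of 1] V by (simp add: Badd algebra_simps)
qed

lemma function_taylor:
  assumes g: "geodesic M g" and g0: "g 0 = x" "velocity M g 0 = s"
  shows "\<bar>f (g 1) - f x - metric M x (rgrad M f x) s - metric M x (rhess M f x s) s / 2\<bar> \<le> L / 6 * mn x s ^ 3"
proof -
  let ?a = "metric M x (rgrad M f x) s" and ?H = "metric M x (rhess M f x s) s"
  let ?F = "\<lambda>r. f (g r) - r * ?a - r\<^sup>2 * ?H / 2"
  let ?G = "\<lambda>r. L / 6 * r ^ 3 * mn x s ^ 3"
  have d: "(?F has_vector_derivative metric M (g r) (rgrad M f (g r)) (velocity M g r) - 1 * ?a - r * ?H) (at r)" for r
    by (intro has_vector_derivative_diff has_derivative_along_geodesic[OF g])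
       (auto intro!: derivative_eq_intros simp flip: has_real_derivative_iff_has_vector_derivative)
  have dG: "(?G has_real_derivative L / 2 * r\<^sup>2 * mn x s ^ 3) (at r)" for r
    by (auto intro!: derivative_eq_intros simp: power2_eq_square)
  have "norm (?F 1 - ?F 0) \<le> ?G 1 - ?G 0"
  proof (rule differentiable_bound_general[where a = 0 and b = 1 and f = ?F and \<phi> = ?G
        and f' = "\<lambda>r. metric M (g r) (rgrad M f (g r)) (velocity M g r) - 1 * ?a - r * ?H"
        and \<phi>' = "\<lambda>r. L / 2 * r\<^sup>2 * mn x s ^ 3"])
    show "continuous_on {0..1} ?F"
      using has_vector_derivative_continuous[OF d] by (intro continuous_at_imp_continuous_on ballI)
    show "continuous_on {0..1} ?G" by (intro continuous_intros)
    fix r :: real assume r: "0 < r" "r < 1"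
    show "(?F has_vector_derivative metric M (g r) (rgrad M f (g r)) (velocity M g r) - 1 * ?a - r * ?H) (at r)" by (rule d)
    show "(?G has_vector_derivative L / 2 * r\<^sup>2 * mn x s ^ 3) (at r)"
      using dG has_real_derivative_iff_has_vector_derivative by blast
    show "norm (metric M (g r) (rgrad M f (g r)) (velocity M g r) - 1 * ?a - r * ?H) \<le> L / 2 * r\<^sup>2 * mn x s ^ 3"
      using gradient_taylor_path[OF g g0 geodesic_par_on[OF g], of r] r
      by (simp add: g0 power3_eq_cube power2_eq_square mult_ac)
  qed simp
  then show ?thesis by (simp add: g0 algebra_simps)
qed

end

section \<open>The pullback to a tangent space\<close>

lemma path_bound:
  fixes u :: "real \<Rightarrow> 'a::real_normed_vector"
  assumes "\<And>t. t \<in> {a..b} \<Longrightarrow> (u has_vector_derivative u' t) (at t within {a..b})"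
    and "\<And>t. t \<in> {a..b} \<Longrightarrow> norm (u' t) \<le> C" and "t \<in> {a..b}"
  shows "norm (u t - u a) \<le> C * (t - a)"
proof -
  have "norm (u t - u a) \<le> C * norm (t - a)"
  proof (rule differentiable_bound[where S = "{a..b}" and f' = "\<lambda>t h. h *\<^sub>R u' t"])
    show "onorm (\<lambda>h. h *\<^sub>R u' r) \<le> C" if "r \<in> {a..b}" for r
      using assms(2)[OF that] by (intro onorm_le) (simp add: mult_left_mono mult.commute[of C])
  qed (use assms in \<open>auto simp: has_vector_derivative_def\<close>)
  then show ?thesis using assms(3) by simp
qed

lemma path_bound_unit:
  fixes u :: "real \<Rightarrow> 'a::real_normed_vector"
  assumes "\<And>t. t \<in> {0..1} \<Longrightarrow> (u has_vector_derivative u' t) (at t within {0..1})"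
    and "\<And>t. t \<in> {0..1} \<Longrightarrow> norm (u' t) \<le> C" and "t \<in> {0..1}"
  shows "norm (u t - u 0) \<le> C"
proof -
  have "C * (t - 0) \<le> C * 1"
    using assms(3) order_trans[OF norm_ge_zero assms(2)[OF assms(3)]] by (intro mult_left_mono) auto
  then show ?thesis using path_bound[OF assms] by simp
qed

context local_metric
begin

text \<open>The form is minimised over the compact product of \<open>K\<close> with the unit sphere.
  The basis expansion \<open>?F\<close> provides joint continuity in point and vector out of
  continuity for fixed vectors.\<close>

lemma metric_lower_bound:
  assumes K: "compact K" "K \<subseteq> U" "K \<noteq> {}"
  obtains m where "m > 0" "\<And>q v. q \<in> K \<Longrightarrow> m * (norm v)\<^sup>2 \<le> g q v v"
proof -
  let ?F = "\<lambda>z. \<Sum>i\<in>Basis. \<Sum>j\<in>Basis. (snd z \<bullet> i) *\<^sub>R ((snd z \<bullet> j) *\<^sub>R g (fst z) i j)"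
  have F: "?F (q, v) = g q v v" if "q \<in> U" for q v
    using linear_basis_sum[OF g_linear(1)[OF that], of v v] linear_basis_sum[OF g_linear(2)[OF that], of _ v]
    by (simp add: scaleR_sum_right sum_distrib_left)
  have cg: "continuous_on (K \<times> sphere 0 1) (\<lambda>z. g (fst z) i j)" for i j
    by (rule continuous_on_compose2[OF continuous_on_subset[OF smooth_on_continuous[OF smooth] K(2)] continuous_on_fst[OF continuous_on_id]]) auto
  have cont: "continuous_on (K \<times> sphere 0 1) ?F" by (intro continuous_intros cg)
  obtain i :: 'e where "i \<in> Basis" using nonempty_Basis by blast
  then have "K \<times> sphere (0::'e) 1 \<noteq> {}" using K(3) by (auto intro!: exI[of _ i])
  moreover have "compact (K \<times> sphere (0::'e) 1)" using K(1) by (intro compact_Times) auto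
  ultimately obtain z0 where z0: "z0 \<in> K \<times> sphere 0 1" "\<And>z. z \<in> K \<times> sphere 0 1 \<Longrightarrow> ?F z0 \<le> ?F z"
    using continuous_attains_inf[OF _ _ cont] by blast
  obtain q0 v0 where z0_eq: "z0 = (q0, v0)" by fastforce
  have q0: "q0 \<in> K" "q0 \<in> U" "norm v0 = 1" using z0(1) K(2) by (auto simp: z0_eq)
  show ?thesis
  proof
    show "g q0 v0 v0 > 0" using q0 by (intro inner_prod.pos[OF ipr]) auto
    fix q v assume q: "q \<in> K"
    then have qU: "q \<in> U" using K by blast
    interpret inner_prod "g q" by (rule ipr[OF qU])
    show "g q0 v0 v0 * (norm v)\<^sup>2 \<le> g q v v"
    proof (cases "v = 0")
      case False
      have "g q0 v0 v0 \<le> g q ((1 / norm v) *\<^sub>R v) ((1 / norm v) *\<^sub>R v)"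
        using z0(2)[of "(q, (1 / norm v) *\<^sub>R v)"] q False unfolding z0_eq F[OF q0(2)] F[OF qU] by simp
      then show ?thesis using False by (simp add: Bscale power2_eq_square field_simps)
    qed simp
  qed
qed

end

section \<open>Short geodesics stay in a chart\<close>

context complete_mfd
begin

text \<open>The bounds hold because the speed of a geodesic, measured in the metric, is constant.\<close>

lemma short_geodesics_stay:
  fixes x :: 'm
  defines "c \<equiv> chart_at M x" 
  assumes r: "r > 0" "cball (chart_map c x) r \<subseteq> chart_img c"
  obtains A \<delta> where "A > 0" "\<delta> > 0"
    and "\<And>g t. geodesic M g \<Longrightarrow> g 0 = x \<Longrightarrow> norm (velocity M g 0) < \<delta> \<Longrightarrow> t \<in> {0..1} \<Longrightarrow>
      g t \<in> chart_dom c \<and> norm (chart_map c (g t) - chart_map c x) \<le> r \<and>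
      norm (chart_map c (g t) - chart_map c x) \<le> A * norm (velocity M g 0) \<and>
      norm (tch c (g t) (velocity M g t)) \<le> A * norm (velocity M g 0)"
proof -
  have c: "c \<in> atlas M" "x \<in> chart_dom c" by (simp_all add: c_def)
  let ?p = "chart_map c x"
  interpret local_metric "chart_metric M c" "chart_img c" by (rule chart_local_metric[OF c(1)])
  interpret x: inner_prod "metric M x" by (rule metric_inner_prod)
  obtain m where m: "m > 0" "\<And>q v. q \<in> cball ?p r \<Longrightarrow> m * (norm v)\<^sup>2 \<le> chart_metric M c q v v"
    using metric_lower_bound[OF compact_cball r(2)] r(1) by (metis cball_eq_empty not_less_iff_gr_or_eq)
  obtain C where C: "C > 0" "\<And>v. norm_wrt (metric M x) v \<le> C * norm v" by (rule x.nrm_equiv_upper) blast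
  define A where "A = C / sqrt m"
  have A: "A > 0" using C m by (simp add: A_def)
  \<comment> \<open>At coordinate speed at most \<open>A * \<delta>\<close> a unit of time covers at
    most \<open>r / 2\<close>. The other half of the radius separates \<open>Kc\<close> from the
    boundary of \<open>Q\<close>.\<close>
  define \<delta> where "\<delta> = r / (2 * A)"
  have \<delta>: "\<delta> > 0" using A r by (simp add: \<delta>_def)
  define Q where "Q = {y \<in> chart_dom c. chart_map c y \<in> ball ?p r}"
  have "Q = chart_dom c \<inter> chart_map c -` ball ?p r" by (auto simp: Q_def)
  then have "open Q"
    using continuous_open_preimage[OF continuous_chart_map[OF c(1)] open_chart_dom[OF c(1)] open_ball] by simp
  \<comment> \<open>Being compact, this image is closed in the Hausdorff manifold, so a curve that
    stays in it until some time is in it at that time. Arguing in coordinates alone would say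
    nothing about a curve leaving the chart domain.\<close>
  define Kc where "Kc = chart_inv c ` cball ?p (r / 2)"
  have sub: "cball ?p (r / 2) \<subseteq> chart_img c" using r by (intro order_trans[OF _ r(2)]) auto
  have "closed Kc" unfolding Kc_def
    using continuous_on_subset[OF continuous_chart_inv[OF c(1)] sub]
    by (intro compact_imp_closed compact_continuous_image) auto
  have KQ: "Kc \<subseteq> Q"
  proof
    fix y assume "y \<in> Kc"
    then obtain q where "y = chart_inv c q" "q \<in> cball ?p (r / 2)" unfolding Kc_def by blast
    then show "y \<in> Q" using sub c r unfolding Q_def by auto
  qed
  have speed: "norm (tch c (g t) (velocity M g t)) \<le> A * norm (velocity M g 0)"
    if g: "geodesic M g" "g 0 = x" and t: "0 \<le> t" "g t \<in> Q" for g t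
  proof -
    have d: "g t \<in> chart_dom c" "chart_map c (g t) \<in> cball ?p r" using t by (auto simp: Q_def)
    have "m * (norm (tch c (g t) (velocity M g t)))\<^sup>2 \<le> metric M (g t) (velocity M g t) (velocity M g t)"
      using m(2)[OF d(2), of "tch c (g t) (velocity M g t)"] by (simp add: chart_metric_map[OF c(1) d(1)])
    also have "\<dots> = (norm_wrt (metric M x) (velocity M g 0))\<^sup>2"
      using par_on_inner[OF g(1) geodesic_par_on[OF g(1)] geodesic_par_on[OF g(1)], of t 0 t] t(1)
      by (simp add: g(2) x.nrm_sq)
    also have "\<dots> \<le> (C * norm (velocity M g 0))\<^sup>2" using C(2) by (intro power_mono) auto
    finally have "(norm (tch c (g t) (velocity M g t)))\<^sup>2 \<le> (A * norm (velocity M g 0))\<^sup>2"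
      using m(1) by (simp add: A_def power_mult_distrib power_divide field_simps)
    then show ?thesis by (rule power2_le_imp_le) (use A in simp)
  qed
  have dist: "norm (chart_map c (g t) - ?p) \<le> A * norm (velocity M g 0) * t"
    if g: "geodesic M g" "g 0 = x" and t: "0 \<le> t" "\<And>q. 0 \<le> q \<Longrightarrow> q \<le> t \<Longrightarrow> g q \<in> Q" for g t
  proof -
    have "norm ((chart_map c \<circ> g) t - (chart_map c \<circ> g) 0) \<le> A * norm (velocity M g 0) * (t - 0)"
    proof (rule path_bound[where b = t and u' = "\<lambda>q. tch c (g q) (velocity M g q)"])
      fix q assume q: "q \<in> {0..t}"
      then have "g q \<in> Q" using t by auto
      then show "(chart_map c \<circ> g has_vector_derivative tch c (g q) (velocity M g q)) (at q within {0..t})"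
        by (intro has_vector_derivative_at_within[OF geodesic_chart_velocity[OF g(1) c(1)]]) (simp add: Q_def)
      show "norm (tch c (g q) (velocity M g q)) \<le> A * norm (velocity M g 0)"
        using speed[OF g _ \<open>g q \<in> Q\<close>] q by simp
    qed (use t in auto)
    then show ?thesis by (simp add: g(2))
  qed
  have inQ: "g t \<in> Q" if g: "geodesic M g" "g 0 = x" "norm (velocity M g 0) < \<delta>" and t: "t \<in> {0..1}" for g t
  proof (rule ccontr)
    assume "g t \<notin> Q"
    \<comment> \<open>\<open>Inf T\<close> is the first exit time. Before it the distance bound
      keeps the curve in \<open>Kc\<close>, and closedness extends this to the exit time itself,
      although \<open>Kc\<close> lies in \<open>Q\<close>.\<close>
    define T where "T = {0..1} \<inter> g -` (- Q)"
    have cg: "continuous_on UNIV g" using g by (simp add: geodesic_def)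
    have "closed T" unfolding T_def
      using \<open>open Q\<close> by (intro continuous_closed_preimage continuous_on_subset[OF cg]) auto
    moreover have "t \<in> T" using t \<open>g t \<notin> Q\<close> by (simp add: T_def)
    moreover have bb: "bdd_below T" by (auto simp: T_def intro!: bdd_belowI[of _ 0])
    ultimately have t0: "Inf T \<in> T" by (intro closed_contains_Inf) auto
    let ?t = "Inf T"
    have before: "g q \<in> Q" if "0 \<le> q" "q < ?t" for q
      using that t0 cInf_lower[OF _ bb, of q] by (auto simp: T_def not_less[symmetric])
    have "x \<in> Q" using c r by (simp add: Q_def)
    then have "?t \<noteq> 0" using t0 g by (auto simp: T_def)
    then have t1: "0 < ?t" "?t \<le> 1" using t0 by (auto simp: T_def)
    have "g q \<in> Kc" if q: "0 \<le> q" "q < ?t" for q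
    proof -
      have "norm (chart_map c (g q) - ?p) \<le> A * norm (velocity M g 0) * q"
        using q before by (intro dist g) auto
      also have "\<dots> \<le> A * \<delta> * 1" using g(3) A q t1 \<delta> by (intro mult_mono) auto
      also have "\<dots> = r / 2" using A by (simp add: \<delta>_def)
      finally have "chart_map c (g q) \<in> cball ?p (r / 2)" by (simp add: dist_norm norm_minus_commute)
      moreover have "g q = chart_inv c (chart_map c (g q))" using before[OF q] c by (simp add: Q_def)
      ultimately show ?thesis unfolding Kc_def by blast
    qed
    then have "{0..<?t} \<subseteq> g -` Kc" by auto
    moreover have "closed (g -` Kc)" by (rule closed_vimage[OF \<open>closed Kc\<close> cg])
    ultimately have "closure {0..<?t} \<subseteq> g -` Kc" by (rule closure_minimal)
    moreover have "?t \<in> closure {0..<?t}" using t1(1) by simp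
    ultimately have "g ?t \<in> Kc" by blast
    then show False using KQ t0 by (auto simp: T_def)
  qed
  show ?thesis
  proof (rule that[OF A \<delta>])
    fix g t assume g: "geodesic M g" "g 0 = x" "norm (velocity M g 0) < \<delta>" and t: "t \<in> {0..(1::real)}"
    have 1: "g t \<in> Q" by (rule inQ[OF g t])
    have "norm (chart_map c (g t) - ?p) \<le> A * norm (velocity M g 0) * t"
      using t by (intro dist g(1,2) inQ g) auto
    also have "\<dots> \<le> A * norm (velocity M g 0)" using t A by (intro mult_left_le) auto
    finally show "g t \<in> chart_dom c \<and> norm (chart_map c (g t) - chart_map c x) \<le> r \<and>
      norm (chart_map c (g t) - chart_map c x) \<le> A * norm (velocity M g 0) \<and>
      norm (tch c (g t) (velocity M g t)) \<le> A * norm (velocity M g 0)"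
      using 1 speed[OF g(1,2) _ 1] t by (auto simp: Q_def dist_norm norm_minus_commute)
  qed
qed

end

section \<open>Second-order expansion of the linearized geodesic equation\<close>

context local_metric
begin

text \<open>Here (q, y) is a geodesic with initial velocity s in phase space and (a, b) a solution of the
  linearized equation along it with initial value (0, w).\<close>

lemma linearized_geodesic_expansion:
  fixes q y a b :: "real \<Rightarrow> 'e"
  assumes G: "\<And>p u v. p \<in> U \<Longrightarrow> ((\<lambda>p. Gam p u v) has_derivative G p u v) (at p)"
    and r: "r \<ge> 0" "cball p r \<subseteq> U" and const: "C \<ge> 0" "A \<ge> 0" "E \<ge> 0" and s: "norm s \<le> 1"
    and Gam_le: "\<And>q u v. q \<in> cball p r \<Longrightarrow> norm (Gam q u v) \<le> C * norm u * norm v"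
    and G_le: "\<And>q u v h. q \<in> cball p r \<Longrightarrow> norm (G q u v h) \<le> C * norm u * norm v * norm h"
    and q: "\<And>t. t \<in> {0..1} \<Longrightarrow> q t \<in> cball p r" "\<And>t. t \<in> {0..1} \<Longrightarrow> norm (q t - p) \<le> A * norm s"
    and y: "\<And>t. t \<in> {0..1} \<Longrightarrow> norm (y t) \<le> A * norm s" "y 0 = s"
      "\<And>t. t \<in> {0..1} \<Longrightarrow> (y has_vector_derivative - Gam (q t) (y t) (y t)) (at t within {0..1})"
    and a: "\<And>t. t \<in> {0..1} \<Longrightarrow> norm (a t) \<le> E * norm w" "a 0 = 0"
      "\<And>t. t \<in> {0..1} \<Longrightarrow> (a has_vector_derivative b t) (at t within {0..1})"
    and b: "\<And>t. t \<in> {0..1} \<Longrightarrow> norm (b t) \<le> E * norm w" "b 0 = w"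
      "\<And>t. t \<in> {0..1} \<Longrightarrow> (b has_vector_derivative
          - (G (q t) (y t) (y t) (a t) + Gam (q t) (b t) (y t) + Gam (q t) (y t) (b t))) (at t within {0..1})"
  shows "norm (a 1 - w + Gam p s w) \<le>
    (C * A\<^sup>2 * E + 2 * (C * (C * E * (A\<^sup>2 + 2 * A)) * A + C * C * A\<^sup>2 + C * A)) * (norm s)\<^sup>2 * norm w"
proof -
  let ?n = "norm s * norm w" and ?m = "(norm s)\<^sup>2 * norm w"
  define g1 where "g1 t = G (q t) (y t) (y t) (a t)" for t
  define h where "h t = Gam (q t) (b t) (y t)" for t
  \<comment> \<open>\<open>B2\<close> bounds the deviation of \<open>b\<close> from \<open>w\<close>
    to first order in \<open>s\<close>, and \<open>B3\<close> the deviation of \<open>h\<close> from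
    the constant \<open>Gam p w s\<close> to second order.\<close>
  define B2 where "B2 = C * E * (A\<^sup>2 + 2 * A)"
  define B3 where "B3 = C * B2 * A + C * C * A\<^sup>2 + C * A"
  have B2: "B2 \<ge> 0" using const by (simp add: B2_def)
  have qU: "q t \<in> U" if "t \<in> {0..1}" for t using q(1)[OF that] r by blast
  have db: "(b has_vector_derivative - (g1 t + h t + h t)) (at t within {0..1})" if "t \<in> {0..1}" for t
    using b(3)[OF that] Gam_commute[OF qU[OF that], of "y t"] by (simp add: g1_def h_def)
  have gam: "norm (Gam (q t) u v) \<le> C * \<alpha> * \<beta>" if "t \<in> {0..1}" "norm u \<le> \<alpha>" "norm v \<le> \<beta>" for t u v \<alpha> \<beta>
  proof -
    have "norm (Gam (q t) u v) \<le> C * norm u * norm v" by (rule Gam_le[OF q(1)[OF that(1)]])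
    also have "\<dots> \<le> C * \<alpha> * \<beta>"
      using that(2,3) const(1) order_trans[OF norm_ge_zero that(2)] by (intro mult_mono mult_nonneg_nonneg) auto
    finally show ?thesis .
  qed
  have tri: "norm (u1 + u2 + u3) \<le> k1 + k2 + k3" if "norm u1 \<le> k1" "norm u2 \<le> k2" "norm u3 \<le> k3"
    for u1 u2 u3 :: 'e and k1 k2 k3
    using that norm_triangle_ineq[of "u1 + u2" u3] norm_triangle_ineq[of u1 u2] by linarith
  have g1: "norm (g1 t) \<le> C * A\<^sup>2 * E * ?m" if t: "t \<in> {0..1}" for t
  proof -
    have "norm (g1 t) \<le> C * norm (y t) * norm (y t) * norm (a t)"
      unfolding g1_def by (rule G_le[OF q(1)[OF t]])
    also have "\<dots> \<le> C * (A * norm s) * (A * norm s) * (E * norm w)"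
      using const y(1)[OF t] a(1)[OF t] by (intro mult_mono) auto
    finally show ?thesis by (simp add: power2_eq_square mult_ac)
  qed
  \<comment> \<open>Because \<open>norm s \<le> 1\<close>, quadratic terms in \<open>s\<close> may
    be counted as linear ones where first-order accuracy suffices.\<close>
  have "?m \<le> ?n" using s by (simp add: power2_eq_square mult_left_le mult_right_mono)
  then have "C * A\<^sup>2 * E * ?m \<le> C * A\<^sup>2 * E * ?n" using const by (intro mult_left_mono) auto
  note g1' = order_trans[OF g1 this]
  have h: "norm (h t) \<le> C * (E * norm w) * (A * norm s)" if "t \<in> {0..1}" for t
    unfolding h_def by (rule gam[OF that b(1)[OF that] y(1)[OF that]])
  have bw: "norm (b t - w) \<le> B2 * ?n" if t: "t \<in> {0..1}" for t
  proof -
    have "norm (b t - b 0) \<le> B2 * ?n"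
    proof (rule path_bound_unit[OF db _ t])
      fix t :: real assume t: "t \<in> {0..1}"
      show "norm (- (g1 t + h t + h t)) \<le> B2 * ?n"
        using tri[OF g1'[OF t] h[OF t] h[OF t]] by (simp only: norm_minus_cancel) (simp add: B2_def algebra_simps)
    qed
    then show ?thesis by (simp add: b)
  qed
  have ys: "norm (y t - s) \<le> C * (A * norm s) * (A * norm s)" if t: "t \<in> {0..1}" for t
    using path_bound_unit[OF y(3) _ t, of "C * (A * norm s) * (A * norm s)"] gam[OF _ y(1) y(1)] by (simp add: y(2))
  have Gp: "norm (Gam (q t) w s - Gam p w s) \<le> (C * norm w * norm s) * (A * norm s)" if t: "t \<in> {0..1}" for t
  proof -
    have "norm (Gam (q t) w s - Gam p w s) \<le> (C * norm w * norm s) * norm (q t - p)"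
    proof (rule differentiable_bound[where S = "cball p r" and f' = "\<lambda>q. G q w s"])
      show "((\<lambda>p. Gam p w s) has_derivative G q w s) (at q within cball p r)" if "q \<in> cball p r" for q
        using r that by (intro has_derivative_at_withinI[OF G]) auto
      show "onorm (G q w s) \<le> C * norm w * norm s" if "q \<in> cball p r" for q
        by (intro onorm_le G_le that)
    qed (use q(1)[OF t] r in auto)
    also have "\<dots> \<le> (C * norm w * norm s) * (A * norm s)" using q(2)[OF t] const by (intro mult_left_mono) auto
    finally show ?thesis .
  qed
  have hp: "norm (h t - Gam p w s) \<le> B3 * ?m" if t: "t \<in> {0..1}" for t
  proof -
    note lin = Gam_linear[OF qU[OF t]]
    have "h t - Gam p w s = Gam (q t) (b t - w) (y t) + Gam (q t) w (y t - s) + (Gam (q t) w s - Gam p w s)"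
      by (simp add: h_def linear_diff[OF lin(1)] linear_diff[OF lin(2)])
    also have "norm \<dots> \<le> C * (B2 * ?n) * (A * norm s) + C * norm w * (C * (A * norm s) * (A * norm s))
        + (C * norm w * norm s) * (A * norm s)"
      by (intro tri gam bw y ys Gp t order_refl)
    also have "\<dots> = B3 * ?m" by (simp add: B3_def power2_eq_square algebra_simps)
    finally show ?thesis .
  qed
  let ?B = "(C * A\<^sup>2 * E + 2 * B3) * ?m"
  \<comment> \<open>Up to second order the derivative of \<open>b\<close> is minus twice
    \<open>Gam p w s\<close>. One integration gives \<open>b\<close> close to
    \<open>w - 2 t Gam p w s\<close>, and the next one gives \<open>a\<close> close to
    \<open>t w - t^2 Gam p w s\<close>, which is taken at \<open>t = 1\<close>.\<close>
  have v: "norm (b t + (2 * t) *\<^sub>R Gam p w s - w) \<le> ?B" if t: "t \<in> {0..1}" for t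
  proof -
    have "norm ((b t + (2 * t) *\<^sub>R Gam p w s) - (b 0 + (2 * 0) *\<^sub>R Gam p w s)) \<le> ?B"
    proof (rule path_bound_unit[OF _ _ t])
      fix t :: real assume t: "t \<in> {0..1}"
      show "((\<lambda>t. b t + (2 * t) *\<^sub>R Gam p w s) has_vector_derivative - (g1 t + h t + h t) + 2 *\<^sub>R Gam p w s) (at t within {0..1})"
        by (intro has_vector_derivative_add db t) (auto intro!: derivative_eq_intros)
      have "- (g1 t + h t + h t) + 2 *\<^sub>R Gam p w s = - (g1 t + (h t - Gam p w s) + (h t - Gam p w s))"
        by (simp add: scaleR_2)
      then show "norm (- (g1 t + h t + h t) + 2 *\<^sub>R Gam p w s) \<le> ?B"
        using tri[OF g1[OF t] hp[OF t] hp[OF t]] by (simp only: norm_minus_cancel) (simp add: algebra_simps)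
    qed
    then show ?thesis by (simp add: b)
  qed
  have "norm ((a 1 + 1\<^sup>2 *\<^sub>R Gam p w s - 1 *\<^sub>R w) - (a 0 + 0\<^sup>2 *\<^sub>R Gam p w s - 0 *\<^sub>R w)) \<le> ?B"
  proof (rule path_bound_unit[OF _ v, where u = "\<lambda>t. a t + t\<^sup>2 *\<^sub>R Gam p w s - t *\<^sub>R w"])
    fix t :: real assume t: "t \<in> {0..1}"
    show "((\<lambda>t. a t + t\<^sup>2 *\<^sub>R Gam p w s - t *\<^sub>R w) has_vector_derivative b t + (2 * t) *\<^sub>R Gam p w s - w) (at t within {0..1})"
      by (intro has_vector_derivative_add has_vector_derivative_diff a t) (auto intro!: derivative_eq_intros)
  qed auto
  moreover have "p \<in> U" using r by auto
  ultimately show ?thesis by (simp add: a B2_def B3_def Gam_commute[of p w] algebra_simps)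
qed

end

section \<open>Differentiability of the exponential map in a chart\<close>

context complete_mfd
begin

text \<open>DF s w is the position component at time 1 of the solution of the linearized geodesic equation
  with initial value (0, w).\<close>

lemma Exp_chart_derivative:
  fixes x :: 'm
  defines "c \<equiv> chart_at M x" 
  obtains \<delta> C and DF :: "'e \<Rightarrow> 'e \<Rightarrow> 'e" where "\<delta> > 0" "C \<ge> 0"
    and "\<And>s. norm s < \<delta> \<Longrightarrow> Exp M x s \<in> chart_dom c"
    and "\<And>s. norm s < \<delta> \<Longrightarrow> ((\<lambda>s. chart_map c (Exp M x s)) has_derivative DF s) (at s)"
    and "\<And>s w. norm s < \<delta> \<Longrightarrow> norm (DF s w - w + Chr c (chart_map c x) s w) \<le> C * (norm s)\<^sup>2 * norm w"
proof -
  have c: "c \<in> atlas M" "x \<in> chart_dom c" by (simp_all add: c_def)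
  define p where "p = chart_map c x"
  have p: "p \<in> chart_img c" using c by (simp add: p_def)
  interpret local_metric "chart_metric M c" "chart_img c" by (rule chart_local_metric[OF c(1)])
  have ChrG: "Chr c = Gam" by (rule christoffel_Gam[OF c(1)])
  obtain r where r: "r > 0" "cball p r \<subseteq> chart_img c" using openU p open_contains_cball by blast
  obtain A \<delta>0 where A: "A > 0" and \<delta>0: "\<delta>0 > 0" and
    stay: "\<And>g t. geodesic M g \<Longrightarrow> g 0 = x \<Longrightarrow> norm (velocity M g 0) < \<delta>0 \<Longrightarrow> t \<in> {0..1} \<Longrightarrow>
      g t \<in> chart_dom c \<and> norm (chart_map c (g t) - p) \<le> r \<and>
      norm (chart_map c (g t) - p) \<le> A * norm (velocity M g 0) \<and>
      norm (tch c (g t) (velocity M g t)) \<le> A * norm (velocity M g 0)"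
    using short_geodesics_stay[of r x] r unfolding c_def p_def by metis
  obtain X' :: "'e \<times> 'e \<Rightarrow> ('e \<times> 'e) \<Rightarrow>\<^sub>L ('e \<times> 'e)" and G
    where X': "\<And>z. fst z \<in> chart_img c \<Longrightarrow> (spray has_derivative X' z) (at z)"
      and cX': "continuous_on (chart_img c \<times> UNIV) X'"
      and G: "\<And>p u v. p \<in> chart_img c \<Longrightarrow> ((\<lambda>p. Gam p u v) has_derivative G p u v) (at p)"
      and cG: "\<And>u v h. continuous_on (chart_img c) (\<lambda>p. G p u v h)"
      and X'_eq: "\<And>q v a b. q \<in> chart_img c \<Longrightarrow> X' (q, v) (a, b) = (b, - (G q v v a + Gam q b v + Gam q v b))"
    by (rule spray_has_derivative) blast
  obtain C0 where C0: "C0 > 0" and Gam_le: "\<And>q u v. q \<in> cball p r \<Longrightarrow> norm (Gam q u v) \<le> C0 * norm u * norm v"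
    and G_le: "\<And>q u v h. q \<in> cball p r \<Longrightarrow> norm (G q u v h) \<le> C0 * norm u * norm v * norm h"
    by (rule bounded_multilinear_on_compact[OF compact_cball r(2) G cG]) blast+
  \<comment> \<open>A compact convex region of phase space that contains, up to time 1, all
    geodesics with sufficiently short initial velocity.\<close>
  define K where "K = cball p r \<times> cball (0::'e) A"
  have K: "compact K" "convex K" "K \<subseteq> chart_img c \<times> UNIV"
    using r(2) by (auto simp: K_def intro!: compact_Times convex_Times)
  have "bounded (X' ` K)"
    using continuous_on_subset[OF cX' K(3)] K(1) compact_continuous_image compact_imp_bounded by blast
  then obtain L where L: "L > 0" "\<And>z. z \<in> K \<Longrightarrow> norm (X' z) \<le> L" unfolding bounded_pos by blast
  define E where "E = sqrt (exp (2 * L + 1))"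
  have E: "E > 0" by (simp add: E_def)
  \<comment> \<open>The bound 1 keeps coordinate velocities in \<open>cball 0 A\<close> and provides
    the \<open>norm s \<le> 1\<close> used by the expansion.\<close>
  define \<delta> where "\<delta> = min \<delta>0 1"
  have \<delta>: "\<delta> > 0" using \<delta>0 by (simp add: \<delta>_def)
  \<comment> \<open>Completeness supplies the family of solutions that forms the flow, and
    uniqueness of geodesics identifies its value at time 1 with \<open>Exp\<close>.\<close>
  have "\<exists>g. geodesic M g \<and> g 0 = x \<and> velocity M g 0 = s" for s by (rule geodesic_exists) blast
  then obtain \<gamma> where \<gamma>: "\<And>s. geodesic M (\<gamma> s)" "\<And>s. \<gamma> s 0 = x" "\<And>s. velocity M (\<gamma> s) 0 = s"
    by metis
  have Exp: "Exp M x s = \<gamma> s 1" for s using Exp_geodesic[OF \<gamma>(1)[of s] \<gamma>(2,3), of 1] by simp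
  define q where "q s t = chart_map c (\<gamma> s t)" for s t
  define y where "y s t = tch c (\<gamma> s t) (velocity M (\<gamma> s) t)" for s t
  define z where "z s t = (q s t, y s t)" for s t
  have dom: "\<gamma> s t \<in> chart_dom c" and q_r: "q s t \<in> cball p r"
    and q_le: "norm (q s t - p) \<le> A * norm s" and y_le: "norm (y s t) \<le> A * norm s"
    if "norm s < \<delta>" "t \<in> {0..1}" for s t
    using stay[OF \<gamma>(1) \<gamma>(2), of s t] that by (auto simp: \<delta>_def \<gamma>(3) q_def y_def dist_norm norm_minus_commute)
  have img: "q s t \<in> chart_img c" if "norm s < \<delta>" "t \<in> {0..1}" for s t using dom[OF that] c by (simp add: q_def)
  have zK: "z s t \<in> K" if "s \<in> ball 0 \<delta>" "t \<in> {0..1}" for s t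
  proof -
    have s: "norm s < \<delta>" using that by simp
    have "A * norm s \<le> A * 1" using s A by (intro mult_left_mono) (auto simp: \<delta>_def)
    then show ?thesis using q_r[OF s that(2)] y_le[OF s that(2)] by (simp add: K_def z_def)
  qed
  have dz: "(z s has_vector_derivative spray (z s t)) (at t within {0..1})" if "s \<in> ball 0 \<delta>" "t \<in> {0..1}" for s t
    unfolding z_def q_def y_def using that
    by (intro has_vector_derivative_at_within[OF geodesic_phase[OF \<gamma>(1) c(1) dom]]) auto
  have z0: "z s 0 = (p, 0) + (0, s)" for s
    by (simp add: z_def q_def y_def \<gamma> p_def) (simp add: c_def)
  have "\<exists>J. J 0 = (0, w) \<and> (\<forall>t\<in>{0..1}. (J has_vector_derivative X' (z s t) (J t)) (at t within {0..1}))"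
    if s: "s \<in> ball 0 \<delta>" for s w
  proof (rule linear_ode_exists)
    have "continuous_on {0..1} (z s)"
      unfolding continuous_on_eq_continuous_within using has_vector_derivative_continuous[OF dz[OF s]] by blast
    then show "continuous_on {0..1} (\<lambda>t. X' (z s t))"
      by (rule continuous_on_compose2[OF cX']) (use K(3) zK[OF s] in blast)
  qed simp
  then obtain J where J0: "\<And>s w. s \<in> ball 0 \<delta> \<Longrightarrow> J s w 0 = (0, w)"
    and J: "\<And>s w t. s \<in> ball 0 \<delta> \<Longrightarrow> t \<in> {0..1} \<Longrightarrow> (J s w has_vector_derivative X' (z s t) (J s w t)) (at t within {0..1})"
    by metis
  have deriv: "((\<lambda>s. z s 1) has_derivative (\<lambda>w. J s w 1)) (at s)" if s: "s \<in> ball 0 \<delta>" for s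
  proof (rule flow_has_derivative[OF K(1,2) _ continuous_on_subset[OF cX' K(3)] open_ball s zK dz z0])
    show "(spray has_derivative X' z) (at z within K)" if "z \<in> K" for z
      using K(3) that by (intro has_derivative_at_withinI[OF X']) auto
    show "bounded_linear (\<lambda>s::'e. (0::'e, s))" by (intro bounded_linear_Pair bounded_linear_zero bounded_linear_ident)
  qed (use J J0 s in auto)
  define B where "B = C0 * A\<^sup>2 * E + 2 * (C0 * (C0 * E * (A\<^sup>2 + 2 * A)) * A + C0 * C0 * A\<^sup>2 + C0 * A)"
  have B: "B \<ge> 0" using C0 E A by (simp add: B_def)
  have est: "norm (fst (J s w 1) - w + Gam p s w) \<le> B * (norm s)\<^sup>2 * norm w" if s: "norm s < \<delta>" for s w
    unfolding B_def
  proof (rule linearized_geodesic_expansion[where q = "q s" and y = "y s" and a = "\<lambda>t. fst (J s w t)" and b = "\<lambda>t. snd (J s w t)",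
        OF G less_imp_le[OF r(1)] r(2) _ _ _ _ Gam_le G_le])
    have sb: "s \<in> ball 0 \<delta>" using s by simp
    show "norm s \<le> 1" using s by (simp add: \<delta>_def)
    show "y s 0 = s" using z0[of s] by (simp add: z_def)
    show "fst (J s w 0) = 0" "snd (J s w 0) = w" by (simp_all add: J0[OF sb])
    fix t :: real assume t: "t \<in> {0..1}"
    show "norm (q s t - p) \<le> A * norm s" "norm (y s t) \<le> A * norm s" "q s t \<in> cball p r"
      using q_le y_le q_r s t by auto
    show "(y s has_vector_derivative - Gam (q s t) (y s t) (y s t)) (at t within {0..1})"
      using bounded_linear.has_vector_derivative[OF bounded_linear_snd dz[OF sb t]]
      by (simp add: z_def[abs_def] spray_def)
    have "X' (z s t) (J s w t) = X' (q s t, y s t) (fst (J s w t), snd (J s w t))" by (simp add: z_def)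
    note J' = J[OF sb t, of w, unfolded this X'_eq[OF img[OF s t]]]
    show "((\<lambda>t. fst (J s w t)) has_vector_derivative snd (J s w t)) (at t within {0..1})"
      using bounded_linear.has_vector_derivative[OF bounded_linear_fst J'] by simp
    show "((\<lambda>t. snd (J s w t)) has_vector_derivative - (G (q s t) (y s t) (y s t) (fst (J s w t))
        + Gam (q s t) (snd (J s w t)) (y s t) + Gam (q s t) (y s t) (snd (J s w t)))) (at t within {0..1})"
      using bounded_linear.has_vector_derivative[OF bounded_linear_snd J'] by simp
    have "(norm (J s w t))\<^sup>2 \<le> exp ((2 * L + 1) * (t - 0)) * ((norm (J s w 0))\<^sup>2 + 0\<^sup>2 * (t - 0))"
    proof (rule gronwall_sq[OF J[OF sb]])
      fix t :: real assume t: "t \<in> {0..1}"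
      have "norm (X' (z s t) (J s w t)) \<le> norm (X' (z s t)) * norm (J s w t)" by (rule norm_blinfun)
      also have "\<dots> \<le> L * norm (J s w t)" by (intro mult_right_mono L zK[OF sb t]) auto
      finally show "norm (X' (z s t) (J s w t)) \<le> L * norm (J s w t) + 0" by simp
    qed (use L t in auto)
    also have "\<dots> \<le> exp (2 * L + 1) * (norm w)\<^sup>2"
      using t L by (auto simp: J0[OF sb] norm_Pair intro!: mult_right_mono)
    also have "\<dots> = (E * norm w)\<^sup>2" by (simp add: E_def power_mult_distrib)
    finally have "norm (J s w t) \<le> E * norm w" by (rule power2_le_imp_le) (use E in simp)
    then show "norm (fst (J s w t)) \<le> E * norm w" "norm (snd (J s w t)) \<le> E * norm w"
      using norm_fst_le[of "fst (J s w t)" "snd (J s w t)"] norm_snd_le[of "snd (J s w t)" "fst (J s w t)"] by auto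
  qed (use C0 A E in auto)
  show ?thesis
  proof (rule that[OF \<delta> B])
    fix s :: 'e assume s: "norm s < \<delta>"
    show "Exp M x s \<in> chart_dom c" using dom[OF s, of 1] by (simp add: Exp)
    show "((\<lambda>s. chart_map c (Exp M x s)) has_derivative (\<lambda>w. fst (J s w 1))) (at s)"
      using has_derivative_fst[OF deriv[of s]] s by (simp add: Exp z_def q_def)
    show "norm (fst (J s w 1) - w + Chr c (chart_map c x) s w) \<le> B * (norm s)\<^sup>2 * norm w" for w
      using est[OF s] by (simp add: ChrG p_def)
  qed
qed

end

section \<open>Derivatives of the pullback at the origin\<close>

context C2_function
begin

text \<open>In the preferred chart at \<open>x\<close> the exponential map has the identity as its
  derivative at the origin and minus the Christoffel symbol as its second derivative. The latter is
  exactly the correction that turns the coordinate second derivative of \<open>f\<close> into the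
  covariant Hessian.\<close>

lemma pullback_derivatives:
  shows pullback_gradient: "gradient (metric M x) (\<lambda>u. f (Exp M x u)) 0 = rgrad M f x"
    and pullback_hessian: "hessian (metric M x) (\<lambda>u. f (Exp M x u)) 0 = rhess M f x"
proof -
  interpret inner_prod "metric M x" by (rule metric_inner_prod)
  define c where "c = chart_at M x"
  define p where "p = chart_map c x"
  have c: "c \<in> atlas M" "x \<in> chart_dom c" by (simp_all add: c_def)
  have p: "p \<in> chart_img c" using c by (simp add: p_def)
  let ?h = "\<lambda>u. f (Exp M x u)"
  define F where "F s = chart_map c (Exp M x s)" for s
  obtain \<delta> C DF where \<delta>: "\<delta> > 0" and C: "C \<ge> 0"
    and dom: "\<And>s. norm s < \<delta> \<Longrightarrow> Exp M x s \<in> chart_dom c"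
    and DF: "\<And>s. norm s < \<delta> \<Longrightarrow> (F has_derivative DF s) (at s)"
    and est: "\<And>s w. norm s < \<delta> \<Longrightarrow> norm (DF s w - w + Chr c p s w) \<le> C * (norm s)\<^sup>2 * norm w"
    using Exp_chart_derivative[of x] unfolding c_def p_def F_def[abs_def] by blast
  obtain g where g: "geodesic M g" "g 0 = x" "velocity M g 0 = 0" by (rule geodesic_exists)
  have "Exp M x 0 = x" using Exp_geodesic[OF g, of 0] g by simp
  then have F0: "F 0 = p" by (simp add: F_def p_def)
  have Fimg: "F s \<in> chart_img c" if "norm s < \<delta>" for s using dom[OF that] c by (simp add: F_def)
  note linC = Chr_linear[OF c(1) p]
  have DF0: "DF 0 w = w" for w using est[of 0 w] \<delta> linear_0[OF linC(1)] by simp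
  have dh: "(?h has_derivative (\<lambda>w. df c (F s) (DF s w))) (at s)" if s: "norm s < \<delta>" for s
  proof -
    have "((\<lambda>s. (f \<circ> chart_inv c) (F s)) has_derivative (\<lambda>w. df c (F s) (DF s w))) (at s)"
      by (rule has_derivative_compose[OF DF[OF s] df[OF c(1) Fimg[OF s]]])
    then show ?thesis
      by (rule has_derivative_transform_within_open[OF _ open_ball[of 0 \<delta>]])
         (use s dom c in \<open>auto simp: F_def\<close>)
  qed
  have grad: "metric M x (gradient (metric M x) ?h s) w = df c (F s) (DF s w)" if "s \<in> ball 0 \<delta>" for s w
    using that by (intro gradient_has_derivative(2) dh) simp
  have id: "tch c x v = v" for v by (simp add: c_def)
  have rg: "metric M x (rgrad M f x) w = df c p w" for w using rgrad_chart[OF c, of w] by (simp add: id p_def)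
  show "gradient (metric M x) ?h 0 = rgrad M f x"
    by (rule ext) (simp add: grad \<delta> F0 DF0 rg)
  \<comment> \<open>\<open>DF s w\<close> deviates from \<open>w - Chr c p s w\<close> only
    quadratically in \<open>s\<close>, which identifies its derivative at the origin.\<close>
  have dDF: "((\<lambda>s. DF s w) has_derivative (\<lambda>u. - Chr c p u w)) (at 0)" for w
    unfolding has_derivative_at_alt
  proof (intro conjI allI impI)
    show "bounded_linear (\<lambda>u. - Chr c p u w)"
      using linC(1)[of w] by (intro bounded_linear_minus) (simp add: linear_conv_bounded_linear)
    fix e :: real assume e: "e > 0"
    let ?k = "C * norm w + 1"
    have k: "?k > 0" using C by (simp add: add_nonneg_pos)
    show "\<exists>d>0. \<forall>y. norm (y - 0) < d \<longrightarrow> norm (DF y w - DF 0 w - - Chr c p (y - 0) w) \<le> e * norm (y - 0)"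
    proof (intro exI[of _ "min \<delta> (e / ?k)"] conjI allI impI)
      show "min \<delta> (e / ?k) > 0" using \<delta> e k by simp
      fix s :: 'e assume "norm (s - 0) < min \<delta> (e / ?k)"
      then have s: "norm s < \<delta>" "norm s * ?k < e" using k by (auto simp: field_simps)
      have "norm (DF s w - w + Chr c p s w) \<le> (norm s * (C * norm w)) * norm s"
        using est[OF s(1), of w] by (simp add: power2_eq_square mult_ac)
      also have "\<dots> \<le> e * norm s"
      proof (rule mult_right_mono)
        show "norm s * (C * norm w) \<le> e"
          using s(2) norm_ge_zero[of s] unfolding distrib_left mult_1_right by linarith
      qed simp
      finally show "norm (DF s w - DF 0 w - - Chr c p (s - 0) w) \<le> e * norm (s - 0)" by (simp add: DF0)
    qed
  qed
  have dk: "((\<lambda>s. df c (F s) (DF s w)) has_derivative (\<lambda>u. d2f c p w u + df c p (- Chr c p u w))) (at 0)" for w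
  proof -
    have "((\<lambda>s. df c (F s) (DF s w)) has_derivative (\<lambda>u. d2f c p (DF 0 w) (DF 0 u) + df c (F 0) (- Chr c p u w))) (at 0)"
      by (rule has_derivative_apply_linear[where A = "df c" and q = F and Y = "\<lambda>s. DF s w" and S = "chart_img c"])
         (use c p \<delta> in \<open>auto simp: F0 open_chart_img df_linear d2f intro!: dDF DF\<close>)
    then show ?thesis by (simp add: F0 DF0)
  qed
  have z0: "0 \<in> ball 0 \<delta>" using \<delta> by simp
  \<comment> \<open>All gradients of the pullback live in the single tangent space at
    \<open>x\<close>, so the inner product is constant and its derivative \<open>b'\<close> is
    zero.\<close>
  obtain z' where z': "(gradient (metric M x) ?h has_derivative z') (at 0)"
    and z'_eq: "\<And>u v. metric M x (z' u) v = (d2f c p v u + df c p (- Chr c p u v)) - 0"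
    by (rule solve_has_derivative[where b = "\<lambda>q. metric M x" and b' = "\<lambda>u v h. 0", OF open_ball z0 ip has_derivative_const dk grad], assumption) (rule that)
  have "z' u = rhess M f x u" for u
    by (rule ext) (simp add: z'_eq rhess_inner[OF c_def p_def] linear_neg[OF df_linear[OF c(1) p]])
  then have "z' = rhess M f x" by blast
  then show "hessian (metric M x) ?h 0 = rhess M f x"
    using frechet_derivative_at[OF z'] by (simp add: hessian_def)
qed

end

section \<open>The cubic model\<close>

context inner_prod
begin

context
  fixes h0 :: real and g0 :: 'e and H :: "'e \<Rightarrow> 'e" and \<sigma> :: real
  assumes H: "linear H" and sa: "\<And>u v. B (H u) v = B u (H v)"
begin

text \<open>At the origin the chain rule through the square root fails, but the function is of third
  order there; elsewhere the chain rule applies.\<close>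

lemma norm_cube_has_derivative: "((\<lambda>s. nrm s ^ 3) has_derivative (\<lambda>w. 3 * nrm s * B s w)) (at s)"
proof (cases "s = 0")
  case True
  obtain C where C: "C > 0" "\<And>v. nrm v \<le> C * norm v" by (rule nrm_equiv_upper) blast
  have "((\<lambda>s. nrm s ^ 3) has_derivative (\<lambda>w. 0)) (at 0)"
    unfolding has_derivative_at_alt
  proof (intro conjI allI impI)
    fix e :: real assume e: "e > 0"
    show "\<exists>d>0. \<forall>y. norm (y - 0) < d \<longrightarrow> norm (nrm y ^ 3 - nrm 0 ^ 3 - 0) \<le> e * norm (y - 0)"
    proof (intro exI[of _ "min 1 (e / C ^ 3)"] conjI allI impI)
      show "min 1 (e / C ^ 3) > 0" using e C by simp
      fix y :: 'e assume y: "norm (y - 0) < min 1 (e / C ^ 3)"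
      then have y1: "norm y \<le> 1" and y2: "C ^ 3 * norm y \<le> e" using C by (auto simp: field_simps)
      have "nrm y ^ 3 \<le> (C * norm y) ^ 3" by (intro power_mono C) auto
      also have "\<dots> = (C ^ 3 * norm y) * (norm y * norm y)" by (simp add: power3_eq_cube mult_ac)
      also have "\<dots> \<le> e * (norm y * 1)" using y1 y2 C e by (intro mult_mono) auto
      finally show "norm (nrm y ^ 3 - nrm 0 ^ 3 - 0) \<le> e * norm (y - 0)" by simp
    qed
  qed simp
  then show ?thesis using True by simp
next
  case False
  have "((\<lambda>s. B s s) has_derivative (\<lambda>w. B s w + B w s)) (at s)"
    by (rule bounded_bilinear.FDERIV[OF bounded_bil has_derivative_ident has_derivative_ident])
  from has_derivative_power[OF has_derivative_real_sqrt[OF _ this], of 3] pos[OF False]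
  have "((\<lambda>s. sqrt (B s s) ^ 3) has_derivative (\<lambda>w. 3 * ((B s w + B w s) * (inverse (sqrt (B s s)) / 2)) * sqrt (B s s) ^ 2)) (at s)"
    by (simp add: mult_ac)
  also have "(\<lambda>w. 3 * ((B s w + B w s) * (inverse (sqrt (B s s)) / 2)) * sqrt (B s s) ^ 2) = (\<lambda>w. 3 * nrm s * B s w)"
  proof
    fix w
    show "3 * ((B s w + B w s) * (inverse (sqrt (B s s)) / 2)) * sqrt (B s s) ^ 2 = 3 * nrm s * B s w"
    proof -
      have r: "sqrt (B s s) = nrm s" by (simp add: norm_wrt_def)
      show ?thesis unfolding r using nrm_pos[OF False] commute[of w s] by (simp add: power2_eq_square field_simps)
    qed
  qed
  finally show ?thesis unfolding norm_wrt_def .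
qed

lemma cubic_gradient:
  "gradient B (\<lambda>s. h0 + B s g0 + B s (H s) / 2 + \<sigma> / 3 * nrm s ^ 3) s = g0 + H s + (\<sigma> * nrm s) *\<^sub>R s"
proof (rule gradient_eqI)
  have blH: "bounded_linear H" using H by (simp add: linear_conv_bounded_linear)
  have 1: "((\<lambda>s. B s g0) has_derivative (\<lambda>w. B w g0)) (at s)"
    by (rule bounded_linear.has_derivative[OF bounded_bilinear.bounded_linear_left[OF bounded_bil] has_derivative_ident])
  have 2: "((\<lambda>s. B s (H s)) has_derivative (\<lambda>w. B s (H w) + B w (H s))) (at s)"
    by (rule bounded_bilinear.FDERIV[OF bounded_bil has_derivative_ident bounded_linear_imp_has_derivative[OF blH]])
  have "((\<lambda>s. h0 + B s g0 + B s (H s) / 2 + \<sigma> / 3 * nrm s ^ 3) has_derivative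
      (\<lambda>w. 0 + B w g0 + (B s (H w) + B w (H s)) / 2 + \<sigma> / 3 * (3 * nrm s * B s w))) (at s)"
    by (intro has_derivative_add has_derivative_const 1 bounded_linear.has_derivative[OF bounded_linear_divide 2]
        has_derivative_mult_right norm_cube_has_derivative)
  also have "(\<lambda>w. 0 + B w g0 + (B s (H w) + B w (H s)) / 2 + \<sigma> / 3 * (3 * nrm s * B s w)) = (\<lambda>w. B (g0 + H s + (\<sigma> * nrm s) *\<^sub>R s) w)"
  proof
    fix w
    show "0 + B w g0 + (B s (H w) + B w (H s)) / 2 + \<sigma> / 3 * (3 * nrm s * B s w) = B (g0 + H s + (\<sigma> * nrm s) *\<^sub>R s) w"
      using commute[of w g0] commute[of w "H s"] sa[of s w] by (simp add: Bsimps)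
  qed
  finally show "((\<lambda>s. h0 + B s g0 + B s (H s) / 2 + \<sigma> / 3 * nrm s ^ 3) has_derivative (\<lambda>w. B (g0 + H s + (\<sigma> * nrm s) *\<^sub>R s) w)) (at s)" .
qed

text \<open>At s = 0 the last summand vanishes because x / 0 = 0, in accordance with the fact that the
  cubic term is twice differentiable at the origin.\<close>

lemma cubic_hessian:
  "hessian B (\<lambda>s. h0 + B s g0 + B s (H s) / 2 + \<sigma> / 3 * nrm s ^ 3) s =
    (\<lambda>w. H w + \<sigma> *\<^sub>R (nrm s *\<^sub>R w + (B s w / nrm s) *\<^sub>R s))"
proof -
  have blH: "bounded_linear H" using H by (simp add: linear_conv_bounded_linear)
  have n: "((\<lambda>s. nrm s *\<^sub>R s) has_derivative (\<lambda>w. nrm s *\<^sub>R w + (B s w / nrm s) *\<^sub>R s)) (at s)"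
  proof (cases "s = 0")
    case True
    obtain C where C: "C > 0" "\<And>v. nrm v \<le> C * norm v" by (rule nrm_equiv_upper) blast
    have "((\<lambda>s. nrm s *\<^sub>R s) has_derivative (\<lambda>w. 0)) (at 0)"
      unfolding has_derivative_at_alt
    proof (intro conjI allI impI)
      fix e :: real assume e: "e > 0"
      show "\<exists>d>0. \<forall>y. norm (y - 0) < d \<longrightarrow> norm (nrm y *\<^sub>R y - nrm 0 *\<^sub>R 0 - 0) \<le> e * norm (y - 0)"
      proof (intro exI[of _ "e / C"] conjI allI impI)
        show "e / C > 0" using e C by simp
        fix y :: 'e assume y: "norm (y - 0) < e / C"
        have "nrm y \<le> C * norm y" by (rule C)
        also have "\<dots> \<le> e" using y C by (simp add: field_simps)
        finally show "norm (nrm y *\<^sub>R y - nrm 0 *\<^sub>R 0 - 0) \<le> e * norm (y - 0)" by (simp add: mult_right_mono)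
      qed
    qed simp
    then show ?thesis using True by simp
  next
    case False
    have "((\<lambda>s. B s s) has_derivative (\<lambda>w. B s w + B w s)) (at s)"
      by (rule bounded_bilinear.FDERIV[OF bounded_bil has_derivative_ident has_derivative_ident])
    from has_derivative_scaleR[OF has_derivative_real_sqrt[OF pos[OF False] this] has_derivative_ident]
    have "((\<lambda>s. nrm s *\<^sub>R s) has_derivative (\<lambda>w. nrm s *\<^sub>R w + ((B s w + B w s) * (inverse (nrm s) / 2)) *\<^sub>R s)) (at s)"
      unfolding norm_wrt_def by simp
    moreover have "(B s w + B w s) * (inverse (nrm s) / 2) = B s w / nrm s" for w
    proof -
      have "B w s = B s w" by (rule commute)
      then show ?thesis by (simp only: divide_inverse) simp
    qed
    ultimately show ?thesis by (simp only:)
  qed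
  have "((\<lambda>s. g0 + H s + \<sigma> *\<^sub>R (nrm s *\<^sub>R s)) has_derivative
      (\<lambda>w. 0 + H w + \<sigma> *\<^sub>R (nrm s *\<^sub>R w + (B s w / nrm s) *\<^sub>R s))) (at s)"
    by (rule has_derivative_add[OF has_derivative_add[OF has_derivative_const bounded_linear_imp_has_derivative[OF blH]]
        bounded_linear.has_derivative[OF bounded_linear_scaleR_right n]])
  then have "frechet_derivative (\<lambda>s. g0 + H s + \<sigma> *\<^sub>R (nrm s *\<^sub>R s)) (at s) =
      (\<lambda>w. 0 + H w + \<sigma> *\<^sub>R (nrm s *\<^sub>R w + (B s w / nrm s) *\<^sub>R s))" by (rule frechet_derivative_at[symmetric])
  moreover have "gradient B (\<lambda>s. h0 + B s g0 + B s (H s) / 2 + \<sigma> / 3 * nrm s ^ 3) = (\<lambda>s. g0 + H s + \<sigma> *\<^sub>R (nrm s *\<^sub>R s))"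
    unfolding cubic_gradient[abs_def] by simp
  ultimately show ?thesis unfolding hessian_def by simp
qed

text \<open>The cubic term adds at most \<open>2 * \<sigma> * nrm s * B v v\<close> to the quadratic
  form: one half comes from the multiple of the identity, the other from the rank-one part by
  Cauchy-Schwarz. The rest of the lower bound falls on \<open>H\<close>.\<close>

lemma cubic_hessian_eigenvalue_bound:
  assumes "min_eigenvalue (hessian B (\<lambda>s. h0 + B s g0 + B s (H s) / 2 + \<sigma> / 3 * nrm s ^ 3) s) \<ge> - \<theta> * nrm s"
    and \<sigma>: "\<sigma> \<ge> 0"
  shows "B v (H v) \<ge> - (\<theta> + 2 * \<sigma>) * nrm s * B v v"
proof -
  let ?A = "\<lambda>w. H w + \<sigma> *\<^sub>R (nrm s *\<^sub>R w + (B s w / nrm s) *\<^sub>R s)"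
  have lin: "linear ?A"
    by (rule linearI) (simp_all add: linear_add[OF H] linear_scale[OF H] Bsimps algebra_simps add_divide_distrib)
  have saA: "B (?A u) v = B u (?A v)" for u v
    by (simp add: Bsimps sa commute[of u s])
  have "- \<theta> * nrm s * B v v \<le> min_eigenvalue ?A * B v v"
    using assms(1) nonneg unfolding cubic_hessian by (rule mult_right_mono)
  also have "\<dots> \<le> B v (?A v)" by (rule min_eigenvalue_le[OF lin saA])
  also have "\<dots> = B v (H v) + \<sigma> * (nrm s * B v v) + \<sigma> * ((B s v)\<^sup>2 / nrm s)"
    by (simp add: Bsimps commute[of v s] power2_eq_square algebra_simps)
  finally have 1: "- \<theta> * nrm s * B v v \<le> B v (H v) + \<sigma> * (nrm s * B v v) + \<sigma> * ((B s v)\<^sup>2 / nrm s)" .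
  have "(B s v)\<^sup>2 / nrm s \<le> nrm s * B v v"
  proof (cases "s = 0")
    case False
    have "(B s v)\<^sup>2 \<le> (nrm s * nrm v)\<^sup>2"
      using power_mono[OF cauchy_schwarz[of s v], of 2] by simp
    also have "\<dots> = (nrm s * B v v) * nrm s"
      unfolding power_mult_distrib nrm_sq[of v] by (simp add: power2_eq_square)
    finally show ?thesis using nrm_pos[OF False] by (simp add: pos_divide_le_eq)
  qed simp
  from mult_left_mono[OF this \<sigma>] 1 show ?thesis by (simp add: algebra_simps)
qed

end

end

section \<open>One iteration of the algorithm\<close>

context lipschitz_hessian_function
begin

lemma cubic_model_eq:
  "cubic_model M (Exp M) f x \<sigma> = (\<lambda>s. f x + metric M x s (rgrad M f x) + metric M x s (rhess M f x s) / 2 + \<sigma> / 3 * mn x s ^ 3)"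
proof -
  obtain g where g: "geodesic M g" "g 0 = x" "velocity M g 0 = 0" by (rule geodesic_exists)
  have "Exp M x 0 = x" using Exp_geodesic[OF g, of 0] g by simp
  then show ?thesis by (simp add: fun_eq_iff cubic_model_def Let_def pullback_gradient pullback_hessian)
qed

context
  fixes x :: 'm and \<sigma> :: real and s :: 'e and P :: arc_params
  assumes fo: "first_order_progress M (Exp M) f P x \<sigma> s" and \<sigma>: "\<sigma> > 0"
begin

interpretation inner_prod "metric M x" by (rule metric_inner_prod)

text \<open>Decrease of the quadratic part of the model. The cubic term added in the denominator of
  \<open>arc_ratio\<close> makes that denominator equal to this quantity.\<close>

abbreviation (input) "dec \<equiv> - (metric M x s (rgrad M f x) + metric M x s (rhess M f x s) / 2)"

lemma dec_ge: "dec \<ge> \<sigma> / 3 * mn x s ^ 3"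
  using fo by (simp add: first_order_progress_def Let_def cubic_model_eq)

lemma arc_ratio_eq: "arc_ratio M (Exp M) f x \<sigma> s = (f x - f (Exp M x s)) / dec"
  by (simp add: arc_ratio_def Let_def cubic_model_eq add_divide_distrib)

lemma model_gradient_le: "mn x (rgrad M f x + rhess M f x s + (\<sigma> * mn x s) *\<^sub>R s) \<le> theta P * (mn x s)\<^sup>2"
  using fo unfolding first_order_progress_def Let_def cubic_model_eq cubic_gradient[OF rhess_linear rhess_self_adjoint] by simp

text \<open>The actual decrease falls short of \<open>dec\<close> by at most \<open>L / 6\<close>
  times the cubed step length, while \<open>dec\<close> is at least \<open>\<sigma> / 3\<close>
  times it. The threshold on \<open>\<sigma>\<close> is the condition
  \<open>L / 6 \<le> (1 - \<eta>) * \<sigma> / 3\<close>.\<close>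

lemma ratio_ge:
  assumes "s \<noteq> 0" "\<eta> < 1" "\<sigma> \<ge> L / (2 * (1 - \<eta>))"
  shows "arc_ratio M (Exp M) f x \<sigma> s \<ge> \<eta>"
proof -
  have n: "mn x s ^ 3 > 0" using nrm_pos[OF assms(1)] by simp
  then have D: "dec > 0" using dec_ge \<sigma> by (smt (verit) divide_pos_pos mult_pos_pos)
  obtain g where g: "geodesic M g" "g 0 = x" "velocity M g 0 = s" by (rule geodesic_exists)
  have E: "Exp M x s = g 1" using Exp_geodesic[OF g, of 1] by simp
  have 1: "f x - f (Exp M x s) \<ge> dec - L / 6 * mn x s ^ 3"
    using abs_le_D1[OF function_taylor[OF g]] commute[of "rgrad M f x" s] commute[of "rhess M f x s" s]
    unfolding E by linarith
  have "L \<le> (1 - \<eta>) * (2 * \<sigma>)" using assms(2,3) by (simp add: field_simps)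
  then have "L / 6 * mn x s ^ 3 \<le> (1 - \<eta>) * (\<sigma> / 3 * mn x s ^ 3)"
    using n by (simp add: mult_right_mono)
  also have "\<dots> \<le> (1 - \<eta>) * dec" using dec_ge assms(2) by (intro mult_left_mono) auto
  finally have "L / 6 * mn x s ^ 3 \<le> dec - \<eta> * dec" unfolding left_diff_distrib mult_1_left .
  then have "\<eta> * dec \<le> f x - f (Exp M x s)" using 1 by linarith
  then show ?thesis unfolding arc_ratio_eq using D by (simp only: pos_le_divide_eq)
qed

lemma successful_decrease:
  assumes "s \<noteq> 0" "\<eta> > 0" "arc_ratio M (Exp M) f x \<sigma> s \<ge> \<eta>"
  shows "f x - f (Exp M x s) \<ge> \<eta> * (\<sigma> / 3 * mn x s ^ 3)"
proof -
  have n: "mn x s ^ 3 > 0" using nrm_pos[OF assms(1)] by simp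
  then have D: "dec > 0" using dec_ge \<sigma> by (smt (verit) divide_pos_pos mult_pos_pos)
  have "\<eta> * (\<sigma> / 3 * mn x s ^ 3) \<le> \<eta> * dec" using dec_ge assms(2) by (intro mult_left_mono) auto
  also have "\<dots> \<le> f x - f (Exp M x s)"
    using assms(3) unfolding arc_ratio_eq using D by (simp only: pos_le_divide_eq)
  finally show ?thesis .
qed

text \<open>The three summands stem from the Taylor remainder of the gradient, the tolerance of the
  subproblem and the gradient of the cubic term. The new gradient is tested against transported
  vectors, so the comparison takes place at \<open>x\<close>.\<close>

lemma next_gradient: "mn (Exp M x s) (rgrad M f (Exp M x s)) \<le> (L / 2 + theta P + \<sigma>) * (mn x s)\<^sup>2"
proof -
  obtain g where g: "geodesic M g" "g 0 = x" "velocity M g 0 = s" by (rule geodesic_exists)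
  have E: "Exp M x s = g 1" using Exp_geodesic[OF g, of 1] by simp
  let ?P = "transport M x s" and ?y = "g 1"
  interpret y: inner_prod "metric M ?y" by (rule metric_inner_prod)
  show ?thesis unfolding E
  proof (rule y.dual_bound)
    fix v
    obtain w where w: "v = ?P w" using transport_bij[OF g] by (metis bij_pointE)
    have nw: "mn ?y (?P w) = mn x w" unfolding norm_wrt_def transport_inner[OF g] ..
    let ?G = "rgrad M f x + rhess M f x s"
    have "metric M x ?G w = metric M x (?G + (\<sigma> * mn x s) *\<^sub>R s) w - \<sigma> * mn x s * metric M x s w"
      by (simp add: Bsimps)
    then have "\<bar>metric M x ?G w\<bar> \<le> \<bar>metric M x (?G + (\<sigma> * mn x s) *\<^sub>R s) w\<bar> + \<sigma> * mn x s * \<bar>metric M x s w\<bar>"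
      using \<sigma> abs_triangle_ineq4[of "metric M x (?G + (\<sigma> * mn x s) *\<^sub>R s) w" "\<sigma> * mn x s * metric M x s w"] by (simp add: abs_mult)
    also have "\<dots> \<le> (theta P * (mn x s)\<^sup>2) * mn x w + \<sigma> * mn x s * (mn x s * mn x w)"
      using \<sigma> by (intro add_mono mult_left_mono cauchy_schwarz order_trans[OF cauchy_schwarz] mult_right_mono model_gradient_le) auto
    finally have "\<bar>metric M x ?G w\<bar> \<le> (theta P * (mn x s)\<^sup>2) * mn x w + \<sigma> * mn x s * (mn x s * mn x w)" .
    then show "\<bar>metric M ?y (rgrad M f ?y) v\<bar> \<le> (L / 2 + theta P + \<sigma>) * (mn x s)\<^sup>2 * mn ?y v"
      using abs_triangle_ineq2[of "metric M ?y (rgrad M f ?y) v" "metric M x ?G w"] gradient_taylor[OF g, of w] unfolding w nw by (simp add: power2_eq_square algebra_simps)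
  qed
qed

text \<open>An eigenvector at the new point is transported back to \<open>x\<close>. There the model
  condition bounds the Hessian form from below, where removing the cubic term costs
  \<open>2 * \<sigma>\<close> and the tolerance \<open>theta P\<close>; the Lipschitz condition
  costs \<open>L\<close>, all times the step length.\<close>

lemma next_hessian:
  assumes "second_order_progress M (Exp M) f P x \<sigma> s"
  shows "min_eigenvalue (rhess M f (Exp M x s)) \<ge> - (L + theta P + 2 * \<sigma>) * mn x s"
proof -
  obtain g where g: "geodesic M g" "g 0 = x" "velocity M g 0 = s" by (rule geodesic_exists)
  have E: "Exp M x s = g 1" using Exp_geodesic[OF g, of 1] by simp
  let ?P = "transport M x s" and ?y = "g 1"
  interpret y: inner_prod "metric M ?y" by (rule metric_inner_prod)
  have low: "metric M x v (rhess M f x v) \<ge> - (theta P + 2 * \<sigma>) * mn x s * metric M x v v" for v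
    using assms \<sigma> unfolding second_order_progress_def Let_def cubic_model_eq
    by (intro cubic_hessian_eigenvalue_bound[OF rhess_linear rhess_self_adjoint]) auto
  obtain v where v: "v \<noteq> 0" "rhess M f ?y v = min_eigenvalue (rhess M f ?y) *\<^sub>R v"
    using y.min_eigenvalue_attained[OF rhess_linear rhess_self_adjoint] by blast
  obtain w where w: "v = ?P w" using transport_bij[OF g] by (metis bij_pointE)
  have "(- (L + theta P + 2 * \<sigma>) * mn x s) * metric M x w w
      \<le> metric M x (rhess M f x w) w - L * mn x s * mn x w * mn x w"
    using low[of w] by (simp add: commute[of "rhess M f x w"] nrm_sq[of w, unfolded power2_eq_square, symmetric] algebra_simps)
  also have "\<dots> \<le> metric M ?y (rhess M f ?y v) v"
    using hessian_transport_diff[OF g, of w w] unfolding w by linarith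
  also have "\<dots> = min_eigenvalue (rhess M f ?y) * metric M x w w"
    unfolding v(2) by (simp add: y.Bscale w transport_inner[OF g])
  finally show ?thesis
    unfolding E using y.pos[OF v(1)] by (simp add: w transport_inner[OF g])
qed

text \<open>For a zero step the model gradient is the Riemannian gradient and the tolerance
  \<open>theta P * (mn x s)\<^sup>2\<close> is zero, so the algorithm terminates only at critical
  points.\<close>

lemma zero_step_gradient: "s = 0 \<Longrightarrow> rgrad M f x = 0"
  using model_gradient_le linear_0[OF rhess_linear[of x]] nrm_nonneg[of "rgrad M f x"] by simp

lemma zero_step_hessian:
  assumes "s = 0" "second_order_progress M (Exp M) f P x \<sigma> s"
  shows "min_eigenvalue (rhess M f x) \<ge> 0"
  using assms unfolding second_order_progress_def Let_def cubic_model_eq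
    cubic_hessian[OF rhess_linear rhess_self_adjoint] by simp

end

end

section \<open>Counting iterations\<close>

text \<open>The potential \<open>ln (\<sigma> k)\<close> falls by at most
  \<open>ln (1 / \<gamma>1)\<close> in a good step and rises by at least \<open>ln \<gamma>2\<close>
  in a bad one. Its final bound \<open>ln S\<close> limits the bad steps in terms of the good ones,
  and the decrease of \<open>\<phi>\<close> limits the good ones.\<close>

lemma iteration_count:
  fixes \<phi> \<sigma> :: "nat \<Rightarrow> real"
  assumes good: "\<And>k. k < K \<Longrightarrow> good k \<Longrightarrow> \<sigma> (Suc k) \<ge> \<gamma>1 * \<sigma> k \<and> \<phi> k - \<phi> (Suc k) \<ge> d"
    and bad: "\<And>k. k < K \<Longrightarrow> \<not> good k \<Longrightarrow> \<sigma> (Suc k) \<ge> \<gamma>2 * \<sigma> k \<and> \<phi> (Suc k) = \<phi> k"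
    and pos: "d > 0" "0 < \<gamma>1" "\<gamma>1 < 1" "\<gamma>2 > 1" "\<sigma> 0 > 0"
    and fin: "\<sigma> K \<le> S" "\<phi> K \<ge> low"
  shows "real K \<le> (1 + ln (1 / \<gamma>1) / ln \<gamma>2) * ((\<phi> 0 - low) / d) + ln (S / \<sigma> 0) / ln \<gamma>2"
proof -
  \<comment> \<open>\<open>a\<close> and \<open>b\<close> count the good and the bad steps among the
    first \<open>k\<close>.\<close>
  have "\<exists>a b. k = a + b \<and> real a * d \<le> \<phi> 0 - \<phi> k \<and> \<sigma> k > 0 \<and>
      ln (\<sigma> k) \<ge> ln (\<sigma> 0) + real a * ln \<gamma>1 + real b * ln \<gamma>2" if "k \<le> K" for k
    using that
  proof (induction k)
    case 0 then show ?case using pos by auto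
  next
    case (Suc k)
    then obtain a b where ab: "k = a + b" "real a * d \<le> \<phi> 0 - \<phi> k" "\<sigma> k > 0"
      "ln (\<sigma> k) \<ge> ln (\<sigma> 0) + real a * ln \<gamma>1 + real b * ln \<gamma>2" by auto
    show ?case
    proof (cases "good k")
      case True
      then have *: "\<sigma> (Suc k) \<ge> \<gamma>1 * \<sigma> k" "\<phi> k - \<phi> (Suc k) \<ge> d" using good Suc.prems by auto
      then have "ln (\<sigma> (Suc k)) \<ge> ln (\<gamma>1 * \<sigma> k)" using pos ab by (intro ln_mono) auto
      moreover have "\<sigma> (Suc k) > 0" using *(1) pos ab by (meson mult_pos_pos less_le_trans)
      ultimately show ?thesis using ab * pos
        by (intro exI[of _ "Suc a"] exI[of _ b]) (simp add: ln_mult algebra_simps)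
    next
      case False
      then have *: "\<sigma> (Suc k) \<ge> \<gamma>2 * \<sigma> k" "\<phi> (Suc k) = \<phi> k" using bad Suc.prems by auto
      then have "ln (\<sigma> (Suc k)) \<ge> ln (\<gamma>2 * \<sigma> k)" using pos ab by (intro ln_mono) auto
      moreover have "\<gamma>2 * \<sigma> k > 0" using pos ab by simp
      then have "\<sigma> (Suc k) > 0" using *(1) by linarith
      ultimately show ?thesis using ab * pos
        by (intro exI[of _ a] exI[of _ "Suc b"]) (simp add: ln_mult algebra_simps)
    qed
  qed
  from this[of K] obtain a b where ab: "K = a + b" "real a * d \<le> \<phi> 0 - \<phi> K" "\<sigma> K > 0"
    "ln (\<sigma> K) \<ge> ln (\<sigma> 0) + real a * ln \<gamma>1 + real b * ln \<gamma>2" by auto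
  have l2: "ln \<gamma>2 > 0" using pos by simp
  have "ln (\<sigma> K) \<le> ln S" using ab fin by simp
  moreover have "ln (1 / \<gamma>1) = - ln \<gamma>1" "ln (S / \<sigma> 0) = ln S - ln (\<sigma> 0)"
    using pos ab fin by (simp_all add: ln_div)
  ultimately have "real b * ln \<gamma>2 \<le> real a * ln (1 / \<gamma>1) + ln (S / \<sigma> 0)"
    using ab(4) by (simp only: mult_minus_right)
  then have b: "real b \<le> real a * (ln (1 / \<gamma>1) / ln \<gamma>2) + ln (S / \<sigma> 0) / ln \<gamma>2"
    using l2 by (simp add: field_simps)
  have a: "real a \<le> (\<phi> 0 - low) / d" using ab fin pos by (simp add: field_simps)
  have q: "ln (1 / \<gamma>1) / ln \<gamma>2 \<ge> 0" using pos l2 by (auto simp: ln_div intro!: divide_nonpos_pos)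
  have "real K \<le> (1 + ln (1 / \<gamma>1) / ln \<gamma>2) * real a + ln (S / \<sigma> 0) / ln \<gamma>2"
    using b ab(1) by (simp add: algebra_simps)
  also have "(1 + ln (1 / \<gamma>1) / ln \<gamma>2) * real a \<le> (1 + ln (1 / \<gamma>1) / ln \<gamma>2) * ((\<phi> 0 - low) / d)"
    using a q by (intro mult_left_mono) auto
  finally show ?thesis by simp
qed

section \<open>Regularization parameters and decrease along a run\<close>

locale arc_execution = lipschitz_hessian_function M f L
  for M :: "('m::{t2_space, second_countable_topology}, 'e::euclidean_space) riem" and f L +
  fixes P :: arc_params and x :: "nat \<Rightarrow> 'm" and s :: "nat \<Rightarrow> 'e" and \<sigma> :: "nat \<Rightarrow> real"
  assumes P: "valid_params P" and run: "arc_run M (Exp M) f P x s \<sigma>"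
begin

lemma params: "theta P > 0" "sigma_min P > 0" "0 < eta1 P" "eta1 P \<le> eta2 P" "eta2 P < 1"
  "0 < gamma1 P" "gamma1 P < 1" "1 < gamma2 P" "gamma2 P < gamma3 P"
  using P by (auto simp: valid_params_def)

abbreviation "\<rho> k \<equiv> arc_ratio M (Exp M) f (x k) (\<sigma> k) (s k)"
abbreviation "smax \<equiv> sigma_max P (\<sigma> 0) L"

lemma produced_Suc: "produced s (Suc k) \<longleftrightarrow> produced s k \<and> s k \<noteq> 0"
  by (auto simp: produced_def less_Suc_eq)

lemma first_order: "produced s k \<Longrightarrow> first_order_progress M (Exp M) f P (x k) (\<sigma> k) (s k)"
  using run by (simp add: arc_run_def)

lemma step:
  assumes "produced s (Suc k)"
  shows "x (Suc k) = (if \<rho> k \<ge> eta1 P then Exp M (x k) (s k) else x k)"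
    and "\<rho> k \<ge> eta2 P \<Longrightarrow> max (sigma_min P) (gamma1 P * \<sigma> k) \<le> \<sigma> (Suc k) \<and> \<sigma> (Suc k) \<le> \<sigma> k"
    and "\<not> \<rho> k \<ge> eta2 P \<Longrightarrow> \<rho> k \<ge> eta1 P \<Longrightarrow> \<sigma> k \<le> \<sigma> (Suc k) \<and> \<sigma> (Suc k) \<le> gamma2 P * \<sigma> k"
    and "\<not> \<rho> k \<ge> eta1 P \<Longrightarrow> gamma2 P * \<sigma> k \<le> \<sigma> (Suc k) \<and> \<sigma> (Suc k) \<le> gamma3 P * \<sigma> k"
  using run assms params(4) unfolding arc_run_def produced_Suc Let_def by (auto split: if_splits)

text \<open>Only very successful iterations may lower the parameter, and those are clipped at
  \<open>sigma_min P\<close>.\<close>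

lemma sigma_lower: "produced s k \<Longrightarrow> sigma_min P \<le> \<sigma> k"
proof (induction k)
  case 0 then show ?case using run by (simp add: arc_run_def)
next
  case (Suc k)
  then have IH: "sigma_min P \<le> \<sigma> k" by (simp add: produced_Suc)
  then have "\<sigma> k > 0" using params(2) by linarith
  then have "1 * \<sigma> k \<le> gamma2 P * \<sigma> k" using params(8) by (intro mult_right_mono) auto
  then show ?case using IH step(2-4)[OF Suc.prems] params(4) by fastforce
qed

lemma sigma_pos: "produced s k \<Longrightarrow> \<sigma> k > 0"
  using sigma_lower params(2) by fastforce

text \<open>An iteration that is not very successful has \<open>\<sigma> k\<close> below the
  threshold of \<open>ratio_ge\<close>, and one update multiplies it by at most
  \<open>gamma3 P\<close>. This is the second entry of the maximum in
  \<open>sigma_max\<close>.\<close>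

lemma sigma_upper: "produced s k \<Longrightarrow> \<sigma> k \<le> smax"
proof (induction k)
  case 0 then show ?case by (simp add: sigma_max_def)
next
  case (Suc k)
  then have IH: "\<sigma> k \<le> smax" and pk: "produced s k" and sk: "s k \<noteq> 0" by (auto simp: produced_Suc)
  show ?case
  proof (cases "\<rho> k \<ge> eta2 P")
    case True then show ?thesis using step(2)[OF Suc.prems] IH by linarith
  next
    case False
    then have "\<sigma> k < L / (2 * (1 - eta2 P))"
      using ratio_ge[OF first_order[OF pk] sigma_pos[OF pk] sk params(5)] by linarith
    then have "gamma3 P * \<sigma> k \<le> gamma3 P * (L / (2 * (1 - eta2 P)))" using params(8,9) by (intro mult_left_mono) auto
    moreover have "\<sigma> (Suc k) \<le> gamma3 P * \<sigma> k"
      using step(3,4)[OF Suc.prems] False sigma_pos[OF pk] params(9) mult_right_mono[of "gamma2 P" "gamma3 P" "\<sigma> k"] by fastforce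
    ultimately show ?thesis by (simp add: sigma_max_def)
  qed
qed

lemma step_decrease:
  assumes k: "produced s (Suc k)" and succ: "\<rho> k \<ge> eta1 P"
  shows "f (x k) - f (x (Suc k)) \<ge> eta1 P * (sigma_min P / 3 * mn (x k) (s k) ^ 3)"
proof -
  have pk: "produced s k" "s k \<noteq> 0" using k by (auto simp: produced_Suc)
  have "eta1 P * (sigma_min P / 3 * mn (x k) (s k) ^ 3) \<le> eta1 P * (\<sigma> k / 3 * mn (x k) (s k) ^ 3)"
    using sigma_lower[OF pk(1)] params inner_prod.nrm_nonneg[OF metric_inner_prod]
    by (intro mult_left_mono mult_right_mono) auto
  also have "\<dots> \<le> f (x k) - f (x (Suc k))"
    using successful_decrease[OF first_order sigma_pos pk(2) params(3) succ] step(1)[OF k] pk(1) succ by simp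
  finally show ?thesis .
qed

lemma f_decreasing: "produced s k \<Longrightarrow> f (x k) \<le> f (x 0)"
proof (induction k)
  case (Suc k)
  then have IH: "f (x k) \<le> f (x 0)" by (simp add: produced_Suc)
  show ?case
  proof (cases "\<rho> k \<ge> eta1 P")
    case True
    have "0 \<le> eta1 P * (sigma_min P / 3 * mn (x k) (s k) ^ 3)"
      using params inner_prod.nrm_nonneg[OF metric_inner_prod] by simp
    then show ?thesis using step_decrease[OF Suc.prems True] IH by linarith
  qed (use step(1)[OF Suc.prems] IH in simp)
qed simp

end

section \<open>Iteration complexity\<close>

context arc_execution
begin

text \<open>The implication covers runs with and without second-order progress, so the counting is
  done once for both.\<close>

definition "approx_critical \<epsilon> k \<longleftrightarrow> mn (x k) (rgrad M f (x k)) \<le> \<epsilon> \<and>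
  (second_order_enforced M (Exp M) f P x s \<sigma> \<longrightarrow> min_eigenvalue (rhess M f (x k)) \<ge> - sqrt \<epsilon>)"

text \<open>A zero step occurs only where the gradient vanishes and, under second-order progress,
  the Hessian has no negative eigenvalue. Hence the run cannot stop before an approximately critical
  iterate.\<close>

lemma produced_step:
  assumes k: "produced s k" and "\<not> approx_critical \<epsilon> k" and "\<epsilon> > 0"
  shows "produced s (Suc k)"
proof -
  have "s k \<noteq> 0"
  proof
    assume 0: "s k = 0"
    have "mn (x k) (rgrad M f (x k)) \<le> \<epsilon>"
      using zero_step_gradient[OF first_order[OF k] sigma_pos[OF k] 0] inner_prod.nrm_zero[OF metric_inner_prod] assms(3) by simp
    moreover have "min_eigenvalue (rhess M f (x k)) \<ge> - sqrt \<epsilon>" if "second_order_enforced M (Exp M) f P x s \<sigma>"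
    proof -
      have "second_order_progress M (Exp M) f P (x k) (\<sigma> k) (s k)"
        using that k by (simp add: second_order_enforced_def)
      from zero_step_hessian[OF first_order[OF k] sigma_pos[OF k] 0 this] show ?thesis
        using assms(3) by (meson neg_le_0_iff_le order_trans real_sqrt_ge_zero less_imp_le)
    qed
    ultimately show False using assms(2) by (simp add: approx_critical_def)
  qed
  then show ?thesis using k by (simp add: produced_Suc)
qed

text \<open>Failure at the arrival point is either a large gradient, which bounds the squared step
  length below by a multiple of \<epsilon>, or a very negative eigenvalue, which bounds the step
  length below by a multiple of \<open>sqrt \<epsilon>\<close>. The summand 1 makes the constant at
  most its square, so that one constant serves both cases.\<close>

lemma long_step:
  assumes k: "produced s (Suc k)" and succ: "\<rho> k \<ge> eta1 P" and nc: "\<not> approx_critical \<epsilon> (Suc k)" and \<epsilon>: "\<epsilon> > 0"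
  shows "\<epsilon> powr (3/2) \<le> (1 + theta P + L + 2 * smax) ^ 3 * mn (x k) (s k) ^ 3"
proof -
  let ?n = "mn (x k) (s k)" and ?C = "1 + theta P + L + 2 * smax"
  have pk: "produced s k" using k by (simp add: produced_Suc)
  have n: "?n \<ge> 0" by (rule inner_prod.nrm_nonneg[OF metric_inner_prod])
  have E: "x (Suc k) = Exp M (x k) (s k)" using step(1)[OF k] succ by simp
  have \<sigma>: "\<sigma> k > 0" "\<sigma> k \<le> smax" using sigma_pos[OF pk] sigma_upper[OF pk] by auto
  have C: "?C \<ge> 1" using L_nonneg params(1) \<sigma> by linarith
  have "sqrt \<epsilon> \<le> ?C * ?n"
  proof (cases "mn (x (Suc k)) (rgrad M f (x (Suc k))) \<le> \<epsilon>")
    case False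
    then have "\<epsilon> \<le> (L / 2 + theta P + \<sigma> k) * ?n\<^sup>2"
      using next_gradient[OF first_order[OF pk] \<sigma>(1)] by (simp add: E)
    also have "\<dots> \<le> ?C * ?n\<^sup>2" using L_nonneg \<sigma> by (intro mult_right_mono) auto
    also have "\<dots> \<le> ?C\<^sup>2 * ?n\<^sup>2"
      using C by (intro mult_right_mono) (auto simp: power2_eq_square)
    also have "\<dots> = (?C * ?n)\<^sup>2" by (simp add: power_mult_distrib)
    finally have "(sqrt \<epsilon>)\<^sup>2 \<le> (?C * ?n)\<^sup>2" using \<epsilon> by simp
    then show ?thesis by (rule power2_le_imp_le) (use C n in simp)
  next
    case True
    then have so: "second_order_enforced M (Exp M) f P x s \<sigma>"
      and low: "min_eigenvalue (rhess M f (x (Suc k))) < - sqrt \<epsilon>" using nc by (auto simp: approx_critical_def)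
    have "second_order_progress M (Exp M) f P (x k) (\<sigma> k) (s k)"
      using so pk by (simp add: second_order_enforced_def)
    from next_hessian[OF first_order[OF pk] \<sigma>(1) this] low
    have "sqrt \<epsilon> \<le> (L + theta P + 2 * \<sigma> k) * ?n" unfolding E mult_minus_left by linarith
    also have "\<dots> \<le> ?C * ?n" using \<sigma> n by (intro mult_right_mono) auto
    finally show ?thesis .
  qed
  then have "sqrt \<epsilon> ^ 3 \<le> (?C * ?n) ^ 3" using \<epsilon> by (intro power_mono) auto
  moreover have "sqrt \<epsilon> ^ 3 = \<epsilon> powr (3/2)"
    using \<epsilon> by (simp add: powr_half_sqrt[symmetric] powr_power)
  ultimately show ?thesis by (simp add: power_mult_distrib)
qed

definition "iter_bound \<epsilon> f_low = (1 + ln (1 / gamma1 P) / ln (gamma2 P)) *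
   (3 * (1 + theta P + L + 2 * smax) ^ 3 * (f (x 0) - f_low) / (eta1 P * sigma_min P) * \<epsilon> powr (-3/2))
   + ln (smax / \<sigma> 0) / ln (gamma2 P)"

text \<open>The hypothesis reaches \<open>k = K\<close> because iteration \<open>K - 1\<close> is
  judged by its arrival point \<open>x K\<close>. The run goes on to \<open>Suc K\<close>, since the
  step taken at the noncritical \<open>x K\<close> is nonzero too.\<close>

lemma noncritical_count:
  assumes low: "\<And>y. f y \<ge> f_low" and \<epsilon>: "\<epsilon> > 0" and nc: "\<And>k. k \<le> K \<Longrightarrow> \<not> approx_critical \<epsilon> k"
  shows "produced s (Suc K)" and "real K \<le> iter_bound \<epsilon> f_low"
proof -
  have prod: "produced s (Suc k)" if "k \<le> K" for k
    using that
  proof (induction k)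
    case 0 show ?case by (rule produced_step[OF _ nc \<epsilon>]) (auto simp: produced_def)
  next
    case (Suc k) then show ?case using produced_step[OF _ nc[of "Suc k"] \<epsilon>] by simp
  qed
  then show "produced s (Suc K)" by simp
  define C where "C = 1 + theta P + L + 2 * smax"
  have p0: "produced s 0" by (simp add: produced_def)
  have \<sigma>0: "\<sigma> 0 > 0" "\<sigma> 0 \<le> smax" using sigma_pos[OF p0] sigma_upper[OF p0] by auto
  have C: "C > 0" using L_nonneg params(1) \<sigma>0 by (simp add: C_def)
  \<comment> \<open>The decrease guaranteed by a successful iteration: \<open>step_decrease\<close>
    with the step length from \<open>long_step\<close>.\<close>
  define d where "d = eta1 P * (sigma_min P / 3 * (\<epsilon> powr (3/2) / C ^ 3))"
  have d: "d > 0" using params C \<epsilon> by (simp add: d_def)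
  have "real K \<le> (1 + ln (1 / gamma1 P) / ln (gamma2 P)) * ((f (x 0) - f_low) / d) + ln (smax / \<sigma> 0) / ln (gamma2 P)"
  proof (rule iteration_count[where \<phi> = "\<lambda>k. f (x k)" and good = "\<lambda>k. \<rho> k \<ge> eta1 P"])
    fix k assume k: "k < K"
    have pk: "produced s (Suc k)" using prod k by simp
    then have \<sigma>k: "\<sigma> k > 0" using sigma_pos by (simp add: produced_Suc)
    { assume succ: "\<rho> k \<ge> eta1 P"
      have "gamma1 P * \<sigma> k \<le> 1 * \<sigma> k" using params(7) \<sigma>k by (intro mult_right_mono) auto
      then have "gamma1 P * \<sigma> k \<le> \<sigma> (Suc k)" using step(2,3)[OF pk] succ by fastforce
      moreover have "\<epsilon> powr (3/2) / C ^ 3 \<le> mn (x k) (s k) ^ 3"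
        using long_step[OF pk succ nc[OF Suc_leI[OF k]] \<epsilon>, folded C_def] C
        by (simp add: pos_divide_le_eq mult.commute)
      then have "d \<le> eta1 P * (sigma_min P / 3 * mn (x k) (s k) ^ 3)"
        unfolding d_def using params by (intro mult_left_mono) auto
      then have "d \<le> f (x k) - f (x (Suc k))" using step_decrease[OF pk succ] by linarith
      ultimately show "\<sigma> (Suc k) \<ge> gamma1 P * \<sigma> k \<and> f (x k) - f (x (Suc k)) \<ge> d" by simp }
    { assume "\<not> \<rho> k \<ge> eta1 P"
      then show "\<sigma> (Suc k) \<ge> gamma2 P * \<sigma> k \<and> f (x (Suc k)) = f (x k)"
        using step(1,4)[OF pk] by simp }
  next
    have "produced s K" using prod[of K] by (simp add: produced_Suc)
    then show "\<sigma> K \<le> smax" by (rule sigma_upper)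
  qed (use d params \<sigma>0 low in auto)
  also have "(f (x 0) - f_low) / d = 3 * C ^ 3 * (f (x 0) - f_low) / (eta1 P * sigma_min P) * \<epsilon> powr (-3/2)"
    using \<epsilon> by (simp add: d_def powr_minus field_simps)
  finally show "real K \<le> iter_bound \<epsilon> f_low" by (simp add: iter_bound_def C_def)
qed

lemma exists_approx_critical:
  assumes low: "\<And>y. f y \<ge> f_low" and \<epsilon>: "\<epsilon> > 0"
  shows "\<exists>k. produced s k \<and> approx_critical \<epsilon> k \<and>
    real k \<le> arc_const P (\<sigma> 0) L (f (x 0) - f_low) * (1 + \<epsilon> powr (-3/2)) * (1 + \<bar>ln \<epsilon>\<bar>)"
proof -
  let ?T = "iter_bound \<epsilon> f_low"
  have "\<exists>k. approx_critical \<epsilon> k"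
  proof (rule ccontr)
    assume "\<not> (\<exists>k. approx_critical \<epsilon> k)"
    then have "real K \<le> ?T" for K using noncritical_count(2)[OF low \<epsilon>] by blast
    then show False by (meson not_le reals_Archimedean2)
  qed
  define k where "k = (LEAST k. approx_critical \<epsilon> k)"
  have crit: "approx_critical \<epsilon> k" unfolding k_def using \<open>\<exists>k. _\<close> by (rule LeastI_ex)
  have nc: "\<not> approx_critical \<epsilon> j" if "j < k" for j using that unfolding k_def by (rule not_less_Least)
  have p0: "produced s 0" by (simp add: produced_def)
  define A where "A = 1 + ln (1 / gamma1 P) / ln (gamma2 P)"
  define N where "N = 3 * (1 + theta P + L + 2 * smax) ^ 3 * (f (x 0) - f_low) / (eta1 P * sigma_min P)"
  define B where "B = ln (smax / \<sigma> 0) / ln (gamma2 P)"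
  define e where "e = \<epsilon> powr (-3/2)"
  have \<sigma>0: "\<sigma> 0 > 0" "\<sigma> 0 \<le> smax" using sigma_pos[OF p0] sigma_upper[OF p0] by auto
  have A: "A \<ge> 0" using params by (simp add: A_def)
  have N: "N \<ge> 0" unfolding N_def using params L_nonneg \<sigma>0 low[of "x 0"]
    by (intro divide_nonneg_nonneg mult_nonneg_nonneg zero_le_power) auto
  have B: "B \<ge> 0" unfolding B_def using params \<sigma>0 by (intro divide_nonneg_nonneg ln_ge_zero) auto
  have e: "e \<ge> 0" by (simp add: e_def)
  have T: "?T = A * (N * e) + B" by (simp add: iter_bound_def A_def N_def B_def e_def)
  have const: "arc_const P (\<sigma> 0) L (f (x 0) - f_low) = A * N + B + 1"
    by (simp add: arc_const_def A_def N_def B_def)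
  \<comment> \<open>The count applies to \<open>K = k - 1\<close>, the last index known to be
    noncritical; the missing iteration is the summand 1 in \<open>arc_const\<close>.\<close>
  have "produced s k \<and> real k \<le> ?T + 1"
  proof (cases k)
    case 0 then show ?thesis using p0 A N B e by (simp add: T)
  next
    case (Suc K)
    then have "\<not> approx_critical \<epsilon> j" if "j \<le> K" for j using nc that by simp
    from noncritical_count[OF low \<epsilon> this] show ?thesis using Suc by simp
  qed
  \<comment> \<open>Expanding the product on the right adds only nonnegative cross terms to the
    left-hand side.\<close>
  moreover have "?T + 1 \<le> (A * N + B + 1) * (1 + e)"
    using A N B e by (simp add: T algebra_simps)
  moreover have "\<dots> * 1 \<le> (A * N + B + 1) * (1 + e) * (1 + \<bar>ln \<epsilon>\<bar>)"
    using A N B e by (intro mult_left_mono) auto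
  ultimately show ?thesis using crit unfolding const e_def[symmetric] by (intro exI[of _ k]) auto
qed

end

theorem theorem1:
  fixes M :: "('m::{t2_space, second_countable_topology}, 'e::euclidean_space) riem"
    and f :: "'m \<Rightarrow> real"
    and f_low L \<epsilon> :: real
    and P :: arc_params
    and x :: "nat \<Rightarrow> 'm" and s :: "nat \<Rightarrow> 'e" and \<sigma> :: "nat \<Rightarrow> real"
  assumes "complete_riemannian_manifold M"
    and "C2_on_manifold M f"
    and "\<And>y. f y \<ge> f_low"
    and "lipschitz_hessian M f L"
    and "valid_params P"
    and "arc_run M (Exp M) f P x s \<sigma>"
    and "\<epsilon> > 0"
  shows "\<exists>k. produced s k \<and>
           f (x k) \<le> f (x 0) \<and>
           norm_wrt (metric M (x k)) (rgrad M f (x k)) \<le> \<epsilon> \<and>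
           (second_order_enforced M (Exp M) f P x s \<sigma> \<longrightarrow>
              min_eigenvalue (rhess M f (x k)) \<ge> - sqrt \<epsilon>) \<and>
           real k \<le> arc_const P (\<sigma> 0) L (f (x 0) - f_low)
                      * (1 + \<epsilon> powr (-3/2)) * (1 + \<bar>ln \<epsilon>\<bar>)"
proof -
  interpret arc_execution M f L P x s \<sigma>
    using assms(1,2,4-6) by unfold_locales
  show ?thesis
    using exists_approx_critical[OF assms(3,7)] f_decreasing unfolding approx_critical_def by blast
qed

end
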